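(* Let $G,\mathcal{K},\kappa>0$, $\nu\in(-1,1/2]$ and $\gamma=4/3$. Suppose $\alpha>0$ and $1<\beta\le 4/3$. Let $\omega$ be the solution of $\omega^2\ddot\omega=\frac{4\pi G}{3}\mathcal{K}\alpha$, $\omega(0)=1$, $\dot\omega(0)=0$. For every $\delta_0^c>0$, let $(\delta_0,\eta_0)$ be the strongly regular solution, with maximal interval of existence $[0,Z_{\max})$ and $\delta_0(0)=\eta_0(0)=\delta_0^c$, of $$\delta_0'=\left(\frac{\delta_0}{\eta_0}\right)^{1-\beta}\left(\frac{3(\beta-4/3)}{z}B(\delta_0/\eta_0)\,\eta_0-\theta z\,\eta_0^{-1/3}\delta_0(\eta_0+\alpha)\right),\qquad \eta_0'=-\frac3z(\eta_0-\delta_0),$$ and let $y_0=\delta_0/\eta_0$. Then $Z_{\max}<\infty$, $0<y_0(z)<1$ for $z\in(0,Z_{\max})$, and $y_0(z)\to0^+$ as $z\to Z_{\max}^-$. In this case there exists a unique continuously expanding homologous self-gravitating polytropic elastic ball $(\rho,p_{\mathrm{rad}},p_{\mathrm{tan}},u)$ (with constant $\alpha$) of type $\mathrm{A}$ with central density $\rho(t,0)=\mathcal{K}\delta_0^c/\omega(t)^3$ and radius $R(t)=Z\omega(t)$, where $Z\in(0,Z_{\max})$ is the first solution of $y_0(Z)=y_{\mathrm b}$. Moreover $p_{\mathrm{tan}}(t,r)\ge p_{\mathrm{rad}}(t,r)$ holds for all times $t\ge0$ in the interior $r<R(t)$ of the ball.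
   Context: Constants: $G$ (Newton's constant), $\mathcal{K}$ (reference density), $\kappa$ (bulk modulus), $\nu$ (Poisson ratio), $\gamma=4/3$ (polytropic exponent), $\beta$ (shear exponent). Put $$\theta=\frac{4\pi G\mathcal{K}^2}{9\kappa}\,\frac{1+\nu}{1-\nu},\qquad y_{\mathrm b}=\left[1-\frac{\beta}{4}\,\frac{1+\nu}{1-\nu}\right]^{1/\beta},\qquad B(y)=\frac{y+(\beta-1)y^{1+\beta}-\beta y^\beta}{\beta(\beta-1)},$$ $$F_{\mathrm{rad}}(\delta,\eta)=3\kappa\frac{1-\nu}{1+\nu}\,\frac{(\delta/\eta)^\beta-y_{\mathrm b}^\beta}{\beta}\,\eta^{4/3},\qquad F_{\mathrm{tan}}(\delta,\eta)=F_{\mathrm{rad}}(\delta,\eta)+3\kappa(1-\delta/\eta)Q(\delta/\eta)\eta^{4/3},$$ $$Q(y)=\frac{3(\beta-4/3)(1-\nu)}{2\beta(\beta-1)(1+\nu)}\,\frac{1-y^\beta}{1-y}+\frac{(1-\nu)}{2(\beta-1)(1+\nu)}-\frac12$$ ($Q$ extended continuously to $y=1$). A solution $(\delta_0,\eta_0)$ of the profile system on $[0,Z_* )$ with $\delta_0(0)=\eta_0(0)>0$ is strongly regular if $\delta_0\in C^1([0,Z_* ))$, $\delta_0>0$ on $[0,Z_* )$ and $\lim_{z\to0^+}\delta_0'(z)=0$. The equation for $\eta_0$ with $\eta_0(0)=\delta_0(0)$ means $\eta_0(z)=\frac{3}{z^3}\int_0^z\delta_0(s)s^2\,ds$. It is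 known that for each $\delta_0^c>0$ there is a unique strongly regular solution with $\delta_0(0)=\delta_0^c$, defined on a maximal interval $[0,Z_{\max})$. Ball of matter with strongly regular center on $[0,T]$. This is a quadruple $(\rho,p_{\mathrm{rad}},p_{\mathrm{tan}},u):[0,T]\times[0,\infty)\to\mathbb{R}^4$ for which there is $R\in C^1([0,T])$, $R>0$, such that: - $\rho,p_{\mathrm{rad}},p_{\mathrm{tan}}>0$ for $0\le r<R(t)$; - all four functions are continuous on $\{0\le t\le T,\,0\le r\le R(t)\}$, $C^1$ on $\{0\le t\le T,\,0\le r<R(t)\}$, and zero for $r>R(t)$; - at $r=0$: $p_{\mathrm{rad}}=p_{\mathrm{tan}}$, $\partial_tp_{\mathrm{rad}}=\partial_tp_{\mathrm{tan}}$, $u=\partial_tu=0$; - as $r\to0^+$: $\partial_r\rho,\partial_rp_{\mathrm{rad}},\partial_rp_{\mathrm{tan}}\to0$, and $\partial_ru$ and $u/r$ tend to a common limit which is continuous in $t$. Homologous self-gravitating polytropic elastic ball with constant $\alpha\ne0$ (initially at rest). This is a quadruple $(\rho,p_{\mathrm{rad}},p_{\mathrm{tan}},u)$ that is a ball of matter with strongly regular center on $[0,T]$ for each $T>0$ in the time interval of existence of $\omega$, and that satisfies the following. - In the interior $r<R(t)$ it solves $$\partial_t\rho+\frac1{r^2}\partial_r(r^2\rho u)=0,\qquad \rho(\partial_tu+u\partial_ru)=-\partial_rp_{\mathrm{rad}}+\frac2r(p_{\mathrm{tan}}-p_{\mathrm{rad}})-G\rho\frac{m}{r^2},\qquad m(t,r)=4\pi\int_0^r\rho(t,s)s^2\,ds.$$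 - The boundary conditions are $u(t,R(t))=\dot R(t)$ and $p_{\mathrm{rad}}(t,R(t))=0$. - The equation of state is $\rho=\mathcal{K}\delta$, $p_{\mathrm{rad}}=F_{\mathrm{rad}}(\delta,\eta)$, $p_{\mathrm{tan}}=F_{\mathrm{tan}}(\delta,\eta)$, with $\eta(t,r)=m(t,r)/(\frac{4\pi}{3}\mathcal{K}r^3)$. - The motion is homologous: for $0\le r\le R(t)$, $$u(t,r)=\frac{\dot\omega(t)}{\omega(t)}r,\quad \delta(t,r)=\omega(t)^{-3}\delta_0(r/\omega(t)),\quad \eta(t,r)=\omega(t)^{-3}\eta_0(r/\omega(t)),$$ where $\omega$ solves $\omega^2\ddot\omega=\frac{4\pi G}{3}\mathcal{K}\alpha$, $\omega(0)=1$, $\dot\omega(0)=0$, and $(\delta_0,\eta_0)$ is a strongly regular solution of the profile system displayed in the claim, restricted to $[0,Z]$ with $R(t)=Z\omega(t)$. For $\alpha>0$, $\omega$ exists for all $t\ge0$ and $\omega(t)\to\infty$ as $t\to\infty$; the ball is then called continuously expanding. The ball is of type $\mathrm{A}$ if $0<Z<Z_{\max}<\infty$, where $[0,Z_{\max})$ is the maximal interval of existence of the strongly regular profile $(\delta_0,\eta_0)$.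
   Formalization: The existence, uniqueness and pressure claims for the ball exclude the case β = 4/3 with ν = 1/2, where y_b = 0 while y_0 > 0 on (0, Z_max), so no Z with y_0(Z) = y_b exists; the claims on Z_max and y_0 keep the full parameter range. *)

theory Defs
  imports "HOL-Analysis.Analysis"
begin

text \<open>Physical constants are passed explicitly: \<open>G\<close> (Newton's constant), \<open>K\<close> (reference density),
  \<open>\<kappa>\<close> (bulk modulus), \<open>\<nu>\<close> (Poisson ratio), \<open>\<beta>\<close> (shear exponent). The polytropic exponent is
  fixed to 4/3 throughout.\<close>

definition \<theta>_const :: "real \<Rightarrow> real \<Rightarrow> real \<Rightarrow> real \<Rightarrow> real" where
  "\<theta>_const G K \<kappa> \<nu> = 4 * pi * G * K\<^sup>2 / (9 * \<kappa>) * ((1 + \<nu>) / (1 - \<nu>))"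

definition y_b :: "real \<Rightarrow> real \<Rightarrow> real" where
  "y_b \<nu> \<beta> = (1 - \<beta> / 4 * ((1 + \<nu>) / (1 - \<nu>))) powr (1 / \<beta>)"

definition B_fun :: "real \<Rightarrow> real \<Rightarrow> real" where
  "B_fun \<beta> y = (y + (\<beta> - 1) * y powr (1 + \<beta>) - \<beta> * y powr \<beta>) / (\<beta> * (\<beta> - 1))"

definition F_rad :: "real \<Rightarrow> real \<Rightarrow> real \<Rightarrow> real \<Rightarrow> real \<Rightarrow> real" where
  "F_rad \<kappa> \<nu> \<beta> \<delta> \<eta> =
     3 * \<kappa> * ((1 - \<nu>) / (1 + \<nu>)) * (((\<delta> / \<eta>) powr \<beta> - y_b \<nu> \<beta> powr \<beta>) / \<beta>) * \<eta> powr (4/3)"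

text \<open>At \<open>y = 1\<close> the difference quotient takes its limit value \<open>\<beta>\<close>.\<close>

definition Q_fun :: "real \<Rightarrow> real \<Rightarrow> real \<Rightarrow> real" where
  "Q_fun \<nu> \<beta> y =
     3 * (\<beta> - 4/3) * (1 - \<nu>) / (2 * \<beta> * (\<beta> - 1) * (1 + \<nu>))
       * (if y = 1 then \<beta> else (1 - y powr \<beta>) / (1 - y))
     + (1 - \<nu>) / (2 * (\<beta> - 1) * (1 + \<nu>)) - 1/2"

definition F_tan :: "real \<Rightarrow> real \<Rightarrow> real \<Rightarrow> real \<Rightarrow> real \<Rightarrow> real" where
  "F_tan \<kappa> \<nu> \<beta> \<delta> \<eta> =
     F_rad \<kappa> \<nu> \<beta> \<delta> \<eta> + 3 * \<kappa> * (1 - \<delta> / \<eta>) * Q_fun \<nu> \<beta> (\<delta> / \<eta>) * \<eta> powr (4/3)"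


text \<open>The interval \<open>[0,b)\<close> with a possibly infinite right endpoint.\<close>

definition from_zero_to :: "ereal \<Rightarrow> real set" where
  "from_zero_to b = {x. 0 \<le> x \<and> ereal x < b}"

text \<open>Derivatives are taken relative to the domain, hence one-sided at its endpoints.\<close>

definition C1_on :: "real set \<Rightarrow> (real \<Rightarrow> real) \<Rightarrow> bool" where
  "C1_on S f \<longleftrightarrow> f differentiable_on S \<and>
     continuous_on S (\<lambda>x. vector_derivative f (at x within S))"


subsection \<open>The profile system\<close>

text \<open>The singular equation for \<open>\<eta>\<close> with \<open>\<eta> 0 = \<delta> 0\<close> is given its meaning by the integral formula.\<close>

definition strongly_regular_profile ::
  "real \<Rightarrow> real \<Rightarrow> real \<Rightarrow> (real \<Rightarrow> real) \<Rightarrow> (real \<Rightarrow> real) \<Rightarrow> ereal \<Rightarrow> bool" where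
  "strongly_regular_profile \<theta> \<beta> \<alpha> \<delta> \<eta> b \<longleftrightarrow>
     (let I = from_zero_to b; \<delta>' = (\<lambda>z. vector_derivative \<delta> (at z within I)) in
      0 < b \<and> \<eta> 0 = \<delta> 0 \<and> C1_on I \<delta> \<and> (\<forall>z\<in>I. 0 < \<delta> z) \<and>
      (\<delta>' \<longlongrightarrow> 0) (at_right 0) \<and>
      (\<forall>z\<in>I. 0 < z \<longrightarrow>
         \<eta> z = 3 / z ^ 3 * integral {0..z} (\<lambda>s. \<delta> s * s\<^sup>2) \<and>
         (\<eta> has_real_derivative - (3 / z) * (\<eta> z - \<delta> z)) (at z) \<and>
         \<delta>' z = (\<delta> z / \<eta> z) powr (1 - \<beta>) *
           (3 * (\<beta> - 4/3) / z * B_fun \<beta> (\<delta> z / \<eta> z) * \<eta> z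
            - \<theta> * z * \<eta> z powr (- 1/3) * \<delta> z * (\<eta> z + \<alpha>))))"

text \<open>\<open>[0,Zmax)\<close> is the maximal interval of existence: the solution has no proper extension.\<close>

definition maximal_strongly_regular_profile ::
  "real \<Rightarrow> real \<Rightarrow> real \<Rightarrow> (real \<Rightarrow> real) \<Rightarrow> (real \<Rightarrow> real) \<Rightarrow> ereal \<Rightarrow> bool" where
  "maximal_strongly_regular_profile \<theta> \<beta> \<alpha> \<delta> \<eta> Zmax \<longleftrightarrow>
     strongly_regular_profile \<theta> \<beta> \<alpha> \<delta> \<eta> Zmax \<and>
     (\<forall>\<delta>' \<eta>' b. strongly_regular_profile \<theta> \<beta> \<alpha> \<delta>' \<eta>' b \<and>
        (\<forall>z\<in>from_zero_to Zmax. \<delta>' z = \<delta> z \<and> \<eta>' z = \<eta> z) \<longrightarrow> b \<le> Zmax)"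


subsection \<open>The scale factor\<close>

definition scale_factor :: "real \<Rightarrow> real \<Rightarrow> real \<Rightarrow> (real \<Rightarrow> real) \<Rightarrow> ereal \<Rightarrow> bool" where
  "scale_factor G K \<alpha> \<omega> b \<longleftrightarrow>
     (let I = from_zero_to b; \<omega>' = (\<lambda>t. vector_derivative \<omega> (at t within I)) in
      0 < b \<and> \<omega> 0 = 1 \<and> \<omega>' 0 = 0 \<and> \<omega> differentiable_on I \<and> \<omega>' differentiable_on I \<and>
      (\<forall>t\<in>I. (\<omega> t)\<^sup>2 * vector_derivative \<omega>' (at t within I) = 4 * pi * G / 3 * K * \<alpha>))"

definition maximal_scale_factor :: "real \<Rightarrow> real \<Rightarrow> real \<Rightarrow> (real \<Rightarrow> real) \<Rightarrow> ereal \<Rightarrow> bool" where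
  "maximal_scale_factor G K \<alpha> \<omega> Tmax \<longleftrightarrow>
     scale_factor G K \<alpha> \<omega> Tmax \<and>
     (\<forall>\<omega>' b. scale_factor G K \<alpha> \<omega>' b \<and> (\<forall>t\<in>from_zero_to Tmax. \<omega>' t = \<omega> t) \<longrightarrow> b \<le> Tmax)"


subsection \<open>Balls of matter\<close>

text \<open>Fields are functions of time \<open>t\<close> and radius \<open>r \<ge> 0\<close>; \<open>I\<close> is the time interval.\<close>

definition partial_t :: "real set \<Rightarrow> (real \<Rightarrow> real \<Rightarrow> real) \<Rightarrow> real \<Rightarrow> real \<Rightarrow> real" where
  "partial_t I f t r = vector_derivative (\<lambda>s. f s r) (at t within I)"

definition partial_r :: "(real \<Rightarrow> real \<Rightarrow> real) \<Rightarrow> real \<Rightarrow> real \<Rightarrow> real" where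
  "partial_r f t r = vector_derivative (f t) (at r within {0..})"

definition ball_interior :: "real set \<Rightarrow> (real \<Rightarrow> real) \<Rightarrow> (real \<times> real) set" where
  "ball_interior I R = {(t, r). t \<in> I \<and> 0 \<le> r \<and> r < R t}"

definition ball_closed :: "real set \<Rightarrow> (real \<Rightarrow> real) \<Rightarrow> (real \<times> real) set" where
  "ball_closed I R = {(t, r). t \<in> I \<and> 0 \<le> r \<and> r \<le> R t}"

text \<open>For continuous \<open>R\<close> the set \<open>ball_interior I R\<close> is relatively open in \<open>I \<times> [0,\<infinity>)\<close>, so the
  following partial derivatives depend only on the values of \<open>f\<close> in that set.\<close>

definition C1_in_ball :: "real set \<Rightarrow> (real \<Rightarrow> real) \<Rightarrow> (real \<Rightarrow> real \<Rightarrow> real) \<Rightarrow> bool" where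
  "C1_in_ball I R f \<longleftrightarrow>
     (\<forall>(t, r)\<in>ball_interior I R. (\<lambda>s. f s r) differentiable (at t within I) \<and>
        f t differentiable (at r within {0..})) \<and>
     continuous_on (ball_interior I R) (\<lambda>(t, r). partial_t I f t r) \<and>
     continuous_on (ball_interior I R) (\<lambda>(t, r). partial_r f t r)"

text \<open>Ball of matter with strongly regular center on \<open>[0,T]\<close>, with radius function \<open>R\<close>.\<close>

definition ball_of_matter ::
  "real \<Rightarrow> (real \<Rightarrow> real) \<Rightarrow> (real \<Rightarrow> real \<Rightarrow> real) \<Rightarrow> (real \<Rightarrow> real \<Rightarrow> real) \<Rightarrow>
   (real \<Rightarrow> real \<Rightarrow> real) \<Rightarrow> (real \<Rightarrow> real \<Rightarrow> real) \<Rightarrow> bool" where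
  "ball_of_matter T R \<rho> p_rad p_tan u \<longleftrightarrow>
     C1_on {0..T} R \<and> (\<forall>t\<in>{0..T}. 0 < R t) \<and>
     (\<forall>(t, r)\<in>ball_interior {0..T} R. 0 < \<rho> t r \<and> 0 < p_rad t r \<and> 0 < p_tan t r) \<and>
     (\<forall>f\<in>{\<rho>, p_rad, p_tan, u}.
        continuous_on (ball_closed {0..T} R) (\<lambda>(t, r). f t r) \<and>
        C1_in_ball {0..T} R f \<and>
        (\<forall>t\<in>{0..T}. \<forall>r>R t. f t r = 0)) \<and>
     (\<forall>t\<in>{0..T}. p_rad t 0 = p_tan t 0 \<and>
        partial_t {0..T} p_rad t 0 = partial_t {0..T} p_tan t 0 \<and>
        u t 0 = 0 \<and> partial_t {0..T} u t 0 = 0) \<and>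
     (\<forall>f\<in>{\<rho>, p_rad, p_tan}. \<forall>t\<in>{0..T}. (partial_r f t \<longlongrightarrow> 0) (at_right 0)) \<and>
     (\<exists>L. continuous_on {0..T} L \<and>
        (\<forall>t\<in>{0..T}. (partial_r u t \<longlongrightarrow> L t) (at_right 0) \<and>
           ((\<lambda>r. u t r / r) \<longlongrightarrow> L t) (at_right 0)))"

definition mass :: "(real \<Rightarrow> real \<Rightarrow> real) \<Rightarrow> real \<Rightarrow> real \<Rightarrow> real" where
  "mass \<rho> t r = 4 * pi * integral {0..r} (\<lambda>s. \<rho> t s * s\<^sup>2)"

text \<open>At the center the quotient is replaced by its limit as \<open>r\<close> tends to 0.\<close>

definition mean_compression :: "real \<Rightarrow> (real \<Rightarrow> real \<Rightarrow> real) \<Rightarrow> real \<Rightarrow> real \<Rightarrow> real" where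
  "mean_compression K \<rho> t r =
     (if r = 0 then \<rho> t 0 / K else mass \<rho> t r / (4 * pi / 3 * K * r ^ 3))"

text \<open>Homologous self-gravitating polytropic elastic ball with constant \<open>\<alpha>\<close>, scale factor \<open>\<omega>\<close> with
  maximal interval \<open>[0,Tmax)\<close>, maximal profile \<open>(\<delta>\<^sub>0, \<eta>\<^sub>0)\<close> on \<open>[0,Zmax)\<close>, and radius \<open>Z * \<omega> t\<close>.
  The field equations are singular at \<open>r = 0\<close> and are imposed for \<open>0 < r < R t\<close>.\<close>

definition homologous_elastic_ball ::
  "real \<Rightarrow> real \<Rightarrow> real \<Rightarrow> real \<Rightarrow> real \<Rightarrow> real \<Rightarrow>
   (real \<Rightarrow> real) \<Rightarrow> ereal \<Rightarrow> (real \<Rightarrow> real) \<Rightarrow> (real \<Rightarrow> real) \<Rightarrow> ereal \<Rightarrow> real \<Rightarrow> (real \<Rightarrow> real) \<Rightarrow>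
   (real \<Rightarrow> real \<Rightarrow> real) \<Rightarrow> (real \<Rightarrow> real \<Rightarrow> real) \<Rightarrow> (real \<Rightarrow> real \<Rightarrow> real) \<Rightarrow>
   (real \<Rightarrow> real \<Rightarrow> real) \<Rightarrow> bool" where
  "homologous_elastic_ball G K \<kappa> \<nu> \<beta> \<alpha> \<omega> Tmax \<delta>\<^sub>0 \<eta>\<^sub>0 Zmax Z R \<rho> p_rad p_tan u \<longleftrightarrow>
     (let J = from_zero_to Tmax; \<eta> = mean_compression K \<rho> in
      \<alpha> \<noteq> 0 \<and>
      maximal_scale_factor G K \<alpha> \<omega> Tmax \<and>
      maximal_strongly_regular_profile (\<theta>_const G K \<kappa> \<nu>) \<beta> \<alpha> \<delta>\<^sub>0 \<eta>\<^sub>0 Zmax \<and>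
      0 < Z \<and> ereal Z < Zmax \<and>
      (\<forall>t\<in>J. R t = Z * \<omega> t) \<and>
      (\<forall>T>0. T \<in> J \<longrightarrow> ball_of_matter T R \<rho> p_rad p_tan u) \<and>
      (\<forall>t\<in>J. \<forall>r. 0 < r \<and> r < R t \<longrightarrow>
         partial_t J \<rho> t r + 1 / r\<^sup>2 * partial_r (\<lambda>t r. r\<^sup>2 * \<rho> t r * u t r) t r = 0 \<and>
         \<rho> t r * (partial_t J u t r + u t r * partial_r u t r) =
           - partial_r p_rad t r + 2 / r * (p_tan t r - p_rad t r)
           - G * \<rho> t r * (mass \<rho> t r / r\<^sup>2)) \<and>
      (\<forall>t\<in>J. u t (R t) = vector_derivative R (at t within J) \<and> p_rad t (R t) = 0) \<and>
      (\<forall>(t, r)\<in>ball_closed J R.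
         p_rad t r = F_rad \<kappa> \<nu> \<beta> (\<rho> t r / K) (\<eta> t r) \<and>
         p_tan t r = F_tan \<kappa> \<nu> \<beta> (\<rho> t r / K) (\<eta> t r)) \<and>
      (\<forall>(t, r)\<in>ball_closed J R.
         u t r = vector_derivative \<omega> (at t within J) / \<omega> t * r \<and>
         \<rho> t r / K = \<delta>\<^sub>0 (r / \<omega> t) / \<omega> t ^ 3 \<and>
         \<eta> t r = \<eta>\<^sub>0 (r / \<omega> t) / \<omega> t ^ 3))"

text \<open>The ball is continuously expanding when \<open>0 < \<alpha>\<close>, and of type A when \<open>0 < Z < Zmax < \<infinity>\<close>.\<close>

definition expanding_ball_type_A ::
  "real \<Rightarrow> real \<Rightarrow> real \<Rightarrow> real \<Rightarrow> real \<Rightarrow> real \<Rightarrow> (real \<Rightarrow> real) \<Rightarrow>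
   (real \<Rightarrow> real \<Rightarrow> real) \<Rightarrow> (real \<Rightarrow> real \<Rightarrow> real) \<Rightarrow> (real \<Rightarrow> real \<Rightarrow> real) \<Rightarrow>
   (real \<Rightarrow> real \<Rightarrow> real) \<Rightarrow> bool" where
  "expanding_ball_type_A G K \<kappa> \<nu> \<beta> \<alpha> R \<rho> p_rad p_tan u \<longleftrightarrow>
     0 < \<alpha> \<and>
     (\<exists>\<omega> Tmax \<delta>\<^sub>0 \<eta>\<^sub>0 Zmax Z.
        homologous_elastic_ball G K \<kappa> \<nu> \<beta> \<alpha> \<omega> Tmax \<delta>\<^sub>0 \<eta>\<^sub>0 Zmax Z R \<rho> p_rad p_tan u \<and>
        0 < Z \<and> ereal Z < Zmax \<and> Zmax < \<infinity>)"

end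

theory Submission
  imports Defs
begin

text \<open>
  Write \<open>y = \<delta>\<^sub>0 / \<eta>\<^sub>0\<close>. For \<open>\<beta> \<le> 4/3\<close> both terms of the profile equation are nonpositive, because
  \<open>B \<ge> 0\<close> (\<open>B_fun_nonneg\<close>). Hence \<open>\<delta>\<^sub>0\<close> decreases strictly and lies strictly below its mean \<open>\<eta>\<^sub>0\<close>, which
  is \<open>0 < y < 1\<close>. Dropping the shear term leaves \<open>(\<delta>\<^sub>0 powr (\<beta> - 1))' \<le> - const * z\<close>, and this rules out a
  solution on the whole half-line (\<open>finite_extent\<close>). At the finite end \<open>\<delta>\<^sub>0\<close> has a limit. A positive limit
  would allow a continuation (\<open>extendable\<close>), since away from the center and from vacuum the equation is
  regular; so the limit is \<open>0\<close>. The mass already enclosed keeps \<open>\<eta>\<^sub>0\<close> positive, and \<open>y\<close> tends to \<open>0\<close>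
  (\<open>maximal_profile_ends_at_vacuum\<close>). As \<open>y\<close> runs continuously from \<open>1\<close> to \<open>0\<close>, it reaches
  a positive \<open>y\<^sub>b\<close> a first time.

  For \<open>\<gamma> = 4/3\<close> the pressures are homogeneous of the degree at which pressure forces and gravity scale
  alike with \<open>\<omega>\<close>. The momentum equation of a homologous motion thereby separates into the profile equation
  (\<open>radial_force_balance\<close>) and the equation of \<open>\<omega>\<close>, and cutting the profile off at the first radius with
  \<open>y = y\<^sub>b\<close> gives the ball. The radial pressure has the sign of \<open>y - y\<^sub>b\<close>, so it is positive inside and
  vanishes at the surface; the tangential one is at least as large, because convexity of \<open>y powr \<beta>\<close>
  gives \<open>(1 - y) * Q y \<ge> 0\<close> (\<open>one_minus_times_Q_nonneg\<close>).

  Uniqueness of the ball rests on uniqueness for the two differential equations. The profile equation is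
  singular at the center. Its shear term has a double zero at \<open>y = 1\<close>, though, and \<open>1 - y\<close> is of order
  \<open>z\<close>; this compensates the factor \<open>1 / z\<close> and leaves a uniform Lipschitz estimate (\<open>slope_lipschitz\<close>).
  It yields \<open>profile_unique\<close> by a weighted maximum and, through Banach's fixed point theorem, the
  continuation used above. Finally the sign of the radial pressure determines the surface radius.
\<close>

section \<open>Inequalities for the constitutive functions\<close>

text \<open>Convexity of \<open>y powr \<beta>\<close> for \<open>\<beta> > 1\<close>: the graph lies above its tangent at \<open>1\<close>. Young's
  inequality with weights \<open>1/\<beta>\<close> and \<open>1 - 1/\<beta>\<close> gives this without any differentiation.\<close>

lemma powr_ge_tangent:
  fixes \<beta> y :: real
  assumes "1 < \<beta>" "0 < y"
  shows "1 + \<beta> * (y - 1) \<le> y powr \<beta>"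
proof -
  have "(y powr \<beta>) powr (1/\<beta>) * 1 powr (1 - 1/\<beta>) \<le> (1/\<beta>) * y powr \<beta> + (1 - 1/\<beta>) * 1"
    using assms by (intro Youngs_inequality_0) auto
  then have "y \<le> (1/\<beta>) * y powr \<beta> + (1 - 1/\<beta>)"
    using assms by (simp add: powr_powr)
  then have "\<beta> * y \<le> \<beta> * ((1/\<beta>) * y powr \<beta> + (1 - 1/\<beta>))"
    using assms by (intro mult_left_mono) auto
  also have "\<dots> = y powr \<beta> + \<beta> - 1"
    using assms by (simp add: field_simps)
  finally show ?thesis
    by (simp add: algebra_simps)
qed

text \<open>Up to the factor \<open>(\<beta> - 1) / y\<close>, \<open>B\<close> is the gap in Young's inequality between
  \<open>y powr (\<beta> - 1)\<close> and a convex combination of \<open>y powr \<beta>\<close> and \<open>1\<close>. This sign makes the shear term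
  of the profile equation point downwards when \<open>\<beta> \<le> 4/3\<close>.\<close>

lemma B_fun_nonneg:
  assumes "1 < \<beta>" "0 < y"
  shows "0 \<le> B_fun \<beta> y"
proof -
  have "(y powr \<beta>) powr ((\<beta>-1)/\<beta>) * 1 powr (1/\<beta>) \<le> ((\<beta>-1)/\<beta>) * y powr \<beta> + (1/\<beta>) * 1"
    using assms by (intro Youngs_inequality_0) (auto simp: field_simps)
  then have "y powr (\<beta> - 1) \<le> ((\<beta>-1)/\<beta>) * y powr \<beta> + 1/\<beta>"
    using assms by (simp add: powr_powr)
  then have "0 \<le> 1 + (\<beta> - 1) * y powr \<beta> - \<beta> * y powr (\<beta> - 1)"
    using assms by (simp add: field_simps)
  then have "0 \<le> y * (1 + (\<beta> - 1) * y powr \<beta> - \<beta> * y powr (\<beta> - 1))"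
    using assms by simp
  also have "\<dots> = y + (\<beta> - 1) * y powr (1 + \<beta>) - \<beta> * y powr \<beta>"
    using assms by (simp add: powr_add powr_diff field_simps)
  finally show ?thesis
    using assms by (simp add: B_fun_def)
qed

text \<open>Multiplied by \<open>1 - y\<close>, the difference quotient in \<open>Q\<close> becomes a smooth function of \<open>y\<close>; it is only
  through this product that \<open>Q\<close> enters the tangential pressure.\<close>

lemma one_minus_times_Q:
  "(1 - y) * Q_fun \<nu> \<beta> y =
     3 * (\<beta> - 4/3) * (1 - \<nu>) / (2 * \<beta> * (\<beta> - 1) * (1 + \<nu>)) * (1 - y powr \<beta>)
     + ((1 - \<nu>) / (2 * (\<beta> - 1) * (1 + \<nu>)) - 1/2) * (1 - y)"
proof (cases "y = 1")
  case False
  define w a c where "w = (1 - y powr \<beta>) / (1 - y)"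
    and "a = 3 * (\<beta> - 4/3) * (1 - \<nu>) / (2 * \<beta> * (\<beta> - 1) * (1 + \<nu>))"
    and "c = (1 - \<nu>) / (2 * (\<beta> - 1) * (1 + \<nu>))"
  have "Q_fun \<nu> \<beta> y = a * w + c - 1/2"
    using False by (simp only: Q_fun_def a_def w_def c_def if_False)
  moreover have "(1 - y) * (a * w + c - 1/2) = a * ((1 - y) * w) + (c - 1/2) * (1 - y)"
    by (simp add: algebra_simps)
  moreover have "(1 - y) * w = 1 - y powr \<beta>"
    using False by (simp add: w_def)
  ultimately show ?thesis
    by (simp only: a_def c_def)
qed (simp add: Q_fun_def)

text \<open>For \<open>\<beta> \<le> 4/3\<close> the coefficient of \<open>1 - y powr \<beta>\<close> is nonpositive, so the tangent bound
  \<open>1 - y powr \<beta> \<le> \<beta> * (1 - y)\<close> may be inserted; the resulting linear coefficient is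
  \<open>(1 - 2 * \<nu>) / (1 + \<nu>)\<close>, which has the right sign for \<open>\<nu> \<le> 1/2\<close>.\<close>

lemma one_minus_times_Q_nonneg:
  assumes "- 1 < \<nu>" "\<nu> \<le> 1/2" "1 < \<beta>" "\<beta> \<le> 4/3" "0 < y" "y \<le> 1"
  shows "0 \<le> (1 - y) * Q_fun \<nu> \<beta> y"
proof -
  let ?c = "3 * (\<beta> - 4/3) * (1 - \<nu>) / (2 * \<beta> * (\<beta> - 1) * (1 + \<nu>))"
  have c: "?c \<le> 0"
  proof (rule divide_nonpos_nonneg)
    show "3 * (\<beta> - 4/3) * (1 - \<nu>) \<le> 0"
      using assms by (simp add: mult_nonpos_nonneg)
    show "0 \<le> 2 * \<beta> * (\<beta> - 1) * (1 + \<nu>)"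
      using assms by auto
  qed
  have "1 - y powr \<beta> \<le> \<beta> * (1 - y)"
    using powr_ge_tangent[of \<beta> y] assms by (simp add: algebra_simps)
  from mult_left_mono_neg[OF this c]
  have "?c * (\<beta> * (1 - y)) + ((1 - \<nu>) / (2 * (\<beta> - 1) * (1 + \<nu>)) - 1/2) * (1 - y)
          \<le> (1 - y) * Q_fun \<nu> \<beta> y"
    unfolding one_minus_times_Q by simp
  moreover have "?c * \<beta> + ((1 - \<nu>) / (2 * (\<beta> - 1) * (1 + \<nu>)) - 1/2)
      = (1 - 2 * \<nu>) / (1 + \<nu>)"
  proof -
    have "\<beta> \<noteq> 0" "\<beta> - 1 \<noteq> 0" "1 + \<nu> \<noteq> 0" using assms by auto
    then show ?thesis by (simp add: divide_simps) algebra
  qed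
  then have "?c * (\<beta> * (1 - y)) + ((1 - \<nu>) / (2 * (\<beta> - 1) * (1 + \<nu>)) - 1/2) * (1 - y)
      = (1 - 2 * \<nu>) / (1 + \<nu>) * (1 - y)"
    by (simp only: mult.assoc[symmetric] distrib_right[symmetric])
  moreover have "0 \<le> (1 - 2 * \<nu>) / (1 + \<nu>) * (1 - y)"
    using assms by simp
  ultimately show ?thesis by linarith
qed

text \<open>Among the admissible parameters the bracket in \<open>y_b\<close> vanishes only at \<open>\<beta> = 4/3\<close>, \<open>\<nu> = 1/2\<close>; excluding this corner
  puts the boundary value strictly between the center value \<open>1\<close> and vacuum.\<close>

lemma y_b_bounds:
  assumes "- 1 < \<nu>" "\<nu> \<le> 1/2" "1 < \<beta>" "\<beta> \<le> 4/3" "\<not> (\<beta> = 4/3 \<and> \<nu> = 1/2)"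
  shows "0 < y_b \<nu> \<beta>" "y_b \<nu> \<beta> < 1"
    and "y_b \<nu> \<beta> powr \<beta> = 1 - \<beta> / 4 * ((1 + \<nu>) / (1 - \<nu>))"
proof -
  let ?n = "(1 + \<nu>) / (1 - \<nu>)"
  have n: "0 < ?n" "?n \<le> 3" using assms by (auto simp: field_simps)
  have lt: "\<beta> / 4 * ?n < 1"
  proof (cases "\<beta> = 4/3")
    case True
    then have "\<nu> < 1/2" using assms by auto
    then have "?n < 3" using assms by (simp add: field_simps)
    then show ?thesis unfolding True by linarith
  next
    case False
    have "\<beta> / 4 * ?n \<le> \<beta> / 4 * 3" using n assms by (intro mult_left_mono) auto
    then show ?thesis using False \<open>\<beta> \<le> 4/3\<close> by linarith
  qed
  have gt: "0 < \<beta> / 4 * ?n" using n assms by simp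
  show "0 < y_b \<nu> \<beta>" unfolding y_b_def by (subst powr_gt_zero) (use lt in linarith)
  have "(1 - \<beta> / 4 * ?n) powr (1/\<beta>) < 1 powr (1/\<beta>)"
    using lt gt assms by (intro powr_less_mono2) auto
  then show "y_b \<nu> \<beta> < 1" by (simp add: y_b_def)
  show "y_b \<nu> \<beta> powr \<beta> = 1 - \<beta> / 4 * ?n"
    using lt assms by (simp add: y_b_def powr_powr)
qed

section \<open>Lipschitz bounds from continuous derivatives\<close>

lemma lipschitz_of_continuous_derivative:
  fixes f f' :: "real \<Rightarrow> real"
  assumes der: "\<And>x. x \<in> {a..b} \<Longrightarrow> (f has_real_derivative f' x) (at x)"
    and cont: "continuous_on {a..b} f'"
  obtains C where "0 \<le> C"
    "\<And>x y. x \<in> {a..b} \<Longrightarrow> y \<in> {a..b} \<Longrightarrow> \<bar>f x - f y\<bar> \<le> C * \<bar>x - y\<bar>"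
proof -
  have "bounded (f' ` {a..b})"
    using compact_continuous_image[OF cont] by (simp add: compact_imp_bounded)
  then obtain C where "\<forall>y \<in> f' ` {a..b}. norm y \<le> C"
    by (auto simp only: bounded_iff)
  then have C: "\<bar>f' x\<bar> \<le> C" if "x \<in> {a..b}" for x
    using that by simp
  have "\<bar>f x - f y\<bar> \<le> \<bar>C\<bar> * \<bar>x - y\<bar>" if "x \<in> {a..b}" "y \<in> {a..b}" for x y
  proof -
    have "norm (f x - f y) \<le> \<bar>C\<bar> * norm (x - y)"
    proof (rule field_differentiable_bound[where S = "{a..b}"])
      show "norm (f' z) \<le> \<bar>C\<bar>" if "z \<in> {a..b}" for z
        using C[OF that] by simp
      show "(f has_real_derivative f' z) (at z within {a..b})" if "z \<in> {a..b}" for z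
        using der[OF that] by (rule has_field_derivative_at_within)
    qed (use that in auto)
    then show ?thesis by simp
  qed
  then show thesis using that[of "\<bar>C\<bar>"] by auto
qed

lemma powr_lipschitz:
  fixes a b p :: real
  assumes "0 < a"
  obtains C where "0 \<le> C"
    "\<And>x y. x \<in> {a..b} \<Longrightarrow> y \<in> {a..b} \<Longrightarrow> \<bar>x powr p - y powr p\<bar> \<le> C * \<bar>x - y\<bar>"
proof -
  have der: "((\<lambda>x. x powr p) has_real_derivative p * x powr (p - 1)) (at x)" if "x \<in> {a..b}" for x
    using that assms by (auto intro!: derivative_eq_intros)
  have cont: "continuous_on {a..b} (\<lambda>x. p * x powr (p - 1))"
    using assms by (intro continuous_intros) auto
  show thesis
    by (rule lipschitz_of_continuous_derivative[OF der cont]) (auto intro: that)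
qed

section \<open>Half-open intervals and one-sided derivatives\<close>

lemma from_zero_to_iff: "z \<in> from_zero_to b \<longleftrightarrow> 0 \<le> z \<and> ereal z < b"
  by (simp add: from_zero_to_def)

lemma from_zero_to_mono: "z \<in> from_zero_to b \<Longrightarrow> 0 \<le> x \<Longrightarrow> x \<le> z \<Longrightarrow> x \<in> from_zero_to b"
  by (auto simp: from_zero_to_iff intro: le_less_trans[of "ereal x" "ereal z"])

lemma from_zero_to_infinity [simp]: "from_zero_to \<infinity> = {0..}"
  by (auto simp: from_zero_to_iff)

lemma from_zero_to_ereal [simp]: "from_zero_to (ereal c) = {0..<c}"
  by (auto simp: from_zero_to_iff)

lemma from_zero_to_gap:
  assumes "z \<in> from_zero_to b"
  obtains c where "z < c" "c \<in> from_zero_to b"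
proof -
  obtain c where "ereal z < ereal c" "ereal c < b"
    using assms ereal_dense2[of "ereal z" b] unfolding from_zero_to_iff by blast
  moreover from this have "c \<in> from_zero_to b"
    using assms by (simp add: from_zero_to_iff)
  ultimately show thesis
    using that[of c] by simp
qed

lemma at_within_from_zero_to:
  assumes "z \<in> from_zero_to b"
  shows "at z within from_zero_to b = at z within {0..}"
proof -
  obtain c where c: "z < c" "c \<in> from_zero_to b"
    by (rule from_zero_to_gap[OF assms])
  show ?thesis
  proof (rule at_within_nhd)
  show "z \<in> {..<c}" "open {..<c}" using c by auto
  show "from_zero_to b \<inter> {..<c} - {z} = {0..} \<inter> {..<c} - {z}"
    using from_zero_to_mono[OF c(2)] by (auto simp: from_zero_to_iff)
  qed
qed

lemma at_within_atLeast_neq_bot: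
  fixes z :: real
  assumes "0 \<le> z"
  shows "at z within {0..} \<noteq> bot"
proof -
  have "z islimpt {z..z+1}" by simp
  then have "z islimpt {0..}" by (rule islimpt_subset) (use assms in auto)
  then show ?thesis by (simp add: trivial_limit_within)
qed

lemma vector_derivative_real:
  assumes "(f has_real_derivative D) (at x within S)" "at x within S \<noteq> bot"
  shows "vector_derivative f (at x within S) = D"
  using assms by (simp add: vector_derivative_within has_real_derivative_iff_has_vector_derivative)

lemma at_within_Ici_interior:
  fixes z :: real
  assumes "0 < z"
  shows "at z within {0..} = at z"
  by (rule at_within_interior) (use assms in simp)

section \<open>Mean values over balls\<close>

text \<open>The value at radius \<open>z\<close> of the mean of a radial function over the ball of radius \<open>z\<close> in three-space;
  the compression \<open>\<eta>\<close> is the ball mean of \<open>\<delta>\<close>.\<close>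

definition ball_mean :: "(real \<Rightarrow> real) \<Rightarrow> real \<Rightarrow> real" where
  "ball_mean f z = 3 / z ^ 3 * integral {0..z} (\<lambda>s. f s * s\<^sup>2)"

lemma has_integral_square:
  fixes a z :: real
  assumes "a \<le> z"
  shows "((\<lambda>s. c * s\<^sup>2) has_integral c * (z ^ 3 - a ^ 3) / 3) {a..z}"
proof -
  have "((\<lambda>s. c * s\<^sup>2) has_integral c * z ^ 3 / 3 - c * a ^ 3 / 3) {a..z}"
    using assms
    by (intro fundamental_theorem_of_calculus)
      (auto intro!: derivative_eq_intros simp flip: has_real_derivative_iff_has_vector_derivative)
  then show ?thesis by (simp add: diff_divide_distrib right_diff_distrib)
qed

lemma ball_mean_const: "0 < z \<Longrightarrow> ball_mean (\<lambda>s. c) z = c"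
  unfolding ball_mean_def by (subst integral_unique[OF has_integral_square[of 0 z c]]) auto

lemma integrable_times_square:
  fixes f :: "real \<Rightarrow> real"
  shows "continuous_on {a..z} f \<Longrightarrow> (\<lambda>s. f s * s\<^sup>2) integrable_on {a..z}"
  by (intro integrable_continuous_real continuous_intros)

lemma ball_mean_mono:
  assumes "0 < z" "continuous_on {0..z} f" "continuous_on {0..z} g"
    and "\<And>s. 0 \<le> s \<Longrightarrow> s \<le> z \<Longrightarrow> f s \<le> g s"
  shows "ball_mean f z \<le> ball_mean g z"
  unfolding ball_mean_def
  using assms
  by (intro mult_left_mono integral_le integrable_times_square mult_right_mono) auto

lemma ball_mean_less:
  assumes "0 < z" "continuous_on {0..z} f" "continuous_on {0..z} g"
    and "\<And>s. 0 < s \<Longrightarrow> s < z \<Longrightarrow> f s < g s"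
  shows "ball_mean f z < ball_mean g z"
  unfolding ball_mean_def
  using assms
  by (intro mult_strict_left_mono integral_less_real continuous_intros) auto

lemma ball_mean_diff:
  assumes "continuous_on {0..z} f" "continuous_on {0..z} g"
  shows "ball_mean (\<lambda>s. f s - g s) z = ball_mean f z - ball_mean g z"
  unfolding ball_mean_def
  using assms
  by (simp add: left_diff_distrib right_diff_distrib integral_diff integrable_times_square)

lemma ball_mean_close:
  assumes "0 < z" "continuous_on {0..z} f" "continuous_on {0..z} g"
    and "\<And>s. 0 \<le> s \<Longrightarrow> s \<le> z \<Longrightarrow> \<bar>f s - g s\<bar> \<le> C"
  shows "\<bar>ball_mean f z - ball_mean g z\<bar> \<le> C"
proof -
  have c: "continuous_on {0..z} (\<lambda>s. f s - g s)"
    using assms by (intro continuous_intros)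
  have "ball_mean (\<lambda>s. f s - g s) z \<le> C" "- C \<le> ball_mean (\<lambda>s. f s - g s) z"
    using ball_mean_mono[OF assms(1) c continuous_on_const, of C]
      ball_mean_mono[OF assms(1) continuous_on_const c, of "- C"] assms
    by (force simp: ball_mean_const abs_le_iff)+
  then show ?thesis
    using assms by (simp add: ball_mean_diff abs_le_iff)
qed

section \<open>Monotonicity of strongly regular profiles\<close>

definition slope :: "real \<Rightarrow> real \<Rightarrow> real \<Rightarrow> real \<Rightarrow> real \<Rightarrow> real \<Rightarrow> real" where
  "slope \<theta> \<beta> \<alpha> z d e = (d / e) powr (1 - \<beta>) *
     (3 * (\<beta> - 4/3) / z * B_fun \<beta> (d / e) * e - \<theta> * z * e powr (- 1/3) * d * (e + \<alpha>))"

locale profile =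
  fixes \<theta> \<beta> \<alpha> :: real and \<delta> \<eta> :: "real \<Rightarrow> real" and b :: ereal
  assumes \<theta>_pos: "0 < \<theta>" and \<beta>_gt: "1 < \<beta>" and \<beta>_le: "\<beta> \<le> 4/3" and \<alpha>_pos: "0 < \<alpha>"
    and profile: "strongly_regular_profile \<theta> \<beta> \<alpha> \<delta> \<eta> b"
begin

abbreviation "I \<equiv> from_zero_to b"

text \<open>The derivative of \<open>\<delta>\<close>. At the center the equation is singular; there strong regularity supplies
  the value \<open>0\<close>.\<close>

definition d\<delta> :: "real \<Rightarrow> real" where
  "d\<delta> z = (if z = 0 then 0 else slope \<theta> \<beta> \<alpha> z (\<delta> z) (\<eta> z))"

lemma b_pos: "0 < b" and \<eta>_0: "\<eta> 0 = \<delta> 0"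
  and \<delta>_pos: "z \<in> I \<Longrightarrow> 0 < \<delta> z"
  and \<eta>_eq: "z \<in> I \<Longrightarrow> 0 < z \<Longrightarrow> \<eta> z = ball_mean \<delta> z"
  and \<eta>_deriv: "z \<in> I \<Longrightarrow> 0 < z \<Longrightarrow> (\<eta> has_real_derivative - (3 / z) * (\<eta> z - \<delta> z)) (at z)"
  using profile by (auto simp: strongly_regular_profile_def Let_def ball_mean_def)

lemma zero_mem: "0 \<in> I"
  using b_pos by (simp add: from_zero_to_iff flip: zero_ereal_def)

lemma \<delta>_deriv: "z \<in> I \<Longrightarrow> (\<delta> has_real_derivative d\<delta> z) (at z within {0..})"
  and d\<delta>_cont: "continuous_on I d\<delta>"
proof -
  define D where "D z = vector_derivative \<delta> (at z within I)" for z
  have D: "\<delta> differentiable_on I" "continuous_on I D" "(D \<longlongrightarrow> 0) (at_right 0)"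
    "\<And>z. z \<in> I \<Longrightarrow> 0 < z \<Longrightarrow> D z = slope \<theta> \<beta> \<alpha> z (\<delta> z) (\<eta> z)"
    using profile unfolding strongly_regular_profile_def C1_on_def Let_def D_def slope_def by auto
  have "(D \<longlongrightarrow> D 0) (at 0 within I)"
    using D(2) zero_mem by (auto simp: continuous_on_def)
  then have "(D \<longlongrightarrow> D 0) (at_right 0)"
    by (simp add: at_within_from_zero_to zero_mem at_within_Ici_at_right)
  then have "D 0 = 0"
    using D(3) by (intro tendsto_unique[OF _ _ D(3)]) auto
  then have eq: "D z = d\<delta> z" if "z \<in> I" for z
    using D(4)[OF that] that by (cases "z = 0") (auto simp: d\<delta>_def from_zero_to_iff)
  show "continuous_on I d\<delta>"
    using D(2) eq continuous_on_cong by metis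
  show "(\<delta> has_real_derivative d\<delta> z) (at z within {0..})" if "z \<in> I"
    using D(1) that eq[OF that] unfolding differentiable_on_def D_def vector_derivative_works
    by (auto simp: has_real_derivative_iff_has_vector_derivative at_within_from_zero_to)
qed

lemma \<delta>_deriv_interior: "z \<in> I \<Longrightarrow> 0 < z \<Longrightarrow> (\<delta> has_real_derivative d\<delta> z) (at z)"
  using \<delta>_deriv[of z] by (simp add: at_within_Ici_interior)

lemma mem_mono: "z \<in> I \<Longrightarrow> 0 \<le> x \<Longrightarrow> x \<le> z \<Longrightarrow> x \<in> I"
  by (rule from_zero_to_mono)

lemma mem_nonneg: "z \<in> I \<Longrightarrow> 0 \<le> z"
  by (simp add: from_zero_to_iff)

lemma \<delta>_cont: "continuous_on I \<delta>"
  unfolding continuous_on_eq_continuous_within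
  using \<delta>_deriv by (auto simp: at_within_from_zero_to intro!: DERIV_continuous)

lemma \<delta>_cont_Icc: "z \<in> I \<Longrightarrow> continuous_on {0..z} \<delta>"
  by (rule continuous_on_subset[OF \<delta>_cont]) (auto intro: mem_mono)

lemma \<eta>_pos: assumes "z \<in> I" shows "0 < \<eta> z"
proof (cases "z = 0")
  case True
  then show ?thesis using \<delta>_pos assms by (simp add: \<eta>_0)
next
  case False
  then have z: "0 < z" using mem_nonneg[OF assms] by simp
  obtain x where x: "x \<in> {0..z}" "\<And>s. s \<in> {0..z} \<Longrightarrow> \<delta> x \<le> \<delta> s"
    using continuous_attains_inf[OF _ _ \<delta>_cont_Icc[OF assms]] z by (auto simp: Ball_def)
  have "\<delta> x \<le> ball_mean \<delta> z"
    using ball_mean_mono[OF z continuous_on_const \<delta>_cont_Icc[OF assms], of "\<delta> x"] x z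
    by (simp add: ball_mean_const)
  moreover have "0 < \<delta> x" using x(1) mem_mono[OF assms, of x] by (intro \<delta>_pos) simp
  ultimately show ?thesis using \<eta>_eq[OF assms z] by simp
qed

text \<open>The shear term has a sign, so gravity alone bounds the slope from above. The powers are collected so
  that dividing by \<open>\<delta> powr (2 - \<beta>)\<close> leaves a bound independent of \<open>\<delta>\<close>.\<close>

lemma d\<delta>_upper:
  assumes "z \<in> I" "0 < z"
  shows "d\<delta> z \<le> - \<theta> * z * \<eta> z powr (\<beta> - 4/3) * \<delta> z powr (2 - \<beta>) * (\<eta> z + \<alpha>)"
proof -
  have p: "0 < \<delta> z" "0 < \<eta> z" using assms \<delta>_pos \<eta>_pos by auto
  have "3 * (\<beta> - 4/3) / z * B_fun \<beta> (\<delta> z / \<eta> z) * \<eta> z \<le> 0"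
  proof (rule mult_nonpos_nonneg[OF mult_nonpos_nonneg])
    show "3 * (\<beta> - 4/3) / z \<le> 0" using assms \<beta>_le by (simp add: divide_le_0_iff)
    show "0 \<le> B_fun \<beta> (\<delta> z / \<eta> z)" using p \<beta>_gt by (simp add: B_fun_nonneg)
  qed (use p in simp)
  then have "d\<delta> z \<le> (\<delta> z / \<eta> z) powr (1 - \<beta>) * (0 - \<theta> * z * \<eta> z powr (- 1/3) * \<delta> z * (\<eta> z + \<alpha>))"
    unfolding d\<delta>_def slope_def using assms
    by (simp only: less_irrefl if_False if_not_P) (intro mult_left_mono diff_right_mono; simp)
  also have "\<dots> = - \<theta> * z * (\<eta> z powr (\<beta> - 1) * \<eta> z powr (- 1/3)) * (\<delta> z powr (1 - \<beta>) * \<delta> z) * (\<eta> z + \<alpha>)"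
    using p by (simp add: powr_divide powr_diff field_simps)
  also have "\<eta> z powr (\<beta> - 1) * \<eta> z powr (- 1/3) = \<eta> z powr (\<beta> - 4/3)"
    by (simp flip: powr_add)
  also have "\<delta> z powr (1 - \<beta>) * \<delta> z = \<delta> z powr (2 - \<beta>)"
    using p powr_add[of "\<delta> z" "1 - \<beta>" 1] by simp
  finally show ?thesis .
qed

lemma d\<delta>_neg: "z \<in> I \<Longrightarrow> 0 < z \<Longrightarrow> d\<delta> z < 0"
proof -
  assume z: "z \<in> I" "0 < z"
  have "0 < \<theta> * z * \<eta> z powr (\<beta> - 4/3) * \<delta> z powr (2 - \<beta>) * (\<eta> z + \<alpha>)"
    using z \<delta>_pos[of z] \<eta>_pos[of z] \<alpha>_pos \<theta>_pos by (intro mult_pos_pos) auto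
  then show ?thesis using d\<delta>_upper[OF z] by simp
qed

lemma \<delta>_less: assumes "z \<in> I" "0 \<le> x" "x < z" shows "\<delta> z < \<delta> x"
proof (rule DERIV_neg_imp_decreasing_open[OF assms(3)])
  show "\<exists>y. (\<delta> has_real_derivative y) (at s) \<and> y < 0" if "x < s" "s < z" for s
  proof -
    have "s \<in> I" using mem_mono[OF assms(1), of s] that assms(2) by simp
    then show ?thesis
      using \<delta>_deriv_interior d\<delta>_neg that assms(2) by (intro exI[of _ "d\<delta> s"]) auto
  qed
  show "continuous_on {x..z} \<delta>"
    using \<delta>_cont_Icc[OF assms(1)] by (rule continuous_on_subset) (use assms in auto)
qed

lemma \<delta>_le: assumes "z \<in> I" "0 \<le> x" "x \<le> z" shows "\<delta> z \<le> \<delta> x"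
  using \<delta>_less[OF assms(1,2)] assms(3) by (cases "x = z") auto

text \<open>A decreasing function lies below its mean, and its mean below its maximum.\<close>

lemma \<delta>_le_\<eta>: assumes "z \<in> I" shows "\<delta> z \<le> \<eta> z"
  and \<eta>_le_center: "\<eta> z \<le> \<delta> 0"
proof -
  have "\<delta> z \<le> \<eta> z \<and> \<eta> z \<le> \<delta> 0"
  proof (cases "z = 0")
    case False
    then have z: "0 < z" using mem_nonneg[OF assms] by simp
    have "\<delta> z \<le> \<delta> s \<and> \<delta> s \<le> \<delta> 0" if "0 \<le> s" "s \<le> z" for s
      using \<delta>_le[OF assms that] \<delta>_le[OF mem_mono[OF assms that], of 0] that by simp
    then show ?thesis
      using ball_mean_mono[OF z continuous_on_const \<delta>_cont_Icc[OF assms], of "\<delta> z"]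
        ball_mean_mono[OF z \<delta>_cont_Icc[OF assms] continuous_on_const, of "\<delta> 0"]
        \<eta>_eq[OF assms z] z
      by (simp add: ball_mean_const)
  qed (simp add: \<eta>_0)
  then show "\<delta> z \<le> \<eta> z" "\<eta> z \<le> \<delta> 0" by auto
qed

definition d\<eta> :: "real \<Rightarrow> real" where
  "d\<eta> z = (if z = 0 then 0 else - (3 / z) * (\<eta> z - \<delta> z))"

text \<open>Since \<open>0 \<le> \<eta> - \<delta> \<le> \<delta> 0 - \<delta>\<close>, this one limit controls \<open>\<eta>\<close> at the center as well: both
  \<open>\<eta>'\<close> and the quotient \<open>(\<eta> - \<delta>) / z\<close> are squeezed to \<open>0\<close>.\<close>

lemma \<delta>_quotient: "((\<lambda>z. (\<delta> 0 - \<delta> z) / z) \<longlongrightarrow> 0) (at_right 0)"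
proof -
  have "((\<lambda>z. (\<delta> z - \<delta> 0) / (z - 0)) \<longlongrightarrow> 0) (at 0 within {0..})"
    using \<delta>_deriv[OF zero_mem] by (simp add: has_field_derivative_iff d\<delta>_def)
  then have "((\<lambda>z. - ((\<delta> z - \<delta> 0) / (z - 0))) \<longlongrightarrow> - 0) (at_right 0)"
    unfolding at_within_Ici_at_right by (rule tendsto_minus)
  then show ?thesis by (simp add: minus_divide_left)
qed

lemma eventually_mem: "eventually (\<lambda>z. z \<in> I \<and> 0 < z) (at_right 0)"
proof -
  obtain c where "0 < c" "c \<in> I" by (rule from_zero_to_gap[OF zero_mem])
  then show ?thesis
    by (auto simp: eventually_at_right_field intro!: exI[of _ c] intro: mem_mono)
qed

lemma \<eta>_deriv_at: "z \<in> I \<Longrightarrow> (\<eta> has_real_derivative d\<eta> z) (at z within {0..})"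
proof (cases "z = 0")
  case True
  have "((\<lambda>z. - ((\<delta> 0 - \<delta> z) / z)) \<longlongrightarrow> 0) (at_right 0)"
    using tendsto_minus[OF \<delta>_quotient] by simp
  then have "((\<lambda>z. (\<eta> z - \<eta> 0) / z) \<longlongrightarrow> 0) (at_right 0)"
  proof (rule tendsto_sandwich[rotated 2])
    show "eventually (\<lambda>z. - ((\<delta> 0 - \<delta> z) / z) \<le> (\<eta> z - \<eta> 0) / z) (at_right 0)"
      using eventually_mem
    proof eventually_elim
      case (elim x)
      then have "(\<delta> x - \<delta> 0) / x \<le> (\<eta> x - \<delta> 0) / x"
        by (intro divide_right_mono) (auto simp: \<delta>_le_\<eta>)
      then show ?case by (simp add: \<eta>_0 minus_divide_left)
    qed
    show "eventually (\<lambda>z. (\<eta> z - \<eta> 0) / z \<le> 0) (at_right 0)"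
      using eventually_mem
      by eventually_elim (simp add: \<eta>_0 divide_nonpos_pos \<eta>_le_center)
  qed auto
  then show ?thesis
    using True by (simp add: has_field_derivative_iff d\<eta>_def at_within_Ici_at_right)
next
  case False
  assume "z \<in> I"
  with False have "0 < z" using mem_nonneg[of z] by simp
  then show ?thesis
    using \<eta>_deriv[OF \<open>z \<in> I\<close>] by (simp add: d\<eta>_def at_within_Ici_interior)
qed

lemma \<eta>_cont: "continuous_on I \<eta>"
  unfolding continuous_on_eq_continuous_within
  using \<eta>_deriv_at by (auto simp: at_within_from_zero_to intro!: DERIV_continuous)

lemma d\<eta>_cont: "continuous_on I d\<eta>"
  unfolding continuous_on_def
proof
  fix z assume z: "z \<in> I"
  show "(d\<eta> \<longlongrightarrow> d\<eta> z) (at z within I)"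
  proof (cases "z = 0")
    case True
    have "((\<lambda>z. - 3 * ((\<delta> 0 - \<delta> z) / z)) \<longlongrightarrow> 0) (at_right 0)"
      using tendsto_mult_left[OF \<delta>_quotient, of "- 3"] by simp
    then have "(d\<eta> \<longlongrightarrow> 0) (at_right 0)"
    proof (rule tendsto_sandwich[rotated 2])
      show "eventually (\<lambda>z. - 3 * ((\<delta> 0 - \<delta> z) / z) \<le> d\<eta> z) (at_right 0)"
        using eventually_mem
      proof eventually_elim
        case (elim x)
        then have "(\<eta> x - \<delta> x) / x \<le> (\<delta> 0 - \<delta> x) / x"
          by (intro divide_right_mono) (auto simp: \<eta>_le_center)
        moreover have "d\<eta> x = - 3 * ((\<eta> x - \<delta> x) / x)"
          using elim by (simp add: d\<eta>_def field_simps)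
        ultimately show ?case by linarith
      qed
      show "eventually (\<lambda>z. d\<eta> z \<le> 0) (at_right 0)"
        using eventually_mem by eventually_elim (simp add: d\<eta>_def \<delta>_le_\<eta>)
    qed auto
    then show ?thesis
      using True z by (simp add: at_within_from_zero_to at_within_Ici_at_right d\<eta>_def)
  next
    case False
    then have pos: "0 < z" using mem_nonneg[OF z] by simp
    have "continuous (at z within I) (\<lambda>z. - (3 / z) * (\<eta> z - \<delta> z))"
      using \<eta>_cont \<delta>_cont z pos
      by (intro continuous_intros) (auto simp: continuous_on_eq_continuous_within)
    then show ?thesis
      unfolding continuous_within[symmetric]
      by (rule continuous_transform_within[OF _ pos z])
        (auto simp: d\<eta>_def dist_real_def abs_less_iff)
  qed
qed

lemma \<delta>_less_\<eta>: assumes "z \<in> I" "0 < z" shows "\<delta> z < \<eta> z"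
  using ball_mean_less[OF assms(2) continuous_on_const \<delta>_cont_Icc[OF assms(1)], of "\<delta> z"]
    \<delta>_less[OF assms(1)] \<eta>_eq[OF assms] assms(2)
  by (simp add: ball_mean_const)

end

section \<open>Lipschitz estimate for the profile equation\<close>

text \<open>The part of the shear term that depends on \<open>y = \<delta> / \<eta>\<close> alone. Both it and its derivative vanish at
  \<open>y = 1\<close>; this double zero compensates the factor \<open>1 / z\<close> at the center.\<close>

definition shear :: "real \<Rightarrow> real \<Rightarrow> real" where
  "shear \<beta> y = (y powr (2 - \<beta>) + (\<beta> - 1) * y\<^sup>2 - \<beta> * y) / (\<beta> * (\<beta> - 1))"

lemma shear_eq: "0 < y \<Longrightarrow> y powr (1 - \<beta>) * B_fun \<beta> y = shear \<beta> y"
proof -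
  assume y: "0 < y"
  have "y powr (1 - \<beta>) * y = y powr (2 - \<beta>)"
    using y powr_add[of y "1 - \<beta>" 1] by simp
  moreover have "y powr (1 - \<beta>) * y powr (1 + \<beta>) = y\<^sup>2"
    using y powr_add[of y "1 - \<beta>" "1 + \<beta>"] by (simp add: powr_numeral)
  moreover have "y powr (1 - \<beta>) * y powr \<beta> = y"
    using y powr_add[of y "1 - \<beta>" \<beta>] by simp
  ultimately have "y powr (1 - \<beta>) * (y + (\<beta> - 1) * y powr (1 + \<beta>) - \<beta> * y powr \<beta>)
      = y powr (2 - \<beta>) + (\<beta> - 1) * y\<^sup>2 - \<beta> * y"
    by (simp add: distrib_left right_diff_distrib mult.left_commute)
  then show ?thesis
    unfolding B_fun_def shear_def by (metis times_divide_eq_right)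
qed

text \<open>The gravitational part of the slope, up to the factor \<open>\<theta> * z\<close>.\<close>

definition gravity :: "real \<Rightarrow> real \<Rightarrow> real \<Rightarrow> real \<Rightarrow> real" where
  "gravity \<beta> \<alpha> d e = d powr (2 - \<beta>) * e powr (\<beta> - 4/3) * (e + \<alpha>)"

lemma slope_eq:
  assumes "0 < d" "0 < e"
  shows "slope \<theta> \<beta> \<alpha> z d e =
    3 * (\<beta> - 4/3) / z * (e * shear \<beta> (d / e))
    - \<theta> * z * gravity \<beta> \<alpha> d e"
proof -
  have "(d / e) powr (1 - \<beta>) * (e powr (- 1/3) * d) = (d powr (1 - \<beta>) * d) * (e powr (\<beta> - 1) * e powr (- 1/3))"
    using assms by (simp add: powr_divide powr_diff field_simps)
  also have "d powr (1 - \<beta>) * d = d powr (2 - \<beta>)"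
    using assms powr_add[of d "1 - \<beta>" 1] by simp
  also have "e powr (\<beta> - 1) * e powr (- 1/3) = e powr (\<beta> - 4/3)"
    by (simp flip: powr_add)
  finally have 1: "(d / e) powr (1 - \<beta>) * (e powr (- 1/3) * d) = d powr (2 - \<beta>) * e powr (\<beta> - 4/3)" .
  have 2: "(d / e) powr (1 - \<beta>) * B_fun \<beta> (d / e) = shear \<beta> (d / e)"
    using assms by (simp add: shear_eq)
  have "slope \<theta> \<beta> \<alpha> z d e = 3 * (\<beta> - 4/3) / z * (e * ((d / e) powr (1 - \<beta>) * B_fun \<beta> (d / e)))
      - \<theta> * z * ((d / e) powr (1 - \<beta>) * (e powr (- 1/3) * d) * (e + \<alpha>))"
    unfolding slope_def by (simp only: right_diff_distrib mult_ac)
  then show ?thesis unfolding 1 2 gravity_def .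
qed

text \<open>Because the derivative vanishes at \<open>1\<close>, the Lipschitz constant on \<open>[1 - w, 1]\<close> is proportional to
  \<open>w\<close>. On a profile \<open>1 - y\<close> is of order \<open>z\<close>, which cancels the singular factor \<open>1 / z\<close>.\<close>

lemma shear_lipschitz:
  assumes "1 < \<beta>" "0 < a"
  obtains C where "0 \<le> C"
    "\<And>x y w. x \<in> {a..1} \<Longrightarrow> y \<in> {a..1} \<Longrightarrow> 1 - x \<le> w \<Longrightarrow> 1 - y \<le> w \<Longrightarrow>
       \<bar>shear \<beta> x - shear \<beta> y\<bar> \<le> C * w * \<bar>x - y\<bar>"
proof -
  define s' where "s' y = ((2 - \<beta>) * y powr (1 - \<beta>) + 2 * (\<beta> - 1) * y - \<beta>) / (\<beta> * (\<beta> - 1))" for y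
  define s'' where "s'' y = ((2 - \<beta>) * ((1 - \<beta>) * y powr (- \<beta>)) + 2 * (\<beta> - 1)) / (\<beta> * (\<beta> - 1))" for y
  have 1: "(shear \<beta> has_real_derivative s' y) (at y)" if "y \<in> {a..1}" for y
  proof -
    have "((\<lambda>y. y powr (2 - \<beta>) + (\<beta> - 1) * y\<^sup>2 - \<beta> * y) has_real_derivative
        (2 - \<beta>) * y powr (1 - \<beta>) + 2 * (\<beta> - 1) * y - \<beta>) (at y)"
      using that assms by (auto intro!: derivative_eq_intros)
    then show ?thesis
      unfolding shear_def[abs_def] s'_def by (rule DERIV_cdivide)
  qed
  have 2: "(s' has_real_derivative s'' y) (at y)" if "y \<in> {a..1}" for y
  proof -
    have "((\<lambda>y. (2 - \<beta>) * y powr (1 - \<beta>) + 2 * (\<beta> - 1) * y - \<beta>) has_real_derivative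
        (2 - \<beta>) * ((1 - \<beta>) * y powr (- \<beta>)) + 2 * (\<beta> - 1)) (at y)"
      using that assms by (auto intro!: derivative_eq_intros)
    then show ?thesis
      unfolding s'_def[abs_def] s''_def by (rule DERIV_cdivide)
  qed
  have 3: "continuous_on {a..1} s''"
    unfolding s''_def using assms by (intro continuous_intros) auto
  obtain C where C: "0 \<le> C" "\<And>x y. x \<in> {a..1} \<Longrightarrow> y \<in> {a..1} \<Longrightarrow> \<bar>s' x - s' y\<bar> \<le> C * \<bar>x - y\<bar>"
    using lipschitz_of_continuous_derivative[OF 2 3] by metis
  have s'1: "s' 1 = 0"
    by (simp add: s'_def)
  have "\<bar>shear \<beta> x - shear \<beta> y\<bar> \<le> C * w * \<bar>x - y\<bar>"
    if xy: "x \<in> {a..1}" "y \<in> {a..1}" "1 - x \<le> w" "1 - y \<le> w" for x y w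
  proof -
    let ?S = "{max a (1 - w)..1}"
    have "norm (shear \<beta> x - shear \<beta> y) \<le> C * w * norm (x - y)"
    proof (rule field_differentiable_bound[where S = ?S])
      show "(shear \<beta> has_real_derivative s' z) (at z within ?S)" if "z \<in> ?S" for z
        using 1[of z] that by (auto intro: has_field_derivative_at_within)
      show "norm (s' z) \<le> C * w" if z: "z \<in> ?S" for z
      proof -
        have "\<bar>s' z - s' 1\<bar> \<le> C * \<bar>z - 1\<bar>" using z xy by (intro C(2)) auto
        also have "\<dots> \<le> C * w" using z C(1) by (intro mult_left_mono) auto
        finally show ?thesis by (simp add: s'1)
      qed
    qed (use xy in auto)
    then show ?thesis by simp
  qed
  then show thesis using that C(1) by blast
qed

lemma abs_mult_diff_le:
  fixes a b c d :: real
  shows "\<bar>a * b - c * d\<bar> \<le> \<bar>a - c\<bar> * \<bar>b\<bar> + \<bar>c\<bar> * \<bar>b - d\<bar>"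
proof -
  have "a * b - c * d = (a - c) * b + c * (b - d)" by (simp add: algebra_simps)
  then show ?thesis using abs_triangle_ineq[of "(a - c) * b" "c * (b - d)"] by (simp add: abs_mult)
qed

lemma gravity_lipschitz:
  fixes m M \<alpha> \<beta> :: real
  assumes "0 < m"
  obtains C where "0 \<le> C"
    "\<And>d e d' e'. d \<in> {m..M} \<Longrightarrow> e \<in> {m..M} \<Longrightarrow> d' \<in> {m..M} \<Longrightarrow> e' \<in> {m..M} \<Longrightarrow>
       \<bar>gravity \<beta> \<alpha> d e - gravity \<beta> \<alpha> d' e'\<bar> \<le> C * (\<bar>d - d'\<bar> + \<bar>e - e'\<bar>)"
proof -
  define p q where "p = 2 - \<beta>" and "q = \<beta> - 4/3"
  obtain P where P: "0 \<le> P" "\<And>x y. x \<in> {m..M} \<Longrightarrow> y \<in> {m..M} \<Longrightarrow> \<bar>x powr p - y powr p\<bar> \<le> P * \<bar>x - y\<bar>"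
    using powr_lipschitz[OF assms] by metis
  define g where "g e = e powr q * (e + \<alpha>)" for e
  obtain R where R: "0 \<le> R" "\<And>x y. x \<in> {m..M} \<Longrightarrow> y \<in> {m..M} \<Longrightarrow> \<bar>g x - g y\<bar> \<le> R * \<bar>x - y\<bar>"
  proof (rule lipschitz_of_continuous_derivative)
    show "(g has_real_derivative (q * e powr (q - 1) * (e + \<alpha>) + e powr q)) (at e)"
      if "e \<in> {m..M}" for e
      unfolding g_def using that assms by (auto intro!: derivative_eq_intros)
    show "continuous_on {m..M} (\<lambda>e. q * e powr (q - 1) * (e + \<alpha>) + e powr q)"
      using assms by (intro continuous_intros) auto
  qed blast
  have "continuous_on {m..M} (\<lambda>d. d powr p)" "continuous_on {m..M} g"
    unfolding g_def using assms by (auto intro!: continuous_intros)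
  then have "bounded ((\<lambda>d. d powr p) ` {m..M})" "bounded (g ` {m..M})"
    by (auto intro!: compact_imp_bounded compact_continuous_image)
  then obtain S T where ST: "\<forall>y \<in> (\<lambda>d. d powr p) ` {m..M}. norm y \<le> S" "\<forall>y \<in> g ` {m..M}. norm y \<le> T"
    by (auto simp only: bounded_iff)
  have "\<bar>d powr p * g e - d' powr p * g e'\<bar> \<le> (P * \<bar>T\<bar> + \<bar>S\<bar> * R) * (\<bar>d - d'\<bar> + \<bar>e - e'\<bar>)"
    if "d \<in> {m..M}" "e \<in> {m..M}" "d' \<in> {m..M}" "e' \<in> {m..M}" for d e d' e'
  proof -
    have "\<bar>d powr p * g e - d' powr p * g e'\<bar> \<le> \<bar>d powr p - d' powr p\<bar> * \<bar>g e\<bar> + \<bar>d' powr p\<bar> * \<bar>g e - g e'\<bar>"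
      by (rule abs_mult_diff_le)
    also have "\<dots> \<le> (P * \<bar>d - d'\<bar>) * \<bar>T\<bar> + \<bar>S\<bar> * (R * \<bar>e - e'\<bar>)"
    proof (intro add_mono mult_mono)
      show "\<bar>g e\<bar> \<le> \<bar>T\<bar>" using bspec[OF ST(2) imageI[OF that(2)]] by simp
      show "\<bar>d' powr p\<bar> \<le> \<bar>S\<bar>" using bspec[OF ST(1) imageI[OF that(3)]] by simp
    qed (use that P R in auto)
    also have "\<dots> \<le> (P * \<bar>T\<bar> + \<bar>S\<bar> * R) * (\<bar>d - d'\<bar> + \<bar>e - e'\<bar>)"
      using P(1) R(1) by (simp add: algebra_simps add_increasing add_increasing2)
    finally show ?thesis .
  qed
  then show thesis
    using that[of "P * \<bar>T\<bar> + \<bar>S\<bar> * R"] P(1) R(1) by (simp add: g_def gravity_def p_def q_def mult.assoc)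
qed

text \<open>The condition \<open>e - d \<le> c * z\<close> serves two purposes. Near the center it records that \<open>1 - y\<close> is of
  order \<open>z\<close>, so that the constant is uniform down to \<open>z = 0\<close>; on an interval bounded away from
  the center it holds for every pair in the box once \<open>c\<close> is large.\<close>

definition slope_lipschitz_on ::
  "real \<Rightarrow> real \<Rightarrow> real \<Rightarrow> real \<Rightarrow> real \<Rightarrow> real \<Rightarrow> real \<Rightarrow> real \<Rightarrow> bool" where
  "slope_lipschitz_on \<theta> \<beta> \<alpha> b m M c L \<longleftrightarrow> (\<forall>z d e d' e'. 0 < z \<longrightarrow> z \<le> b \<longrightarrow>
     m \<le> d \<longrightarrow> d \<le> e \<longrightarrow> e \<le> M \<longrightarrow> e - d \<le> c * z \<longrightarrow>
     m \<le> d' \<longrightarrow> d' \<le> e' \<longrightarrow> e' \<le> M \<longrightarrow> e' - d' \<le> c * z \<longrightarrow>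
     \<bar>slope \<theta> \<beta> \<alpha> z d e - slope \<theta> \<beta> \<alpha> z d' e'\<bar> \<le> L * (\<bar>d - d'\<bar> + \<bar>e - e'\<bar>))"

lemma slope_lipschitz:
  assumes "1 < \<beta>" "0 < m" "0 \<le> c"
  obtains L where "0 \<le> L" "slope_lipschitz_on \<theta> \<beta> \<alpha> b m M c L"
proof (cases "m \<le> M")
  case False
  then have "slope_lipschitz_on \<theta> \<beta> \<alpha> b m M c 0"
    unfolding slope_lipschitz_on_def by (meson order_trans)
  then show thesis using that by blast
next
  case True
  with assms have M: "0 < M" by simp
  obtain C where C: "0 \<le> C"
    "\<And>x y w. x \<in> {m/M..1} \<Longrightarrow> y \<in> {m/M..1} \<Longrightarrow> 1 - x \<le> w \<Longrightarrow> 1 - y \<le> w \<Longrightarrow>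
       \<bar>shear \<beta> x - shear \<beta> y\<bar> \<le> C * w * \<bar>x - y\<bar>"
    using shear_lipschitz[OF assms(1), of "m/M"] M assms(2) by (metis divide_pos_pos)
  obtain D where D: "0 \<le> D"
    "\<And>d e d' e'. d \<in> {m..M} \<Longrightarrow> e \<in> {m..M} \<Longrightarrow> d' \<in> {m..M} \<Longrightarrow> e' \<in> {m..M} \<Longrightarrow>
       \<bar>gravity \<beta> \<alpha> d e - gravity \<beta> \<alpha> d' e'\<bar> \<le> D * (\<bar>d - d'\<bar> + \<bar>e - e'\<bar>)"
    using gravity_lipschitz[OF assms(2)] by metis
  define k where "k = \<bar>3 * (\<beta> - 4/3)\<bar>"
  define A where "A = C * (c / m)"
  define L where "L = k * (A + M * (A * (M / m\<^sup>2))) + \<bar>\<theta>\<bar> * \<bar>b\<bar> * D"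
  have A: "0 \<le> A" using C assms by (simp add: A_def)
  have "0 \<le> L" using A M assms D by (simp add: L_def k_def)
  moreover have "slope_lipschitz_on \<theta> \<beta> \<alpha> b m M c L"
    unfolding slope_lipschitz_on_def
  proof (intro allI impI)
    fix z d e d' e'
    assume z: "0 < z" "z \<le> b" and 1: "m \<le> d" "d \<le> e" "e \<le> M" "e - d \<le> c * z"
      and 2: "m \<le> d'" "d' \<le> e'" "e' \<le> M" "e' - d' \<le> c * z"
    let ?s = "\<bar>d - d'\<bar> + \<bar>e - e'\<bar>"
    have pos: "0 < d" "0 < e" "0 < d'" "0 < e'" using 1 2 assms by auto
    have ratio: "d / e \<in> {m/M..1} \<and> 1 - d / e \<le> c * z / m"
      if "m \<le> d" "d \<le> e" "e \<le> M" "e - d \<le> c * z" for d e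
    proof -
      have "m / M \<le> d / e" using that assms M by (intro frac_le) auto
      moreover have "1 - d / e = (e - d) / e" using that assms by (simp add: diff_divide_distrib)
      moreover have "(e - d) / e \<le> c * z / m" using that assms z by (intro frac_le) auto
      moreover have "d / e \<le> 1" using that assms by simp
      ultimately show ?thesis by simp
    qed
    have lip: "\<bar>shear \<beta> (d / e) - shear \<beta> (d' / e')\<bar> \<le> C * (c * z / m) * \<bar>d / e - d' / e'\<bar>"
      using ratio[OF 1] ratio[OF 2] by (intro C(2)) auto
    have "\<bar>d / e - d' / e'\<bar> = \<bar>d * e' - d' * e\<bar> / (e * e')"
      using pos by (simp add: abs_divide diff_frac_eq abs_mult mult.commute)
    also have "\<dots> \<le> (\<bar>d - d'\<bar> * M + M * \<bar>e - e'\<bar>) / (m * m)"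
    proof (rule frac_le)
      have "\<bar>d * e' - d' * e\<bar> \<le> \<bar>d - d'\<bar> * \<bar>e'\<bar> + \<bar>d'\<bar> * \<bar>e' - e\<bar>"
        by (rule abs_mult_diff_le)
      also have "\<dots> \<le> \<bar>d - d'\<bar> * M + M * \<bar>e' - e\<bar>"
        using 1 2 pos by (intro add_mono mult_left_mono mult_right_mono) auto
      finally show "\<bar>d * e' - d' * e\<bar> \<le> \<bar>d - d'\<bar> * M + M * \<bar>e - e'\<bar>"
        by (simp add: abs_minus_commute)
      show "m * m \<le> e * e'" using 1 2 assms by (intro mult_mono) auto
    qed (use assms M in auto)
    also have "\<dots> = M / m\<^sup>2 * ?s" by (simp add: power2_eq_square field_simps)
    finally have ratio_diff: "\<bar>d / e - d' / e'\<bar> \<le> M / m\<^sup>2 * ?s" .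
    have "\<bar>shear \<beta> (d / e) - shear \<beta> 1\<bar> \<le> C * (c * z / m) * \<bar>d / e - 1\<bar>"
      using ratio[OF 1] True M assms z by (intro C(2)) auto
    also have "\<dots> \<le> C * (c * z / m) * 1"
      using ratio[OF 1] C(1) assms z pos by (intro mult_left_mono) auto
    finally have shear_le: "\<bar>shear \<beta> (d / e)\<bar> \<le> A * z"
      by (simp add: shear_def A_def mult_ac)
    have "\<bar>e * shear \<beta> (d / e) - e' * shear \<beta> (d' / e')\<bar>
        \<le> \<bar>e - e'\<bar> * \<bar>shear \<beta> (d / e)\<bar> + \<bar>e'\<bar> * \<bar>shear \<beta> (d / e) - shear \<beta> (d' / e')\<bar>"
      by (rule abs_mult_diff_le)
    also have "\<dots> \<le> ?s * (A * z) + M * (A * z * (M / m\<^sup>2 * ?s))"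
    proof (intro add_mono mult_mono shear_le)
      have "C * (c * z / m) * \<bar>d / e - d' / e'\<bar> \<le> A * z * (M / m\<^sup>2 * ?s)"
      proof -
        have "A * z * \<bar>d / e - d' / e'\<bar> \<le> A * z * (M / m\<^sup>2 * ?s)"
          using A z by (intro mult_left_mono ratio_diff) auto
        moreover have "C * (c * z / m) = A * z" by (simp add: A_def)
        ultimately show ?thesis by simp
      qed
      then show "\<bar>shear \<beta> (d / e) - shear \<beta> (d' / e')\<bar> \<le> A * z * (M / m\<^sup>2 * ?s)"
        using lip by linarith
    qed (use 2 pos M in auto)
    also have "\<dots> = z * ((A + M * (A * (M / m\<^sup>2))) * ?s)"
      by (simp add: algebra_simps add_divide_distrib)
    finally have shear_part: "\<bar>e * shear \<beta> (d / e) - e' * shear \<beta> (d' / e')\<bar>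
        \<le> z * ((A + M * (A * (M / m\<^sup>2))) * ?s)" .
    let ?g = "gravity \<beta> \<alpha>"
    let ?X = "e * shear \<beta> (d / e) - e' * shear \<beta> (d' / e')" and ?Y = "?g d e - ?g d' e'"
    have "slope \<theta> \<beta> \<alpha> z d e - slope \<theta> \<beta> \<alpha> z d' e' = 3 * (\<beta> - 4/3) / z * ?X - \<theta> * z * ?Y"
      unfolding slope_eq[OF pos(1,2)] slope_eq[OF pos(3,4)] by (simp only: right_diff_distrib)
    also have "\<bar>\<dots>\<bar> \<le> \<bar>3 * (\<beta> - 4/3) / z * ?X\<bar> + \<bar>\<theta> * z * ?Y\<bar>"
      by (rule abs_triangle_ineq4)
    also have "\<dots> = k / z * \<bar>?X\<bar> + \<bar>\<theta>\<bar> * z * \<bar>?Y\<bar>"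
      using z unfolding k_def by (simp only: abs_mult abs_divide abs_of_pos)
    also have "\<dots> \<le> k / z * (z * ((A + M * (A * (M / m\<^sup>2))) * ?s)) + \<bar>\<theta>\<bar> * \<bar>b\<bar> * (D * ?s)"
      using z 1 2 D(1) by (intro add_mono mult_mono mult_left_mono shear_part D(2)) (auto simp: k_def)
    also have "\<dots> = L * ?s"
      using z by (simp add: L_def algebra_simps)
    finally show "\<bar>slope \<theta> \<beta> \<alpha> z d e - slope \<theta> \<beta> \<alpha> z d' e'\<bar> \<le> L * ?s" .
  qed
  ultimately show thesis by (rule that)
qed

section \<open>Uniqueness of the profile with given central value\<close>

text \<open>Integrating an exponential bound gains the factor \<open>1 / \<mu>\<close>. Measuring differences of solutions with
  the weight \<open>exp (- \<mu> * x)\<close> for large \<open>\<mu>\<close> thus replaces Gronwall's inequality.\<close>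

lemma exponential_weight_bound:
  fixes f f' :: "real \<Rightarrow> real"
  assumes cont: "continuous_on {0..b} f" and f0: "f 0 = 0" and "0 < \<mu>" "0 \<le> C"
    and der: "\<And>s. 0 < s \<Longrightarrow> s < b \<Longrightarrow> (f has_real_derivative f' s) (at s)"
    and le: "\<And>s. 0 < s \<Longrightarrow> s < b \<Longrightarrow> \<bar>f' s\<bar> \<le> C * exp (\<mu> * s)"
    and x: "0 \<le> x" "x \<le> b"
  shows "\<bar>f x\<bar> \<le> C / \<mu> * exp (\<mu> * x)"
proof -
  have aux: "g x \<le> C / \<mu> * exp (\<mu> * x)"
    if g: "continuous_on {0..b} g" "g 0 = 0"
      "\<And>s. 0 < s \<Longrightarrow> s < b \<Longrightarrow> (g has_real_derivative g' s) (at s)"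
      "\<And>s. 0 < s \<Longrightarrow> s < b \<Longrightarrow> g' s \<le> C * exp (\<mu> * s)" for g g' :: "real \<Rightarrow> real"
  proof -
    have "C / \<mu> * exp (\<mu> * 0) - g 0 \<le> C / \<mu> * exp (\<mu> * x) - g x"
    proof (rule DERIV_nonneg_imp_increasing_open[OF x(1)])
      fix s assume s: "0 < s" "s < x"
      have "((\<lambda>x. C / \<mu> * exp (\<mu> * x) - g x) has_real_derivative C * exp (\<mu> * s) - g' s) (at s)"
        using s x \<open>0 < \<mu>\<close> by (auto intro!: derivative_eq_intros g(3))
      then show "\<exists>y. ((\<lambda>x. C / \<mu> * exp (\<mu> * x) - g x) has_real_derivative y) (at s) \<and> 0 \<le> y"
        using g(4)[of s] s x by (intro exI conjI) auto
    next
      show "continuous_on {0..x} (\<lambda>x. C / \<mu> * exp (\<mu> * x) - g x)"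
        using x by (intro continuous_intros continuous_on_subset[OF g(1)]) auto
    qed
    moreover have "0 \<le> C / \<mu>" using assms by simp
    ultimately show ?thesis using g(2) by simp
  qed
  have "f x \<le> C / \<mu> * exp (\<mu> * x)"
    by (rule aux[OF cont f0 der]) (use le in \<open>auto simp: abs_le_iff\<close>)
  moreover have "- f x \<le> C / \<mu> * exp (\<mu> * x)"
    by (rule aux[of "\<lambda>x. - f x" "\<lambda>x. - f' x"])
      (use cont f0 der le in \<open>auto intro!: continuous_intros derivative_intros simp: abs_le_iff\<close>)
  ultimately show ?thesis by (simp add: abs_le_iff)
qed

context profile
begin

text \<open>The mean differs from \<open>\<delta> z\<close> by at most the drop \<open>\<delta> 0 - \<delta> z\<close>, which is of order \<open>z\<close>.\<close>

lemma anisotropy_bound: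
  assumes "b' \<in> I"
  obtains c where "0 \<le> c" "\<And>z. 0 \<le> z \<Longrightarrow> z \<le> b' \<Longrightarrow> \<eta> z - \<delta> z \<le> c * z"
proof -
  have "continuous_on {0..b'} d\<delta>"
    by (rule continuous_on_subset[OF d\<delta>_cont]) (use assms in \<open>auto intro: mem_mono\<close>)
  then have "bounded (d\<delta> ` {0..b'})"
    by (intro compact_imp_bounded compact_continuous_image) auto
  then obtain c where "\<forall>y \<in> d\<delta> ` {0..b'}. norm y \<le> c"
    by (auto simp only: bounded_iff)
  have c: "\<bar>d\<delta> z\<bar> \<le> \<bar>c\<bar>" if "z \<in> {0..b'}" for z
    using bspec[OF \<open>\<forall>y \<in> d\<delta> ` {0..b'}. norm y \<le> c\<close> imageI[OF that]] by simp
  have "\<eta> z - \<delta> z \<le> \<bar>c\<bar> * z" if z: "0 \<le> z" "z \<le> b'" for z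
  proof -
    have zI: "z \<in> I" using mem_mono[OF assms z] .
    have "norm (\<delta> 0 - \<delta> z) \<le> \<bar>c\<bar> * norm (0 - z)"
    proof (rule field_differentiable_bound[where S = "{0..z}"])
      show "(\<delta> has_real_derivative d\<delta> x) (at x within {0..z})" if "x \<in> {0..z}" for x
        by (rule DERIV_subset[OF \<delta>_deriv[OF mem_mono[OF zI]]]) (use that in auto)
      show "norm (d\<delta> x) \<le> \<bar>c\<bar>" if "x \<in> {0..z}" for x
        using c[of x] that z by simp
    qed (use z in auto)
    then show ?thesis using \<eta>_le_center[OF zI] z by simp
  qed
  then show thesis using that[of "\<bar>c\<bar>"] by simp
qed

end

text \<open>Let \<open>N\<close> be the maximum of \<open>\<bar>\<delta> - \<delta>'\<bar>\<close> in the exponentially weighted norm. Ball means do not increase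
  such a bound, so the slopes differ by at most \<open>2 * L * N\<close> in that norm, and integration gives
  \<open>N \<le> N / 2\<close>. The Lipschitz constant is uniform down to the center, so
  the estimate starts at \<open>z = 0\<close>.\<close>

lemma profile_unique:
  assumes p1: "profile \<theta> \<beta> \<alpha> \<delta> \<eta> b" and p2: "profile \<theta> \<beta> \<alpha> \<delta>' \<eta>' b'"
    and center: "\<delta> 0 = \<delta>' 0"
    and a: "a \<in> from_zero_to b" "a \<in> from_zero_to b'"
  shows "\<delta> a = \<delta>' a \<and> \<eta> a = \<eta>' a"
proof -
  interpret p: profile \<theta> \<beta> \<alpha> \<delta> \<eta> b by fact
  interpret q: profile \<theta> \<beta> \<alpha> \<delta>' \<eta>' b' by fact
  have a0: "0 \<le> a" using a(1) p.mem_nonneg by simp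
  define m where "m = min (\<delta> a) (\<delta>' a)"
  have m: "0 < m" using p.\<delta>_pos q.\<delta>_pos a by (simp add: m_def)
  obtain c1 where c1: "0 \<le> c1" "\<And>z. 0 \<le> z \<Longrightarrow> z \<le> a \<Longrightarrow> \<eta> z - \<delta> z \<le> c1 * z"
    using p.anisotropy_bound[OF a(1)] by metis
  obtain c2 where c2: "0 \<le> c2" "\<And>z. 0 \<le> z \<Longrightarrow> z \<le> a \<Longrightarrow> \<eta>' z - \<delta>' z \<le> c2 * z"
    using q.anisotropy_bound[OF a(2)] by metis
  define c where "c = max c1 c2"
  have c: "0 \<le> c" using c1 by (simp add: c_def)
  obtain L where L: "0 \<le> L" "slope_lipschitz_on \<theta> \<beta> \<alpha> a m (\<delta> 0) c L"
    by (rule slope_lipschitz[OF p.\<beta>_gt m c])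
  \<comment> \<open>From \<open>\<mu> \<ge> 4 * L\<close> on, the weighted maximum is at most half of itself; the summand \<open>1\<close> covers \<open>L = 0\<close>.\<close>
  define \<mu> where "\<mu> = 4 * L + 1"
  have \<mu>: "0 < \<mu>" "2 * L / \<mu> \<le> 1/2" using L(1) by (auto simp: \<mu>_def field_simps)
  define f where "f z = \<delta> z - \<delta>' z" for z
  have cont: "continuous_on {0..a} f"
    unfolding f_def by (intro continuous_intros p.\<delta>_cont_Icc q.\<delta>_cont_Icc a)
  obtain x where x: "x \<in> {0..a}" "\<And>z. z \<in> {0..a} \<Longrightarrow> \<bar>f z\<bar> * exp (- \<mu> * z) \<le> \<bar>f x\<bar> * exp (- \<mu> * x)"
  proof -
    have "continuous_on {0..a} (\<lambda>z. \<bar>f z\<bar> * exp (- \<mu> * z))"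
      by (intro continuous_intros cont)
    then show thesis
      using continuous_attains_sup[of "{0..a}" "\<lambda>z. \<bar>f z\<bar> * exp (- \<mu> * z)"] a0 that by auto
  qed
  define N where "N = \<bar>f x\<bar> * exp (- \<mu> * x)"
  have N: "0 \<le> N" by (simp add: N_def)
  have f_le: "\<bar>f z\<bar> \<le> N * exp (\<mu> * z)" if "z \<in> {0..a}" for z
  proof -
    have "\<bar>f z\<bar> * exp (- \<mu> * z) * exp (\<mu> * z) \<le> N * exp (\<mu> * z)"
      unfolding N_def using x(2)[OF that] by (rule mult_right_mono) simp
    then show ?thesis by (simp add: mult.assoc flip: exp_add)
  qed
  have \<eta>_le: "\<bar>\<eta> z - \<eta>' z\<bar> \<le> N * exp (\<mu> * z)" if z: "0 < z" "z \<le> a" for z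
  proof -
    have zI: "z \<in> from_zero_to b" "z \<in> from_zero_to b'"
      using z by (auto intro: p.mem_mono[OF a(1)] q.mem_mono[OF a(2)])
    have "\<bar>ball_mean \<delta> z - ball_mean \<delta>' z\<bar> \<le> N * exp (\<mu> * z)"
    proof (rule ball_mean_close[OF z(1) p.\<delta>_cont_Icc[OF zI(1)] q.\<delta>_cont_Icc[OF zI(2)]])
      fix s assume s: "0 \<le> s" "s \<le> z"
      have "\<bar>\<delta> s - \<delta>' s\<bar> \<le> N * exp (\<mu> * s)"
        using f_le[of s] s z by (simp add: f_def)
      also have "\<dots> \<le> N * exp (\<mu> * z)" using s N \<mu> by (intro mult_left_mono) auto
      finally show "\<bar>\<delta> s - \<delta>' s\<bar> \<le> N * exp (\<mu> * z)" .
    qed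
    then show ?thesis using p.\<eta>_eq q.\<eta>_eq zI z by simp
  qed
  have "\<bar>f x\<bar> \<le> (2 * L * N) / \<mu> * exp (\<mu> * x)"
  proof (rule exponential_weight_bound[OF cont])
    show "f 0 = 0" using center by (simp add: f_def)
    show "0 \<le> 2 * L * N" using L N by simp
    show "0 \<le> x" "x \<le> a" using x by auto
    fix s assume s: "0 < s" "s < a"
    have sI: "s \<in> from_zero_to b" "s \<in> from_zero_to b'"
      using s by (auto intro: p.mem_mono[OF a(1)] q.mem_mono[OF a(2)])
    show "(f has_real_derivative p.d\<delta> s - q.d\<delta> s) (at s)"
      unfolding f_def using s sI
      by (intro derivative_intros p.\<delta>_deriv_interior q.\<delta>_deriv_interior)
    have cs: "c1 * s \<le> c * s" "c2 * s \<le> c * s"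
      using s by (auto simp: c_def intro!: mult_right_mono)
    have "\<bar>p.d\<delta> s - q.d\<delta> s\<bar> \<le> L * (\<bar>\<delta> s - \<delta>' s\<bar> + \<bar>\<eta> s - \<eta>' s\<bar>)"
    proof -
      have "m \<le> \<delta> s" "m \<le> \<delta>' s"
        using p.\<delta>_le[OF a(1), of s] q.\<delta>_le[OF a(2), of s] s by (auto simp: m_def)
      moreover have "\<eta> s \<le> \<delta> 0" "\<eta>' s \<le> \<delta> 0" "\<delta> s \<le> \<eta> s" "\<delta>' s \<le> \<eta>' s"
        using sI p.\<eta>_le_center q.\<eta>_le_center p.\<delta>_le_\<eta> q.\<delta>_le_\<eta> center by auto
      moreover have "\<eta> s - \<delta> s \<le> c * s" "\<eta>' s - \<delta>' s \<le> c * s"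
        using c1(2)[of s] c2(2)[of s] cs s by linarith+
      ultimately show ?thesis
        using s L(2) by (simp add: p.d\<delta>_def q.d\<delta>_def slope_lipschitz_on_def)
    qed
    also have "\<dots> \<le> L * (N * exp (\<mu> * s) + N * exp (\<mu> * s))"
      using f_le[of s] \<eta>_le[of s] s L(1) unfolding f_def by (intro mult_left_mono add_mono) auto
    finally show "\<bar>p.d\<delta> s - q.d\<delta> s\<bar> \<le> 2 * L * N * exp (\<mu> * s)" by (simp add: mult_ac)
  qed (use \<mu> in auto)
  then have "\<bar>f x\<bar> * exp (- \<mu> * x) \<le> (2 * L * N) / \<mu> * exp (\<mu> * x) * exp (- \<mu> * x)"
    by (intro mult_right_mono) auto
  also have "\<dots> = 2 * L / \<mu> * N" by (simp add: mult.assoc flip: exp_add)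
  also have "\<dots> \<le> 1/2 * N" using \<mu> N by (intro mult_right_mono) auto
  finally have "N \<le> 0" by (simp add: N_def)
  then have N0: "N = 0" using N by simp
  have "\<delta> a = \<delta>' a" using f_le[of a] a0 by (simp add: N0 f_def)
  moreover have "\<eta> a = \<eta>' a"
  proof (cases "a = 0")
    case True
    then show ?thesis using center p.\<eta>_0 q.\<eta>_0 by simp
  next
    case False
    then show ?thesis using \<eta>_le[of a] a0 by (simp add: N0)
  qed
  ultimately show ?thesis by simp
qed

section \<open>Local solvability away from the center\<close>

text \<open>Picard's theorem for a right-hand side that may depend on the whole function rather than on its value
  at one point, by Banach's fixed point theorem on the bounded continuous functions. This form
  fits because \<open>\<eta>\<close> is an integral of \<open>\<delta>\<close>: the system is treated as one equation for \<open>\<delta>\<close>.\<close>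

lemma volterra_fixed_point:
  fixes g :: "(real \<Rightarrow> real) \<Rightarrow> real \<Rightarrow> real"
  defines "adm \<equiv> \<lambda>a \<epsilon> r d \<phi>. continuous_on {a..a + \<epsilon>} \<phi> \<and> (\<forall>s\<in>{a..a + \<epsilon>}. \<bar>\<phi> s - d\<bar> \<le> r)"
  assumes "0 < \<epsilon>" "0 \<le> r" "0 \<le> C" "\<epsilon> * V \<le> r" "\<epsilon> * C \<le> 1/2"
    and cont: "\<And>\<phi>. adm a \<epsilon> r d \<phi> \<Longrightarrow> continuous_on {a..a + \<epsilon>} (g \<phi>)"
    and bound: "\<And>\<phi> s. adm a \<epsilon> r d \<phi> \<Longrightarrow> s \<in> {a..a + \<epsilon>} \<Longrightarrow> \<bar>g \<phi> s\<bar> \<le> V"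
    and lip: "\<And>\<phi> \<psi> N s. adm a \<epsilon> r d \<phi> \<Longrightarrow> adm a \<epsilon> r d \<psi> \<Longrightarrow>
      (\<And>t. t \<in> {a..a + \<epsilon>} \<Longrightarrow> \<bar>\<phi> t - \<psi> t\<bar> \<le> N) \<Longrightarrow> s \<in> {a..a + \<epsilon>} \<Longrightarrow>
      \<bar>g \<phi> s - g \<psi> s\<bar> \<le> C * N"
  obtains \<phi> where "adm a \<epsilon> r d \<phi>"
    "\<And>z. z \<in> {a..a + \<epsilon>} \<Longrightarrow> \<phi> z = d + integral {a..z} (g \<phi>)"
proof -
  define clamp where "clamp z = max a (min (a + \<epsilon>) z)" for z
  have clamp: "clamp z \<in> {a..a + \<epsilon>}" for z using \<open>0 < \<epsilon>\<close> by (auto simp: clamp_def)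
  have clamp_id: "clamp z = z" if "z \<in> {a..a + \<epsilon>}" for z using that by (auto simp: clamp_def)
  define S :: "(real \<Rightarrow>\<^sub>C real) set" where "S = PiC UNIV (\<lambda>_. cball d r)"
  have S_iff: "\<phi> \<in> S \<longleftrightarrow> (\<forall>z. \<bar>apply_bcontfun \<phi> z - d\<bar> \<le> r)" for \<phi>
    by (simp add: S_def mem_PiC_iff Pi_iff dist_real_def abs_minus_commute)
  have S_adm: "adm a \<epsilon> r d (apply_bcontfun \<phi>)" if "\<phi> \<in> S" for \<phi>
    using that by (simp add: adm_def S_iff)
  define J where "J \<phi> z = d + integral {a..clamp z} (g \<phi>)" for \<phi> z
  have int: "g \<phi> integrable_on {a..clamp z}" if "adm a \<epsilon> r d \<phi>" for \<phi> z
    by (rule integrable_continuous_real, rule continuous_on_subset[OF cont[OF that]])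
      (use clamp[of z] in auto)
  have int_le: "\<bar>integral {a..clamp z} h\<bar> \<le> \<epsilon> * N"
    if "h integrable_on {a..clamp z}" "\<And>s. s \<in> {a..a + \<epsilon>} \<Longrightarrow> \<bar>h s\<bar> \<le> N" for h N z
  proof -
    have "norm (integral {a..clamp z} h) \<le> integral {a..clamp z} (\<lambda>_. N)"
      by (rule integral_norm_bound_integral[OF that(1)]) (use that(2) clamp[of z] in auto)
    also have "\<dots> = (clamp z - a) * N" using clamp[of z] by simp
    also have "\<dots> \<le> \<epsilon> * N"
      using clamp[of z] that(2)[of a] \<open>0 < \<epsilon>\<close> by (intro mult_right_mono) (auto intro: order_trans)
    finally show ?thesis by simp
  qed
  have J_le: "\<bar>J \<phi> z - d\<bar> \<le> r" if "adm a \<epsilon> r d \<phi>" for \<phi> z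
    using int_le[OF int[OF that] bound[OF that]] \<open>\<epsilon> * V \<le> r\<close> by (auto simp: J_def intro: order_trans)
  have J_cont: "continuous_on UNIV (J \<phi>)" if "adm a \<epsilon> r d \<phi>" for \<phi>
  proof -
    have "continuous_on {a..a + \<epsilon>} (\<lambda>x. integral {a..x} (g \<phi>))"
      by (intro indefinite_integral_continuous_1 integrable_continuous_real cont that)
    moreover have "continuous_on UNIV clamp"
      unfolding clamp_def by (intro continuous_intros)
    ultimately have "continuous_on UNIV (\<lambda>z. integral {a..clamp z} (g \<phi>))"
      by (rule continuous_on_compose2) (use clamp in auto)
    then show ?thesis unfolding J_def by (intro continuous_intros)
  qed
  have J_bcontfun: "J \<phi> \<in> bcontfun" if "adm a \<epsilon> r d \<phi>" for \<phi>
  proof (rule bcontfun_normI[OF J_cont[OF that]])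
    show "norm (J \<phi> z) \<le> \<bar>d\<bar> + r" for z using J_le[OF that, of z] by simp
  qed
  define T where "T \<phi> = Bcontfun (J (apply_bcontfun \<phi>))" for \<phi> :: "real \<Rightarrow>\<^sub>C real"
  have T: "apply_bcontfun (T \<phi>) = J (apply_bcontfun \<phi>)" if "\<phi> \<in> S" for \<phi>
    unfolding T_def by (rule Bcontfun_inverse[OF J_bcontfun[OF S_adm[OF that]]])
  have "\<exists>!\<phi>\<in>S. T \<phi> = \<phi>"
  proof (rule Banach_fix)
    show "complete S"
      unfolding S_def by (intro closed_PiC[THEN complete_eq_closed[THEN iffD2]]) auto
    have "const_bcontfun d \<in> S" using \<open>0 \<le> r\<close> by (simp add: S_iff const_bcontfun.rep_eq)
    then show "S \<noteq> {}" by blast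
    show "T ` S \<subseteq> S"
      using T J_le[OF S_adm] by (auto simp: S_iff)
    show "dist (T \<phi>) (T \<psi>) \<le> 1/2 * dist \<phi> \<psi>" if "\<phi> \<in> S" "\<psi> \<in> S" for \<phi> \<psi>
    proof (rule dist_bound)
      fix z
      let ?N = "dist \<phi> \<psi>" and ?f = "apply_bcontfun \<phi>" and ?h = "apply_bcontfun \<psi>"
      have adm: "adm a \<epsilon> r d ?f" "adm a \<epsilon> r d ?h" using that S_adm by auto
      have "\<bar>integral {a..clamp z} (\<lambda>s. g ?f s - g ?h s)\<bar> \<le> \<epsilon> * (C * ?N)"
      proof (rule int_le)
        show "(\<lambda>s. g ?f s - g ?h s) integrable_on {a..clamp z}"
          by (intro integrable_diff int adm)
        show "\<bar>g ?f s - g ?h s\<bar> \<le> C * ?N" if "s \<in> {a..a + \<epsilon>}" for s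
          using dist_bounded[of \<phi> _ \<psi>] that by (intro lip adm) (auto simp: dist_real_def)
      qed
      also have "\<dots> \<le> 1/2 * ?N"
        using mult_right_mono[OF \<open>\<epsilon> * C \<le> 1/2\<close>, of ?N] by (simp add: mult.assoc)
      finally have "\<bar>integral {a..clamp z} (\<lambda>s. g ?f s - g ?h s)\<bar> \<le> 1/2 * ?N" .
      then show "dist (apply_bcontfun (T \<phi>) z) (apply_bcontfun (T \<psi>) z) \<le> 1/2 * ?N"
        using that by (simp add: T J_def dist_real_def integral_diff int adm)
    qed
  qed auto
  then obtain \<phi> where \<phi>: "\<phi> \<in> S" "T \<phi> = \<phi>" by blast
  show thesis
  proof (rule that[OF S_adm[OF \<phi>(1)]])
    show "apply_bcontfun \<phi> z = d + integral {a..z} (g (apply_bcontfun \<phi>))"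
      if "z \<in> {a..a + \<epsilon>}" for z
      using T[OF \<phi>(1)] unfolding \<phi>(2) by (metis J_def clamp_id that)
  qed
qed

lemma continuous_on_slope:
  assumes "continuous_on S d" "continuous_on S e" "1 < \<beta>"
    and "\<And>z. z \<in> S \<Longrightarrow> 0 < z" "\<And>z. z \<in> S \<Longrightarrow> 0 < d z" "\<And>z. z \<in> S \<Longrightarrow> 0 < e z"
  shows "continuous_on S (\<lambda>z. slope \<theta> \<beta> \<alpha> z (d z) (e z))"
  unfolding slope_def B_fun_def
  using assms by (intro continuous_intros) (auto simp: less_imp_neq[symmetric] dest: less_imp_neq)

text \<open>The ball mean at \<open>s \<ge> z0\<close> of a function with ball mean \<open>e0\<close> at \<open>z0\<close> that is continued by \<open>\<phi>\<close>.\<close>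

definition continued_mean :: "real \<Rightarrow> real \<Rightarrow> (real \<Rightarrow> real) \<Rightarrow> real \<Rightarrow> real" where
  "continued_mean z0 e0 \<phi> s = (z0 ^ 3 * e0 + 3 * integral {z0..s} (\<lambda>t. \<phi> t * t\<^sup>2)) / s ^ 3"

lemma continued_mean_const:
  assumes "0 < z0" "z0 \<le> s"
  shows "continued_mean z0 e0 (\<lambda>_. e0) s = e0"
  unfolding continued_mean_def
  using assms by (subst integral_unique[OF has_integral_square]) (auto simp: field_simps)

text \<open>The shell between \<open>z0\<close> and \<open>s\<close> carries a fraction \<open>1 - (z0 / s) ^ 3\<close> of the volume, so on a short
  interval the mean is insensitive to the continuation.\<close>

lemma continued_mean_close:
  assumes "0 < z0" "z0 \<le> s" "s \<le> z0 + \<epsilon>" "continuous_on {z0..s} \<phi>" "continuous_on {z0..s} \<psi>"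
    and "\<And>t. t \<in> {z0..s} \<Longrightarrow> \<bar>\<phi> t - \<psi> t\<bar> \<le> N"
  shows "\<bar>continued_mean z0 e0 \<phi> s - continued_mean z0 e0 \<psi> s\<bar> \<le> 3 * \<epsilon> / z0 * N"
proof -
  have s: "0 < s" "0 \<le> N" using assms(1,2) assms(6)[of s] by (auto intro: order_trans)
  have "continued_mean z0 e0 \<phi> s - continued_mean z0 e0 \<psi> s
      = 3 * integral {z0..s} (\<lambda>t. (\<phi> t - \<psi> t) * t\<^sup>2) / s ^ 3"
    using assms by (simp add: continued_mean_def left_diff_distrib integral_diff
        integrable_times_square diff_divide_distrib add_divide_distrib right_diff_distrib)
  moreover
  have "norm (integral {z0..s} (\<lambda>t. (\<phi> t - \<psi> t) * t\<^sup>2)) \<le> integral {z0..s} (\<lambda>t. N * t\<^sup>2)"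
  proof (rule integral_norm_bound_integral)
    show "(\<lambda>t. (\<phi> t - \<psi> t) * t\<^sup>2) integrable_on {z0..s}"
      using assms by (intro integrable_times_square continuous_intros)
    show "(\<lambda>t. N * t\<^sup>2) integrable_on {z0..s}"
      by (intro integrable_times_square continuous_intros)
    show "norm ((\<phi> t - \<psi> t) * t\<^sup>2) \<le> N * t\<^sup>2" if "t \<in> {z0..s}" for t
      using mult_right_mono[OF assms(6)[OF that], of "t\<^sup>2"] by (simp add: abs_mult)
  qed
  then have "3 * \<bar>integral {z0..s} (\<lambda>t. (\<phi> t - \<psi> t) * t\<^sup>2)\<bar> \<le> N * (s ^ 3 - z0 ^ 3)"
    unfolding integral_unique[OF has_integral_square[OF assms(2)]] by simp
  ultimately have "\<bar>continued_mean z0 e0 \<phi> s - continued_mean z0 e0 \<psi> s\<bar> \<le> N * (s ^ 3 - z0 ^ 3) / s ^ 3"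
    using s by (simp add: abs_mult divide_right_mono)
  also have "\<dots> \<le> N * (3 * \<epsilon> * s\<^sup>2) / s ^ 3"
  proof (intro divide_right_mono mult_left_mono)
    have "s ^ 3 - z0 ^ 3 = (s - z0) * (s\<^sup>2 + s * z0 + z0\<^sup>2)"
      by (simp add: power2_eq_square power3_eq_cube algebra_simps)
    also have "\<dots> \<le> \<epsilon> * (s\<^sup>2 + s\<^sup>2 + s\<^sup>2)"
      using assms(1-3) by (intro mult_mono add_mono) (auto simp: power2_eq_square intro!: mult_mono)
    finally show "s ^ 3 - z0 ^ 3 \<le> 3 * \<epsilon> * s\<^sup>2" by simp
  qed (use s in auto)
  also have "\<dots> = 3 * \<epsilon> / s * N" using s by (simp add: field_simps power2_eq_square power3_eq_cube)
  also have "\<dots> \<le> 3 * \<epsilon> / z0 * N"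
    using assms(1-3) s by (intro mult_right_mono divide_left_mono) auto
  finally show ?thesis .
qed

lemma continued_mean_cont:
  assumes "0 < z0" "continuous_on {z0..z1} \<phi>"
  shows "continuous_on {z0..z1} (continued_mean z0 e0 \<phi>)"
  unfolding continued_mean_def
  using assms
  by (intro continuous_intros indefinite_integral_continuous_1 integrable_times_square) auto

text \<open>Away from the center and from vacuum the profile equation is regular. Initial data with \<open>d0 < e0\<close> stay
  in the region \<open>d \<le> e\<close>, where the Lipschitz estimate holds, for a short while.\<close>

lemma local_continuation:
  assumes "1 < \<beta>" "0 < z0" "0 < d0" "d0 < e0"
  obtains \<epsilon> \<phi> where "0 < \<epsilon>" "continuous_on {z0..z0 + \<epsilon>} \<phi>"
    "\<And>z. z \<in> {z0..z0 + \<epsilon>} \<Longrightarrow> 0 < \<phi> z \<and> 0 < continued_mean z0 e0 \<phi> z"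
    "\<And>z. z \<in> {z0..z0 + \<epsilon>} \<Longrightarrow>
      \<phi> z = d0 + integral {z0..z} (\<lambda>s. slope \<theta> \<beta> \<alpha> s (\<phi> s) (continued_mean z0 e0 \<phi> s))"
proof -
  let ?F = "slope \<theta> \<beta> \<alpha>" and ?mean = "continued_mean z0 e0"
  \<comment> \<open>Deviations up to \<open>r\<close> keep \<open>d \<ge> d0 / 2\<close> and \<open>d \<le> e\<close>.\<close>
  define r where "r = min ((e0 - d0) / 2) (d0 / 2)"
  define M where "M = e0 + r"
  have "r \<le> (e0 - d0) / 2" "r \<le> d0 / 2" unfolding r_def by (rule min.cobounded1 min.cobounded2)+
  then have r: "0 < r" "2 * r \<le> e0 - d0" "2 * r \<le> d0" using assms by (auto simp: r_def)
  have M: "0 < M" using assms r by (simp add: M_def)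
  \<comment> \<open>With \<open>c = M / z0\<close> the condition \<open>e - d \<le> c * z\<close> holds for all \<open>z \<ge> z0\<close>.\<close>
  have "0 < d0 / 2" "0 \<le> M / z0" using assms M by auto
  then obtain L where L: "0 \<le> L" "slope_lipschitz_on \<theta> \<beta> \<alpha> (z0 + 1) (d0 / 2) M (M / z0) L"
    by (rule slope_lipschitz[OF \<open>1 < \<beta>\<close>])
  have lip: "\<bar>?F z d e - ?F z d' e'\<bar> \<le> L * (\<bar>d - d'\<bar> + \<bar>e - e'\<bar>)"
    if z: "z0 \<le> z" "z \<le> z0 + 1" and b: "\<bar>d - d0\<bar> \<le> r" "\<bar>e - e0\<bar> \<le> r" "\<bar>d' - d0\<bar> \<le> r" "\<bar>e' - e0\<bar> \<le> r"
    for z d e d' e'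
  proof -
    have Mz: "M \<le> M / z0 * z" using z M assms by (simp add: field_simps)
    have box: "d0 / 2 \<le> d \<and> d \<le> e \<and> e \<le> M \<and> e - d \<le> M"
      if "\<bar>d - d0\<bar> \<le> r" "\<bar>e - e0\<bar> \<le> r" for d e
      using that r assms(3) by (simp add: M_def abs_le_iff)
    show ?thesis
      by (intro L(2)[unfolded slope_lipschitz_on_def, rule_format])
        (use box[OF b(1,2)] box[OF b(3,4)] Mz z assms(2) in linarith)+
  qed
  have "continuous_on {z0..z0 + 1} (\<lambda>z. ?F z d0 e0)"
    using assms by (intro continuous_on_slope continuous_intros) auto
  then have "bounded ((\<lambda>z. ?F z d0 e0) ` {z0..z0 + 1})"
    by (intro compact_imp_bounded compact_continuous_image) auto
  then obtain V0 where V0: "\<forall>y \<in> (\<lambda>z. ?F z d0 e0) ` {z0..z0 + 1}. norm y \<le> V0"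
    by (auto simp only: bounded_iff)
  define V where "V = \<bar>V0\<bar> + L * (2 * r)"
  have V: "0 \<le> V" using L(1) r by (simp add: V_def)
  have bound: "\<bar>?F z d e\<bar> \<le> V"
    if z: "z0 \<le> z" "z \<le> z0 + 1" and b: "\<bar>d - d0\<bar> \<le> r" "\<bar>e - e0\<bar> \<le> r" for z d e
  proof -
    have "\<bar>?F z d e - ?F z d0 e0\<bar> \<le> L * (\<bar>d - d0\<bar> + \<bar>e - e0\<bar>)"
      using that r by (intro lip) auto
    also have "\<dots> \<le> L * (2 * r)" using b L(1) by (intro mult_left_mono) auto
    finally show ?thesis using bspec[OF V0 imageI[of z]] z by (auto simp: V_def)
  qed
  \<comment> \<open>In this order: staying below \<open>z0 + 1\<close>, the means do not enlarge differences and stay within \<open>r\<close>, the solution stays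
    within \<open>r\<close>, and the Picard map contracts.\<close>
  define \<epsilon> where "\<epsilon> = min (min 1 (z0 / 3)) (min (r * z0 / (3 * M)) (min (r / (V + 1)) (1 / (4 * L + 1))))"
  have "0 < r * z0 / (3 * M)" "0 < r / (V + 1)" "0 < 1 / (4 * L + 1)" "0 < z0 / 3"
    using assms r M V L(1) by auto
  then have "0 < \<epsilon>" by (simp only: \<epsilon>_def min_less_iff_conj zero_less_one simp_thms)
  moreover have "\<epsilon> \<le> 1" "\<epsilon> \<le> z0 / 3" "\<epsilon> \<le> r * z0 / (3 * M)" "\<epsilon> \<le> r / (V + 1)" "\<epsilon> \<le> 1 / (4 * L + 1)"
    unfolding \<epsilon>_def by (blast intro: min.coboundedI1 min.coboundedI2 order_refl)+
  ultimately have \<epsilon>: "0 < \<epsilon>" "\<epsilon> \<le> 1" "\<epsilon> \<le> z0 / 3" "\<epsilon> \<le> r * z0 / (3 * M)"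
    "\<epsilon> \<le> r / (V + 1)" "\<epsilon> \<le> 1 / (4 * L + 1)" .
  have \<epsilon>1: "3 * \<epsilon> / z0 \<le> 1" "3 * \<epsilon> / z0 * M \<le> r"
    using \<epsilon>(3,4) assms(2) M by (auto simp: field_simps)
  have \<epsilon>V: "\<epsilon> * V \<le> r"
  proof -
    have "\<epsilon> * V \<le> \<epsilon> * (V + 1)" using \<epsilon>(1) by simp
    also have "\<dots> \<le> r" using \<epsilon>(5) V by (simp add: pos_le_divide_eq)
    finally show ?thesis .
  qed
  have \<epsilon>L: "\<epsilon> * (2 * L) \<le> 1/2"
  proof -
    have "\<epsilon> * (4 * L + 1) \<le> 1" using \<epsilon>(6) L(1) by (simp add: pos_le_divide_eq)
    then show ?thesis using \<epsilon>(1) by (simp add: algebra_simps)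
  qed
  define adm where "adm \<phi> \<longleftrightarrow> continuous_on {z0..z0 + \<epsilon>} \<phi> \<and> (\<forall>s\<in>{z0..z0 + \<epsilon>}. \<bar>\<phi> s - d0\<bar> \<le> r)" for \<phi>
  have adm_cont: "continuous_on {z0..s} \<phi>" if "adm \<phi>" "s \<in> {z0..z0 + \<epsilon>}" for \<phi> s
    by (rule continuous_on_subset[of "{z0..z0 + \<epsilon>}"]) (use that in \<open>auto simp: adm_def\<close>)
  have adm_mean: "\<bar>?mean \<phi> s - e0\<bar> \<le> r" if a: "adm \<phi>" "s \<in> {z0..z0 + \<epsilon>}" for \<phi> s
  proof -
    have "\<bar>?mean \<phi> s - ?mean (\<lambda>_. e0) s\<bar> \<le> 3 * \<epsilon> / z0 * M"
    proof (rule continued_mean_close)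
      show "continuous_on {z0..s} \<phi>" using adm_cont a .
      show "\<bar>\<phi> t - e0\<bar> \<le> M" if "t \<in> {z0..s}" for t
      proof -
        have "\<bar>\<phi> t - d0\<bar> \<le> r" using a that by (auto simp: adm_def)
        then show ?thesis using r assms unfolding M_def abs_le_iff by linarith
      qed
    qed (use a assms in auto)
    then show ?thesis using \<epsilon>1(2) a assms by (simp add: continued_mean_const)
  qed
  let ?g = "\<lambda>\<phi> s. ?F s (\<phi> s) (?mean \<phi> s)"
  have pos: "0 < \<phi> s \<and> 0 < ?mean \<phi> s" if "adm \<phi>" "s \<in> {z0..z0 + \<epsilon>}" for \<phi> s
  proof -
    have "\<bar>\<phi> s - d0\<bar> \<le> r" using that by (auto simp: adm_def)
    then show ?thesis using adm_mean[OF that] r assms unfolding abs_le_iff by linarith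
  qed
  obtain \<phi> where \<phi>: "adm \<phi>" "\<And>z. z \<in> {z0..z0 + \<epsilon>} \<Longrightarrow> \<phi> z = d0 + integral {z0..z} (?g \<phi>)"
  proof (rule volterra_fixed_point[of \<epsilon> r "2 * L" V z0 d0 ?g, folded adm_def])
    show "continuous_on {z0..z0 + \<epsilon>} (?g \<phi>)" if "adm \<phi>" for \<phi>
      using that assms(1,2) pos[OF that]
      by (intro continuous_on_slope continued_mean_cont) (auto simp: adm_def)
    show "\<bar>?g \<phi> s\<bar> \<le> V" if "adm \<phi>" "s \<in> {z0..z0 + \<epsilon>}" for \<phi> s
      using that adm_mean[OF that] \<epsilon>(2) by (intro bound) (auto simp: adm_def)
    show "\<bar>?g \<phi> s - ?g \<psi> s\<bar> \<le> 2 * L * N"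
      if "adm \<phi>" "adm \<psi>" and N: "\<And>t. t \<in> {z0..z0 + \<epsilon>} \<Longrightarrow> \<bar>\<phi> t - \<psi> t\<bar> \<le> N"
        and s: "s \<in> {z0..z0 + \<epsilon>}" for \<phi> \<psi> N s
    proof -
      have "0 \<le> N" using N[OF s] by simp
      have "\<bar>?mean \<phi> s - ?mean \<psi> s\<bar> \<le> 3 * \<epsilon> / z0 * N"
        using that assms by (intro continued_mean_close adm_cont) auto
      also have "\<dots> \<le> 1 * N" using \<epsilon>1(1) \<open>0 \<le> N\<close> by (intro mult_right_mono)
      finally have "\<bar>?mean \<phi> s - ?mean \<psi> s\<bar> \<le> N" by simp
      moreover have "\<bar>?g \<phi> s - ?g \<psi> s\<bar>
          \<le> L * (\<bar>\<phi> s - \<psi> s\<bar> + \<bar>?mean \<phi> s - ?mean \<psi> s\<bar>)"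
        using that adm_mean \<epsilon>(2) by (intro lip) (auto simp: adm_def)
      moreover have "\<dots> \<le> L * (N + N)"
        using N[OF s] calculation(1) L(1) by (intro mult_left_mono add_mono) auto
      ultimately show ?thesis by simp
    qed
  qed (use \<epsilon> r L V \<epsilon>V \<epsilon>L in auto)
  show thesis
    by (rule that[OF \<epsilon>(1) _ pos[OF \<phi>(1)] \<phi>(2)]) (use \<phi>(1) in \<open>auto simp: adm_def\<close>)
qed

section \<open>Continuation past a positive density\<close>

text \<open>The equation for \<open>\<eta>\<close> follows from the integral formula, so only the equation for \<open>\<delta>\<close> has to be
  supplied; \<open>D\<close> is the derivative of \<open>\<delta>\<close> up to and including the center.\<close>

lemma strongly_regular_profileI:
  assumes "0 < b" and center: "\<eta> 0 = \<delta> 0"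
    and pos: "\<And>z. 0 \<le> z \<Longrightarrow> z < b \<Longrightarrow> 0 < \<delta> z"
    and der: "\<And>z. 0 \<le> z \<Longrightarrow> z < b \<Longrightarrow> (\<delta> has_real_derivative D z) (at z within {0..})"
    and cont: "continuous_on {0..<b} D" and D0: "D 0 = 0"
    and D: "\<And>z. 0 < z \<Longrightarrow> z < b \<Longrightarrow> D z = slope \<theta> \<beta> \<alpha> z (\<delta> z) (\<eta> z)"
    and \<eta>: "\<And>z. 0 < z \<Longrightarrow> z < b \<Longrightarrow> \<eta> z = ball_mean \<delta> z"
  shows "strongly_regular_profile \<theta> \<beta> \<alpha> \<delta> \<eta> (ereal b)"
proof -
  have within: "at z within {0..<b} = at z within {0..}" if "z \<in> {0..<b}" for z
    using at_within_from_zero_to[of z "ereal b"] that by simp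
  have vd: "vector_derivative \<delta> (at z within {0..<b}) = D z" if "z \<in> {0..<b}" for z
    using der[of z] that within[OF that] at_within_atLeast_neq_bot[of z]
    by (simp add: vector_derivative_real)
  have "\<delta> differentiable (at z within {0..<b})" if "z \<in> {0..<b}" for z
    using der[of z] that within[OF that] has_field_derivative_imp_has_derivative
    unfolding differentiable_def by force
  then have C1: "C1_on {0..<b} \<delta>"
    unfolding C1_on_def differentiable_on_def using continuous_on_eq[OF cont] vd by simp
  have "(D \<longlongrightarrow> D 0) (at 0 within {0..<b})"
    using cont \<open>0 < b\<close> by (auto simp: continuous_on_def)
  then have D_lim: "(D \<longlongrightarrow> 0) (at_right 0)"
    using \<open>0 < b\<close> D0 by (simp add: within at_within_Ici_at_right)
  moreover have "eventually (\<lambda>z. D z = vector_derivative \<delta> (at z within {0..<b})) (at_right 0)"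
    using \<open>0 < b\<close> vd by (auto simp: eventually_at_right_field intro!: exI[of _ b])
  ultimately have lim: "((\<lambda>z. vector_derivative \<delta> (at z within {0..<b})) \<longlongrightarrow> 0) (at_right 0)"
    by (rule Lim_transform_eventually)
  have \<delta>_cont: "continuous_on {0..<b} \<delta>"
    unfolding continuous_on_eq_continuous_within
    using der by (auto simp: within intro!: DERIV_continuous)
  have \<eta>_der: "(\<eta> has_real_derivative - (3 / z) * (\<eta> z - \<delta> z)) (at z)" if z: "0 < z" "z < b" for z
  proof -
    obtain c where c: "z < c" "c < b" using dense z by blast
    have ct: "continuous_on {0..c} (\<lambda>s. \<delta> s * s\<^sup>2)"
      using c by (intro continuous_intros continuous_on_subset[OF \<delta>_cont]) auto
    have "((\<lambda>x. integral {0..x} (\<lambda>s. \<delta> s * s\<^sup>2)) has_real_derivative \<delta> z * z\<^sup>2) (at z within {0..c})"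
      by (rule integral_has_real_derivative[OF ct]) (use z c in auto)
    then have "((\<lambda>x. integral {0..x} (\<lambda>s. \<delta> s * s\<^sup>2)) has_real_derivative \<delta> z * z\<^sup>2) (at z)"
      using z c by (simp add: at_within_Icc_at)
    then have "(ball_mean \<delta> has_real_derivative
        - (9 / z ^ 4) * integral {0..z} (\<lambda>s. \<delta> s * s\<^sup>2) + 3 / z ^ 3 * (\<delta> z * z\<^sup>2)) (at z)"
      unfolding ball_mean_def[abs_def] using z
      by (auto intro!: derivative_eq_intros simp: field_simps eval_nat_numeral)
    also have "- (9 / z ^ 4) * integral {0..z} (\<lambda>s. \<delta> s * s\<^sup>2) + 3 / z ^ 3 * (\<delta> z * z\<^sup>2)
        = - (3 / z) * (ball_mean \<delta> z - \<delta> z)"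
      using z by (simp add: ball_mean_def field_simps eval_nat_numeral)
    finally have "(ball_mean \<delta> has_real_derivative - (3 / z) * (\<eta> z - \<delta> z)) (at z)"
      using \<eta>[OF z] by simp
    then show ?thesis
    proof (rule DERIV_cong_ev[THEN iffD1, rotated -1])
      show "eventually (\<lambda>x. ball_mean \<delta> x = \<eta> x) (nhds z)"
        using eventually_nhds_in_open[of "{0<..<b}" z] z \<eta> by (auto elim: eventually_mono)
    qed auto
  qed
  show ?thesis
    unfolding strongly_regular_profile_def Let_def
    using C1 lim pos center D \<eta> \<eta>_der \<open>0 < b\<close> vd by (auto simp: slope_def ball_mean_def)
qed

context profile
begin

abbreviation "F \<equiv> slope \<theta> \<beta> \<alpha>"

text \<open>The local solution started from the limits of \<open>\<delta>\<close> and \<open>\<eta>\<close> at \<open>Z\<close> is glued to the profile. At the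
  seam both pieces satisfy the same integral equation with continuous integrand, hence the glued
  function is continuously differentiable there.\<close>

lemma extendable:
  assumes b: "b = ereal Z" and lim: "(\<delta> \<longlongrightarrow> d) (at_left Z)" and "0 < d"
  obtains \<delta>' \<eta>' b' where "strongly_regular_profile \<theta> \<beta> \<alpha> \<delta>' \<eta>' b'" "b < b'"
    "\<And>z. z \<in> I \<Longrightarrow> \<delta>' z = \<delta> z \<and> \<eta>' z = \<eta> z"
proof -
  have Z: "0 < Z" using b_pos b by simp
  have I: "I = {0..<Z}" by (simp add: b)
  have d_less: "d < \<delta> z" if "z \<in> {0..<Z}" for z
  proof -
    \<comment> \<open>An intermediate point turns the weak bound from the limit into a strict one.\<close>
    define w where "w = (z + Z) / 2"
    have w: "z < w" "w < Z" using that by (auto simp: w_def)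
    have "d \<le> \<delta> w"
    proof (rule tendsto_upperbound[OF lim])
      show "eventually (\<lambda>x. \<delta> x \<le> \<delta> w) (at_left Z)"
        unfolding eventually_at_left_field
        using w that by (intro exI[of _ w]) (auto intro!: \<delta>_le simp: I)
    qed simp
    also have "\<dots> < \<delta> z" using w that by (intro \<delta>_less) (auto simp: I)
    finally show ?thesis .
  qed
  define \<delta>1 where "\<delta>1 z = (if z < Z then \<delta> z else d)" for z
  have \<delta>1_cont: "continuous_on {0..Z} \<delta>1"
    unfolding continuous_on_eq_continuous_within
  proof
    fix z assume z: "z \<in> {0..Z}"
    show "continuous (at z within {0..Z}) \<delta>1"
    proof (cases "z = Z")
      case True
      have "eventually (\<lambda>x. \<delta> x = \<delta>1 x) (at_left Z)"
        by (simp add: \<delta>1_def eventually_at_filter)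
      then have "(\<delta>1 \<longlongrightarrow> d) (at_left Z)"
        using lim by (rule Lim_transform_eventually[rotated])
      then show ?thesis
        using True Z by (simp add: continuous_within at_within_Icc_at_left \<delta>1_def)
    next
      case False
      then have "continuous (at z within {0..<Z}) \<delta>"
        using \<delta>_cont z by (simp add: I continuous_on_eq_continuous_within)
      then have 1: "(\<delta> \<longlongrightarrow> \<delta> z) (at z within {0..<Z})" by (simp add: continuous_within)
      have 2: "at z within {0..<Z} = at z within {0..Z}"
        using z False by (intro at_within_nhd[of _ "{..<Z}"]) auto
      have 3: "eventually (\<lambda>x. \<delta> x = \<delta>1 x) (at z within {0..Z})"
        using eventually_nhds_in_open[of "{..<Z}" z] z False
        by (auto simp: \<delta>1_def eventually_at_filter elim!: eventually_mono)
      have "(\<delta>1 \<longlongrightarrow> \<delta> z) (at z within {0..Z})"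
        using 1 3 unfolding 2 by (rule Lim_transform_eventually)
      then show ?thesis using False z by (simp add: continuous_within \<delta>1_def)
    qed
  qed
  define e where "e = ball_mean \<delta>1 Z"
  have "d < e"
  proof -
    have "d < \<delta>1 s" if "0 < s" "s < Z" for s
      using d_less[of s] that by (simp add: \<delta>1_def)
    then have "ball_mean (\<lambda>_. d) Z < e"
      unfolding e_def by (rule ball_mean_less[OF Z continuous_on_const \<delta>1_cont])
    then show ?thesis using Z by (simp add: ball_mean_const)
  qed
  then obtain \<epsilon> \<phi> where \<epsilon>: "0 < \<epsilon>" and \<phi>_cont: "continuous_on {Z..Z + \<epsilon>} \<phi>"
    and \<phi>_pos: "\<And>z. z \<in> {Z..Z + \<epsilon>} \<Longrightarrow> 0 < \<phi> z \<and> 0 < continued_mean Z e \<phi> z"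
    and \<phi>_eq: "\<And>z. z \<in> {Z..Z + \<epsilon>} \<Longrightarrow>
      \<phi> z = d + integral {Z..z} (\<lambda>s. F s (\<phi> s) (continued_mean Z e \<phi> s))"
    by (rule local_continuation[OF \<beta>_gt Z \<open>0 < d\<close>, of e \<theta> \<alpha>]) (rule that)
  have \<phi>Z: "\<phi> Z = d" using \<phi>_eq[of Z] \<epsilon> by simp
  define \<delta>' where "\<delta>' z = (if z < Z then \<delta> z else \<phi> z)" for z
  define \<eta>' where "\<eta>' z = (if z = 0 then \<delta> 0 else ball_mean \<delta>' z)" for z
  have \<delta>'_cont: "continuous_on {0..Z + \<epsilon>} \<delta>'"
  proof -
    have "continuous_on ({0..Z} \<union> {Z..Z + \<epsilon>}) (\<lambda>z. if z \<le> Z then \<delta>1 z else \<phi> z)"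
      by (rule continuous_on_If) (use \<delta>1_cont \<phi>_cont \<phi>Z in \<open>auto simp: \<delta>1_def\<close>)
    moreover have "{0..Z} \<union> {Z..Z + \<epsilon>} = {0..Z + \<epsilon>}" using Z \<epsilon> by auto
    moreover have "(\<lambda>z. if z \<le> Z then \<delta>1 z else \<phi> z) = \<delta>'"
      using \<phi>Z by (auto simp: \<delta>'_def \<delta>1_def)
    ultimately show ?thesis by (simp only:)
  qed
  have \<delta>'_cont_Icc: "continuous_on {a..z} \<delta>'" if "0 \<le> a" "z \<le> Z + \<epsilon>" for a z
    by (rule continuous_on_subset[OF \<delta>'_cont]) (use that in auto)
  have left: "\<delta>' z = \<delta> z \<and> \<eta>' z = \<eta> z" if "z \<in> {0..<Z}" for z
  proof -
    have "ball_mean \<delta>' z = ball_mean \<delta> z"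
      unfolding ball_mean_def using that by (auto simp: \<delta>'_def intro!: integral_cong)
    then show ?thesis using that \<eta>_eq[of z] \<eta>_0 by (auto simp: \<delta>'_def \<eta>'_def I)
  qed
  have e_eq: "ball_mean \<delta>' Z = e"
    unfolding e_def ball_mean_def using \<phi>Z by (auto simp: \<delta>'_def \<delta>1_def intro!: integral_cong)
  have right: "\<eta>' z = continued_mean Z e \<phi> z" if z: "z \<in> {Z..Z + \<epsilon>}" for z
  proof -
    have "integral {0..Z} (\<lambda>s. \<delta>' s * s\<^sup>2) + integral {Z..z} (\<lambda>s. \<delta>' s * s\<^sup>2)
        = integral {0..z} (\<lambda>s. \<delta>' s * s\<^sup>2)"
      using z Z by (intro Henstock_Kurzweil_Integration.integral_combine integrable_times_square \<delta>'_cont_Icc) auto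
    moreover have "integral {Z..z} (\<lambda>s. \<delta>' s * s\<^sup>2) = integral {Z..z} (\<lambda>s. \<phi> s * s\<^sup>2)"
      by (rule integral_cong) (auto simp: \<delta>'_def)
    moreover have "3 * integral {0..Z} (\<lambda>s. \<delta>' s * s\<^sup>2) = Z ^ 3 * e"
      using e_eq Z by (simp add: ball_mean_def field_simps)
    ultimately have "3 * integral {0..z} (\<lambda>s. \<delta>' s * s\<^sup>2) = Z ^ 3 * e + 3 * integral {Z..z} (\<lambda>s. \<phi> s * s\<^sup>2)"
      by linarith
    then show ?thesis
      using z Z by (simp add: \<eta>'_def ball_mean_def continued_mean_def)
  qed
  define D where "D z = (if z = 0 then 0 else F z (\<delta>' z) (\<eta>' z))" for z
  have D_left: "D z = d\<delta> z" if "z \<in> {0..<Z}" for z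
    using left[OF that] by (simp add: D_def d\<delta>_def)
  have pos: "0 < \<delta>' z \<and> 0 < \<eta>' z" if "0 \<le> z" "z \<le> Z + \<epsilon>" for z
  proof (cases "z < Z")
    case True
    then show ?thesis using left[of z] that \<delta>_pos[of z] \<eta>_pos[of z] by (simp add: I)
  next
    case False
    then show ?thesis using right[of z] that \<phi>_pos[of z] by (simp add: \<delta>'_def)
  qed
  have \<eta>'_cont: "continuous_on {a..Z + \<epsilon>} \<eta>'" if "0 < a" for a
  proof -
    have "continuous_on {0..Z + \<epsilon>} (\<lambda>z. integral {0..z} (\<lambda>s. \<delta>' s * s\<^sup>2))"
      by (intro indefinite_integral_continuous_1 integrable_times_square \<delta>'_cont)
    then have "continuous_on {a..Z + \<epsilon>} (ball_mean \<delta>')"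
      unfolding ball_mean_def[abs_def] using that
      by (intro continuous_intros) (auto elim: continuous_on_subset)
    then show ?thesis
      by (rule continuous_on_eq) (use that in \<open>auto simp: \<eta>'_def\<close>)
  qed
  have D_cont: "continuous_on {a..Z + \<epsilon>} D" if "0 < a" for a
  proof -
    have "continuous_on {a..Z + \<epsilon>} (\<lambda>z. F z (\<delta>' z) (\<eta>' z))"
      using that pos by (intro continuous_on_slope \<eta>'_cont \<delta>'_cont_Icc \<beta>_gt) auto
    then show ?thesis
      by (rule continuous_on_eq) (use that in \<open>auto simp: D_def\<close>)
  qed
  have der_pos: "(\<delta>' has_real_derivative D z) (at z)" if z: "0 < z" "z < Z + \<epsilon>" for z
  proof -
    define a where "a = min z Z / 2"
    have a: "0 < a" "a < z" "a < Z" using z Z by (auto simp: a_def)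
    have ftc: "\<delta>' x = \<delta>' a + integral {a..x} D" if x: "x \<in> {a..Z + \<epsilon>}" for x
    proof -
      have "(D has_integral (\<delta>' x - \<delta>' a)) {a..x}"
      proof (rule fundamental_theorem_of_calculus_interior_strong[of "{Z}"])
        fix y assume "y \<in> {a<..<x} - {Z}"
        then have y: "a < y" "y < x" "y \<noteq> Z" by auto
        have "(\<delta>' has_real_derivative D y) (at y)"
        proof (cases "y < Z")
          case True
          have "(\<delta> has_real_derivative D y) (at y)"
            using \<delta>_deriv_interior[of y] D_left[of y] True y a by (simp add: I)
          then show ?thesis
          proof (rule DERIV_cong_ev[THEN iffD1, rotated -1])
            show "eventually (\<lambda>x. \<delta> x = \<delta>' x) (nhds y)"
              using eventually_nhds_in_open[of "{..<Z}" y] True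
              by (auto simp: \<delta>'_def elim: eventually_mono)
          qed auto
        next
          case False
          let ?g = "\<lambda>s. F s (\<phi> s) (continued_mean Z e \<phi> s)"
          have "continuous_on {Z..Z + \<epsilon>} D" using D_cont[OF Z] .
          then have "continuous_on {Z..Z + \<epsilon>} ?g"
            by (rule continuous_on_eq) (use Z right in \<open>auto simp: D_def \<delta>'_def\<close>)
          then have "((\<lambda>x. integral {Z..x} ?g) has_real_derivative ?g y) (at y within {Z..Z + \<epsilon>})"
            by (rule integral_has_real_derivative) (use False y x in auto)
          then have "((\<lambda>x. d + integral {Z..x} ?g) has_real_derivative ?g y) (at y)"
            using False y x by (auto simp: at_within_Icc_at intro!: derivative_eq_intros)
          moreover have "?g y = D y"
            using right[of y] False y x Z by (simp add: D_def \<delta>'_def)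
          ultimately have "((\<lambda>x. d + integral {Z..x} ?g) has_real_derivative D y) (at y)" by simp
          then show ?thesis
          proof (rule DERIV_cong_ev[THEN iffD1, rotated -1])
            have "d + integral {Z..s} ?g = \<delta>' s" if "s \<in> {Z<..<Z + \<epsilon>}" for s
              using \<phi>_eq[of s] that by (simp add: \<delta>'_def)
            then show "eventually (\<lambda>s. d + integral {Z..s} ?g = \<delta>' s) (nhds y)"
              using eventually_nhds_in_open[of "{Z<..<Z + \<epsilon>}" y] False y x
              by (auto elim!: eventually_mono)
          qed auto
        qed
        then show "(\<delta>' has_vector_derivative D y) (at y)"
          by (simp add: has_real_derivative_iff_has_vector_derivative)
      qed (use x a in \<open>auto intro!: \<delta>'_cont_Icc\<close>)
      from integral_unique[OF this] show ?thesis by simp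
    qed
    have "((\<lambda>x. integral {a..x} D) has_real_derivative D z) (at z within {a..Z + \<epsilon>})"
      using a z by (intro integral_has_real_derivative D_cont) auto
    then have "((\<lambda>x. \<delta>' a + integral {a..x} D) has_real_derivative D z) (at z)"
      using a z by (auto simp: at_within_Icc_at intro!: derivative_eq_intros)
    then show ?thesis
    proof (rule DERIV_cong_ev[THEN iffD1, rotated -1])
      have eq: "\<delta>' a + integral {a..x} D = \<delta>' x" if "x \<in> {a<..<Z + \<epsilon>}" for x
        using ftc[of x] that by simp
      have "eventually (\<lambda>x. x \<in> {a<..<Z + \<epsilon>}) (nhds z)"
        using a z by (intro eventually_nhds_in_open) auto
      then show "eventually (\<lambda>x. \<delta>' a + integral {a..x} D = \<delta>' x) (nhds z)"
        by (rule eventually_mono) (rule eq)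
    qed auto
  qed
  have "strongly_regular_profile \<theta> \<beta> \<alpha> \<delta>' \<eta>' (ereal (Z + \<epsilon>))"
  proof (rule strongly_regular_profileI)
    show "0 < Z + \<epsilon>" using Z \<epsilon> by simp
    show "\<eta>' 0 = \<delta>' 0" using Z by (simp add: \<eta>'_def \<delta>'_def)
    show "0 < \<delta>' z" if "0 \<le> z" "z < Z + \<epsilon>" for z using pos that by simp
    show "D 0 = 0" by (simp add: D_def)
    show "D z = F z (\<delta>' z) (\<eta>' z)" "\<eta>' z = ball_mean \<delta>' z" if "0 < z" "z < Z + \<epsilon>" for z
      using that by (auto simp: D_def \<eta>'_def)
    show "(\<delta>' has_real_derivative D z) (at z within {0..})" if "0 \<le> z" "z < Z + \<epsilon>" for z
    proof (cases "z = 0")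
      case True
      have "(\<delta>' has_real_derivative D 0) (at 0 within {0..})"
      proof (rule has_field_derivative_transform_within[where d = Z])
        show "(\<delta> has_real_derivative D 0) (at 0 within {0..})"
          using \<delta>_deriv[OF zero_mem] D_left[of 0] Z by simp
        show "\<delta> x = \<delta>' x" if "dist x 0 < Z" for x
          using that by (simp add: \<delta>'_def dist_real_def abs_less_iff)
      qed (use Z in auto)
      then show ?thesis using True by simp
    next
      case False
      then have "(\<delta>' has_real_derivative D z) (at z)" using that by (intro der_pos) auto
      then show ?thesis by (rule has_field_derivative_at_within)
    qed
    show "continuous_on {0..<Z + \<epsilon>} D"
      unfolding continuous_on_eq_continuous_within
    proof
      fix z assume z: "z \<in> {0..<Z + \<epsilon>}"
      show "continuous (at z within {0..<Z + \<epsilon>}) D"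
      proof (cases "z < Z")
        case True
        have "continuous (at z within {0..<Z}) d\<delta>"
          using d\<delta>_cont True z by (simp add: I continuous_on_eq_continuous_within)
        moreover have "at z within {0..<Z} = at z within {0..<Z + \<epsilon>}"
          using z True \<epsilon> by (intro at_within_nhd[of _ "{..<Z}"]) auto
        ultimately have "continuous (at z within {0..<Z + \<epsilon>}) d\<delta>" by simp
        then show ?thesis
          by (rule continuous_transform_within[where \<delta> = "Z - z"])
            (use z True D_left in \<open>auto simp: dist_real_def\<close>)
      next
        case False
        have "isCont D z"
          using D_cont[of "Z / 2"] False z Z
          by (intro continuous_on_interior[of "{Z/2..Z + \<epsilon>}"]) auto
        then show ?thesis by (rule continuous_at_imp_continuous_at_within)
      qed
    qed
  qed
  then show thesis
    by (rule that) (use \<epsilon> b left I in auto)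
qed

end

section \<open>The maximal profile ends at vacuum\<close>

context profile
begin

text \<open>In the upper bound for the slope, \<open>\<eta> powr (\<beta> - 4/3)\<close> is at least its value at the center, since the
  exponent is nonpositive, and \<open>\<eta> + \<alpha>\<close> is at least \<open>\<alpha>\<close>. So the derivative of
  \<open>\<delta> powr (\<beta> - 1)\<close> is below a fixed negative multiple of \<open>z\<close>, and \<open>\<delta>\<close> would have to vanish at a finite
  radius. Here \<open>\<alpha> > 0\<close> enters.\<close>

lemma finite_extent: "b \<noteq> \<infinity>"
proof
  assume "b = \<infinity>"
  then have I: "I = {0..}" by simp
  \<comment> \<open>The decay rate, and the radius where \<open>\<delta> 0 powr (\<beta> - 1) - k * z\<^sup>2\<close> has already dropped to \<open>-1\<close>.\<close>
  define k where "k = (\<beta> - 1) * \<theta> * (\<delta> 0 powr (\<beta> - 4/3) * \<alpha>) / 2"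
  have \<delta>0: "0 < \<delta> 0" by (rule \<delta>_pos[OF zero_mem])
  have k: "0 < k" using \<delta>0 \<beta>_gt \<theta>_pos \<alpha>_pos by (simp add: k_def)
  define z where "z = sqrt ((\<delta> 0 powr (\<beta> - 1) + 1) / k)"
  have "0 < (\<delta> 0 powr (\<beta> - 1) + 1) / k" using k by (intro divide_pos_pos add_nonneg_pos) auto
  then have z: "0 < z" "k * z\<^sup>2 = \<delta> 0 powr (\<beta> - 1) + 1" using k by (auto simp: z_def)
  have "\<delta> z powr (\<beta> - 1) + k * z\<^sup>2 \<le> \<delta> 0 powr (\<beta> - 1) + k * 0\<^sup>2"
  proof (rule DERIV_nonpos_imp_decreasing_open[where f = "\<lambda>z. \<delta> z powr (\<beta> - 1) + k * z\<^sup>2"])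
    show "0 \<le> z" using z by simp
    fix x assume x: "0 < x" "x < z"
    have xI: "x \<in> I" using x by (simp add: I)
    have pos: "0 < \<delta> x" "0 < \<eta> x" "\<eta> x \<le> \<delta> 0" using \<delta>_pos \<eta>_pos \<eta>_le_center xI by auto
    let ?D = "(\<beta> - 1) * \<delta> x powr (\<beta> - 2) * d\<delta> x + 2 * k * x"
    have "((\<lambda>z. \<delta> z powr (\<beta> - 1) + k * z\<^sup>2) has_real_derivative ?D) (at x)"
      using pos by (auto intro!: derivative_eq_intros \<delta>_deriv_interior xI x simp: field_simps)
    moreover have "?D \<le> 0"
    proof -
      have "\<delta> x powr (\<beta> - 2) * d\<delta> x
          \<le> \<delta> x powr (\<beta> - 2) * (- \<theta> * x * \<eta> x powr (\<beta> - 4/3) * \<delta> x powr (2 - \<beta>) * (\<eta> x + \<alpha>))"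
        by (intro mult_left_mono d\<delta>_upper xI x) simp
      also have "\<dots> = - \<theta> * x * (\<eta> x powr (\<beta> - 4/3) * (\<eta> x + \<alpha>)) * (\<delta> x powr (\<beta> - 2) * \<delta> x powr (2 - \<beta>))"
        by (simp add: mult_ac)
      also have "\<delta> x powr (\<beta> - 2) * \<delta> x powr (2 - \<beta>) = 1"
        using pos by (simp flip: powr_add)
      also have "- \<theta> * x * (\<eta> x powr (\<beta> - 4/3) * (\<eta> x + \<alpha>)) * 1
          \<le> - \<theta> * x * (\<delta> 0 powr (\<beta> - 4/3) * \<alpha>)"
      proof -
        have "\<delta> 0 powr (\<beta> - 4/3) \<le> \<eta> x powr (\<beta> - 4/3)"
          using pos \<beta>_le by (intro powr_mono2') auto
        then have "\<delta> 0 powr (\<beta> - 4/3) * \<alpha> \<le> \<eta> x powr (\<beta> - 4/3) * (\<eta> x + \<alpha>)"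
          using pos \<alpha>_pos by (intro mult_mono) auto
        then have "\<theta> * x * (\<delta> 0 powr (\<beta> - 4/3) * \<alpha>) \<le> \<theta> * x * (\<eta> x powr (\<beta> - 4/3) * (\<eta> x + \<alpha>))"
          using \<theta>_pos x by (intro mult_left_mono) auto
        then show ?thesis by simp
      qed
      finally have "(\<beta> - 1) * (\<delta> x powr (\<beta> - 2) * d\<delta> x) \<le> (\<beta> - 1) * (- \<theta> * x * (\<delta> 0 powr (\<beta> - 4/3) * \<alpha>))"
        using \<beta>_gt by (intro mult_left_mono) auto
      also have "\<dots> = - (2 * k * x)" by (simp add: k_def)
      finally show ?thesis by (simp add: mult.assoc)
    qed
    ultimately show "\<exists>y. ((\<lambda>z. \<delta> z powr (\<beta> - 1) + k * z\<^sup>2) has_real_derivative y) (at x) \<and> y \<le> 0"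
      by blast
  next
    have "\<delta> x \<noteq> 0" if "x \<in> {0..z}" for x using \<delta>_pos[of x] that by (simp add: I)
    moreover have "continuous_on {0..z} \<delta>" using z by (intro \<delta>_cont_Icc) (simp add: I)
    ultimately show "continuous_on {0..z} (\<lambda>z. \<delta> z powr (\<beta> - 1) + k * z\<^sup>2)"
      by (intro continuous_intros) auto
  qed
  then show False using z powr_ge_zero[of "\<delta> z" "\<beta> - 1"] by simp
qed

lemma \<delta>_limit:
  assumes "b = ereal Z"
  obtains d where "0 \<le> d" "(\<delta> \<longlongrightarrow> d) (at_left Z)"
proof -
  have Z: "0 < Z" using b_pos assms by simp
  have I: "I = {0..<Z}" by (simp add: assms)
  define d where "d = Inf (\<delta> ` {0..<Z})"
  have bdd: "bdd_below (\<delta> ` {0..<Z})"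
    using \<delta>_pos by (intro bdd_belowI[of _ 0]) (force simp: I)
  have lower: "d \<le> \<delta> z" if "0 \<le> z" "z < Z" for z
    unfolding d_def using that by (intro cInf_lower bdd) auto
  have "(\<delta> \<longlongrightarrow> d) (at_left Z)"
  proof (rule decreasing_tendsto)
    show "eventually (\<lambda>x. d \<le> \<delta> x) (at_left Z)"
      using Z lower by (auto simp: eventually_at_left_field)
    fix u assume u: "d < u"
    have "\<delta> ` {0..<Z} \<noteq> {}" using Z by simp
    then obtain z where z: "z \<in> {0..<Z}" "\<delta> z < u"
      using u cInf_lessD[of "\<delta> ` {0..<Z}" u] unfolding d_def by blast
    have "\<delta> x < u" if "z < x" "x < Z" for x
      using \<delta>_less[of x z] that z by (simp add: I)
    then show "eventually (\<lambda>x. \<delta> x < u) (at_left Z)"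
      using z by (auto simp: eventually_at_left_field)
  qed
  moreover have "0 \<le> d"
    unfolding d_def using Z \<delta>_pos by (intro cInf_greatest) (force simp: I)+
  ultimately show thesis using that by blast
qed

text \<open>The mass inside radius \<open>z\<close> increases with \<open>z\<close>; this keeps \<open>\<eta>\<close> away from \<open>0\<close> when \<open>\<delta>\<close> vanishes.\<close>

lemma volume_mean_mono:
  assumes "z \<in> I" "0 < x" "x \<le> z"
  shows "x ^ 3 * \<eta> x \<le> z ^ 3 * \<eta> z"
proof -
  have xI: "x \<in> I" using mem_mono[OF assms(1)] assms by simp
  have "integral {0..x} (\<lambda>s. \<delta> s * s\<^sup>2) \<le> integral {0..z} (\<lambda>s. \<delta> s * s\<^sup>2)"
  proof (rule integral_subset_le)
    have "0 \<le> \<delta> s * s\<^sup>2" if "s \<in> {0..z}" for s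
      using \<delta>_pos[OF mem_mono[OF assms(1), of s]] that by simp
    then show "\<forall>s \<in> {0..z}. 0 \<le> \<delta> s * s\<^sup>2" by blast
  qed (use assms xI in \<open>auto intro!: integrable_times_square \<delta>_cont_Icc\<close>)
  then show ?thesis
    using \<eta>_eq[OF xI] \<eta>_eq[OF assms(1)] assms by (simp add: ball_mean_def)
qed

lemma ratio_tends_to_0:
  assumes b: "b = ereal Z" and lim: "(\<delta> \<longlongrightarrow> 0) (at_left Z)"
  shows "filterlim (\<lambda>z. \<delta> z / \<eta> z) (at_right 0) (at_left Z)"
proof -
  have Z: "0 < Z" using b_pos b by simp
  have I: "I = {0..<Z}" by (simp add: b)
  define h where "h = Z / 2"
  \<comment> \<open>A lower bound for \<open>\<eta>\<close> on \<open>(h, Z)\<close>, from the mass inside radius \<open>h\<close>.\<close>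
  define e where "e = (h / Z) ^ 3 * \<eta> h"
  have h: "0 < h" "h < Z" "h \<in> I" using Z by (auto simp: h_def I)
  have e: "0 < e" using h Z \<eta>_pos[of h] by (simp add: e_def)
  have bound: "\<delta> z / \<eta> z \<le> \<delta> z / e" if "h < z" "z < Z" for z
  proof -
    have zI: "z \<in> I" using that h by (simp add: I)
    have "h ^ 3 * \<eta> h \<le> z ^ 3 * \<eta> z"
      using that h by (intro volume_mean_mono zI) auto
    also have "\<dots> \<le> Z ^ 3 * \<eta> z"
      using that h \<eta>_pos[OF zI] by (intro mult_right_mono power_mono) auto
    finally have "e \<le> \<eta> z" using Z by (simp add: e_def power_divide field_simps)
    then show ?thesis
      using e \<eta>_pos[OF zI] \<delta>_pos[OF zI] by (intro divide_left_mono) auto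
  qed
  have near: "eventually (\<lambda>z. h < z \<and> z < Z) (at_left Z)"
    using h by (auto simp: eventually_at_left_field)
  have "((\<lambda>z. \<delta> z / \<eta> z) \<longlongrightarrow> 0) (at_left Z)"
  proof (rule tendsto_sandwich)
    show "eventually (\<lambda>z. 0 \<le> \<delta> z / \<eta> z) (at_left Z)"
      using near by eventually_elim (use h \<delta>_pos \<eta>_pos in \<open>simp add: I less_imp_le\<close>)
    show "eventually (\<lambda>z. \<delta> z / \<eta> z \<le> \<delta> z / e) (at_left Z)"
      using near by eventually_elim (use bound in blast)
    show "((\<lambda>z. \<delta> z / e) \<longlongrightarrow> 0) (at_left Z)"
      using tendsto_divide[OF lim tendsto_const, of e] e by simp
  qed simp
  moreover have "eventually (\<lambda>z. 0 < \<delta> z / \<eta> z) (at_left Z)"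
    using near by eventually_elim (use h \<delta>_pos \<eta>_pos in \<open>simp add: I\<close>)
  ultimately show ?thesis
    unfolding filterlim_at by (auto elim!: eventually_mono)
qed

lemma ratio_bounds:
  assumes "z \<in> I" shows "0 < \<delta> z / \<eta> z" "0 < z \<Longrightarrow> \<delta> z / \<eta> z < 1"
  using assms \<delta>_pos \<eta>_pos \<delta>_less_\<eta> by auto

lemma ratio_center: "\<delta> 0 / \<eta> 0 = 1"
  using \<eta>_0 \<delta>_pos[OF zero_mem] by simp

lemma ratio_cont: "continuous_on I (\<lambda>z. \<delta> z / \<eta> z)"
  using \<eta>_pos by (intro continuous_intros \<delta>_cont \<eta>_cont) force

text \<open>The ratio runs continuously from \<open>1\<close> to \<open>0\<close>. The level set inside a compact interval has a least
  element, and before it the ratio cannot have dropped below the level without crossing it.\<close>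

lemma first_ratio_crossing:
  assumes "b = ereal Z" and lim: "filterlim (\<lambda>z. \<delta> z / \<eta> z) (at_right 0) (at_left Z)"
    and y: "0 < y" "y < 1"
  obtains x where "0 < x" "x < Z" "\<delta> x / \<eta> x = y"
    "\<And>z. 0 \<le> z \<Longrightarrow> z < x \<Longrightarrow> y < \<delta> z / \<eta> z"
proof -
  have Z: "0 < Z" using b_pos assms(1) by simp
  have I: "I = {0..<Z}" by (simp add: assms(1))
  let ?y = "\<lambda>z. \<delta> z / \<eta> z"
  have "(?y \<longlongrightarrow> 0) (at_left Z)" using lim by (simp add: filterlim_at)
  then have "eventually (\<lambda>z. ?y z < y) (at_left Z)" using y(1) by (rule order_tendstoD)
  then obtain c where c: "c < Z" "\<And>z. c < z \<Longrightarrow> z < Z \<Longrightarrow> ?y z < y"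
    unfolding eventually_at_left_field by blast
  define w where "w = (max c 0 + Z) / 2"
  have w: "0 < w" "w < Z" "c < w" using c(1) Z by (auto simp: w_def)
  have yw: "?y w < y" using c(2) w by simp
  have cont: "continuous_on {a..x} ?y" if "0 \<le> a" "x < Z" for a x
    by (rule continuous_on_subset[OF ratio_cont]) (use that in \<open>auto simp: I\<close>)
  let ?S = "{z \<in> {0..w}. ?y z = y}"
  have ivt: "\<exists>z. 0 \<le> z \<and> z \<le> x \<and> ?y z = y" if "0 \<le> x" "x < Z" "?y x \<le> y" for x
    using IVT2'[of ?y x y 0] cont[of 0 x] that y(2) ratio_center by auto
  have S_ne: "?S \<noteq> {}" using ivt[of w] w yw by auto
  have "compact ?S"
  proof -
    have "closed ?S"
      using continuous_closed_preimage_constant[OF cont[of 0 w] closed_atLeastAtMost] w by simp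
    moreover have "bounded ?S" by (rule bounded_subset[of "{0..w}"]) auto
    ultimately show ?thesis by (simp add: compact_eq_bounded_closed)
  qed
  then obtain x where x: "x \<in> ?S" "\<And>z. z \<in> ?S \<Longrightarrow> x \<le> z"
    using compact_attains_inf[OF _ S_ne] by blast
  have "x \<noteq> 0" using x(1) y(2) ratio_center by force
  show thesis
  proof (rule that[of x])
    show "0 < x" "x < Z" "?y x = y" using x(1) \<open>x \<noteq> 0\<close> w by auto
    show "y < ?y z" if z: "0 \<le> z" "z < x" for z
    proof (rule ccontr)
      assume "\<not> y < ?y z"
      then obtain z' where "0 \<le> z'" "z' \<le> z" "?y z' = y"
        using ivt[of z] z x(1) w by auto
      then show False using x(2)[of z'] z x(1) by auto
    qed
  qed
qed

end

text \<open>A positive limit density at the end would allow a proper extension, so the density tends to \<open>0\<close>.\<close>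

lemma maximal_profile_ends_at_vacuum:
  assumes "profile \<theta> \<beta> \<alpha> \<delta> \<eta> Zmax"
    and max: "maximal_strongly_regular_profile \<theta> \<beta> \<alpha> \<delta> \<eta> Zmax"
  obtains Z where "Zmax = ereal Z" "filterlim (\<lambda>z. \<delta> z / \<eta> z) (at_right 0) (at_left Z)"
proof -
  interpret profile \<theta> \<beta> \<alpha> \<delta> \<eta> Zmax by fact
  obtain Z where Z: "Zmax = ereal Z"
    using finite_extent b_pos by (cases Zmax) auto
  obtain d where d: "0 \<le> d" "(\<delta> \<longlongrightarrow> d) (at_left Z)"
    by (rule \<delta>_limit[OF Z])
  have "d = 0"
  proof (rule ccontr)
    assume "d \<noteq> 0"
    then have "0 < d" using d by simp
    then obtain \<delta>' \<eta>' b' where "strongly_regular_profile \<theta> \<beta> \<alpha> \<delta>' \<eta>' b'" "Zmax < b'"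
      "\<And>z. z \<in> from_zero_to Zmax \<Longrightarrow> \<delta>' z = \<delta> z \<and> \<eta>' z = \<eta> z"
      using extendable[OF Z d(2)] by metis
    then have "b' \<le> Zmax" using max unfolding maximal_strongly_regular_profile_def by blast
    then show False using \<open>Zmax < b'\<close> by simp
  qed
  then show thesis using that Z ratio_tends_to_0[OF Z] d by simp
qed

section \<open>The scale factor\<close>

text \<open>The initial value problem \<open>\<omega>\<^sup>2 \<omega>'' = k\<close>, \<open>\<omega> 0 = 1\<close>, \<open>\<omega>' 0 = 0\<close> with \<open>k > 0\<close>. Solutions accelerate
  outwards, so \<open>\<omega> \<ge> 1\<close> and the equation stays uniformly Lipschitz.\<close>

locale scale =
  fixes k :: real and \<omega> :: "real \<Rightarrow> real" and b :: ereal
  assumes k_pos: "0 < k" and b_pos: "0 < b" and \<omega>_0: "\<omega> 0 = 1"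
    and velocity_0: "vector_derivative \<omega> (at 0 within from_zero_to b) = 0"
    and \<omega>_diff: "\<omega> differentiable_on from_zero_to b"
    and velocity_diff:
      "(\<lambda>t. vector_derivative \<omega> (at t within from_zero_to b)) differentiable_on from_zero_to b"
    and acceleration: "\<And>t. t \<in> from_zero_to b \<Longrightarrow> (\<omega> t)\<^sup>2 *
      vector_derivative (\<lambda>t. vector_derivative \<omega> (at t within from_zero_to b)) (at t within from_zero_to b) = k"
begin

abbreviation "J \<equiv> from_zero_to b"

definition d\<omega> :: "real \<Rightarrow> real" where
  "d\<omega> t = vector_derivative \<omega> (at t within J)"

lemma zero_mem: "0 \<in> J"
  using b_pos by (simp add: from_zero_to_iff flip: zero_ereal_def)

lemma d\<omega>_0: "d\<omega> 0 = 0"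
  using velocity_0 by (simp add: d\<omega>_def)

lemma \<omega>_deriv: "t \<in> J \<Longrightarrow> (\<omega> has_real_derivative d\<omega> t) (at t within {0..})"
  using \<omega>_diff unfolding differentiable_on_def d\<omega>_def vector_derivative_works
  by (auto simp: has_real_derivative_iff_has_vector_derivative at_within_from_zero_to)

lemma \<omega>_nonzero: "t \<in> J \<Longrightarrow> \<omega> t \<noteq> 0"
  using acceleration[of t] k_pos by auto

lemma d\<omega>_deriv: "t \<in> J \<Longrightarrow> (d\<omega> has_real_derivative k / (\<omega> t)\<^sup>2) (at t within {0..})"
proof -
  assume t: "t \<in> J"
  have "vector_derivative d\<omega> (at t within J) = k / (\<omega> t)\<^sup>2"
    using acceleration[OF t] \<omega>_nonzero[OF t] by (simp add: d\<omega>_def[abs_def] field_simps)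
  moreover have "(d\<omega> has_vector_derivative vector_derivative d\<omega> (at t within J)) (at t within J)"
    using velocity_diff t unfolding differentiable_on_def vector_derivative_works d\<omega>_def[abs_def] by blast
  ultimately show ?thesis
    using t by (simp add: has_real_derivative_iff_has_vector_derivative at_within_from_zero_to)
qed

lemma \<omega>_cont: "continuous_on J \<omega>" and d\<omega>_cont: "continuous_on J d\<omega>"
  unfolding continuous_on_eq_continuous_within
  using \<omega>_deriv d\<omega>_deriv by (auto simp: at_within_from_zero_to intro: DERIV_continuous)

lemma cont_Icc:
  assumes "t \<in> J"
  shows "continuous_on {0..t} \<omega>" "continuous_on {0..t} d\<omega>"
proof -
  have "{0..t} \<subseteq> J" using from_zero_to_mono[OF assms] by auto
  then show "continuous_on {0..t} \<omega>" "continuous_on {0..t} d\<omega>"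
    using \<omega>_cont d\<omega>_cont continuous_on_subset by blast+
qed

lemma deriv_interior:
  assumes "t \<in> J" "0 < t"
  shows "(\<omega> has_real_derivative d\<omega> t) (at t)" "(d\<omega> has_real_derivative k / (\<omega> t)\<^sup>2) (at t)"
  using \<omega>_deriv[OF assms(1)] d\<omega>_deriv[OF assms(1)] assms(2)
  by (simp_all add: at_within_Ici_interior)

lemma d\<omega>_nonneg: assumes "t \<in> J" shows "0 \<le> d\<omega> t"
proof -
  have "0 \<le> t" using assms by (simp add: from_zero_to_iff)
  have "d\<omega> 0 \<le> d\<omega> t"
  proof (rule DERIV_nonneg_imp_increasing_open[OF \<open>0 \<le> t\<close> _ cont_Icc(2)[OF assms]])
    fix s assume "0 < s" "s < t"
    then have "(d\<omega> has_real_derivative k / (\<omega> s)\<^sup>2) (at s)"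
      by (intro deriv_interior from_zero_to_mono[OF assms]) auto
    then show "\<exists>y. (d\<omega> has_real_derivative y) (at s) \<and> 0 \<le> y"
      using k_pos by (intro exI[of _ "k / (\<omega> s)\<^sup>2"]) simp
  qed
  then show ?thesis by (simp add: d\<omega>_0)
qed

lemma \<omega>_ge_1: assumes "t \<in> J" shows "1 \<le> \<omega> t"
proof -
  have "0 \<le> t" using assms by (simp add: from_zero_to_iff)
  have "\<omega> 0 \<le> \<omega> t"
  proof (rule DERIV_nonneg_imp_increasing_open[OF \<open>0 \<le> t\<close> _ cont_Icc(1)[OF assms]])
    fix s assume "0 < s" "s < t"
    then have s: "s \<in> J" "0 < s" using from_zero_to_mono[OF assms, of s] by auto
    then show "\<exists>y. (\<omega> has_real_derivative y) (at s) \<and> 0 \<le> y"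
      using deriv_interior(1)[OF s] d\<omega>_nonneg[OF s(1)] by blast
  qed
  then show ?thesis by (simp add: \<omega>_0)
qed

end

lemma scale_of_scale_factor:
  assumes "scale_factor G K \<alpha> \<omega> b" "0 < G" "0 < K" "0 < \<alpha>"
  shows "scale (4 * pi * G / 3 * K * \<alpha>) \<omega> b"
  using assms unfolding scale_factor_def Let_def scale_def by simp

lemma inverse_square_lipschitz:
  fixes x y :: real
  assumes "1 \<le> x" "1 \<le> y"
  shows "\<bar>1 / x\<^sup>2 - 1 / y\<^sup>2\<bar> \<le> 2 * \<bar>x - y\<bar>"
proof -
  have "1 / x\<^sup>2 - 1 / y\<^sup>2 = (y - x) * (1 / (x * y\<^sup>2) + 1 / (x\<^sup>2 * y))"
    using assms by (simp add: field_simps power2_eq_square)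
  moreover have "1 / (x * y\<^sup>2) \<le> 1" "1 / (x\<^sup>2 * y) \<le> 1"
  proof -
    have "1 * 1 \<le> x * y\<^sup>2" "1 * 1 \<le> x\<^sup>2 * y"
      using assms by (intro mult_mono; simp)+
    then show "1 / (x * y\<^sup>2) \<le> 1" "1 / (x\<^sup>2 * y) \<le> 1" by auto
  qed
  moreover have "0 \<le> 1 / (x * y\<^sup>2) + 1 / (x\<^sup>2 * y)" using assms by simp
  ultimately have "\<bar>1 / x\<^sup>2 - 1 / y\<^sup>2\<bar> \<le> \<bar>y - x\<bar> * 2"
    by (simp only: abs_mult) (intro mult_left_mono; simp)
  then show ?thesis by (simp add: abs_minus_commute mult.commute)
qed

text \<open>The squared distance of two solutions in phase space grows at most exponentially, with rate
  \<open>1 + 2 * k\<close>, and starts from \<open>0\<close>.\<close>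

lemma scale_unique:
  assumes s1: "scale k \<omega> b" and s2: "scale k \<omega>' b'"
    and t: "t \<in> from_zero_to b" "t \<in> from_zero_to b'"
  shows "\<omega> t = \<omega>' t"
proof -
  interpret p: scale k \<omega> b by fact
  interpret q: scale k \<omega>' b' by fact
  have t0: "0 \<le> t" using t(1) by (simp add: from_zero_to_iff)
  define c where "c = 1 + 2 * k"
  define E where "E s = exp (- c * s) * ((p.d\<omega> s - q.d\<omega> s)\<^sup>2 + (\<omega> s - \<omega>' s)\<^sup>2)" for s
  have "E t \<le> E 0"
  proof (rule DERIV_nonpos_imp_decreasing_open[OF t0])
    fix s assume s: "0 < s" "s < t"
    then have sI: "s \<in> from_zero_to b" "s \<in> from_zero_to b'"
      using from_zero_to_mono[OF t(1), of s] from_zero_to_mono[OF t(2), of s] by auto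
    let ?v = "p.d\<omega> s - q.d\<omega> s" and ?x = "\<omega> s - \<omega>' s" and ?a = "k / (\<omega> s)\<^sup>2 - k / (\<omega>' s)\<^sup>2"
    let ?D = "exp (- c * s) * (2 * ?v * ?a + 2 * ?x * ?v) - c * exp (- c * s) * (?v\<^sup>2 + ?x\<^sup>2)"
    have "(E has_real_derivative ?D) (at s)"
      unfolding E_def using s(1) sI
      by (auto intro!: derivative_eq_intros p.deriv_interior q.deriv_interior simp: algebra_simps)
    moreover have "?D \<le> 0"
    proof -
      have "?a = k * (1 / (\<omega> s)\<^sup>2 - 1 / (\<omega>' s)\<^sup>2)"
        by (simp add: right_diff_distrib)
      then have "\<bar>?a\<bar> = k * \<bar>1 / (\<omega> s)\<^sup>2 - 1 / (\<omega>' s)\<^sup>2\<bar>"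
        using p.k_pos by (simp add: abs_mult)
      also have "\<dots> \<le> k * (2 * \<bar>?x\<bar>)"
        using p.k_pos p.\<omega>_ge_1 q.\<omega>_ge_1 sI by (intro mult_left_mono inverse_square_lipschitz) auto
      finally have a: "\<bar>?a\<bar> \<le> 2 * k * \<bar>?x\<bar>" by simp
      have "2 * ?v * ?a + 2 * ?x * ?v \<le> \<bar>2 * ?v * ?a\<bar> + \<bar>2 * ?x * ?v\<bar>" by linarith
      also have "\<dots> = 2 * \<bar>?v\<bar> * \<bar>?a\<bar> + 2 * \<bar>?x\<bar> * \<bar>?v\<bar>"
        by (simp only: abs_mult abs_numeral)
      also have "\<dots> \<le> 2 * \<bar>?v\<bar> * (2 * k * \<bar>?x\<bar>) + 2 * \<bar>?x\<bar> * \<bar>?v\<bar>"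
        using a by (intro add_mono mult_left_mono) auto
      also have "\<dots> = c * (2 * \<bar>?v\<bar> * \<bar>?x\<bar>)" by (simp add: c_def algebra_simps)
      also have "\<dots> \<le> c * (\<bar>?v\<bar>\<^sup>2 + \<bar>?x\<bar>\<^sup>2)"
        using p.k_pos by (intro mult_left_mono sum_squares_bound) (simp add: c_def)
      finally have "2 * ?v * ?a + 2 * ?x * ?v \<le> c * (?v\<^sup>2 + ?x\<^sup>2)" by simp
      then have "exp (- c * s) * (2 * ?v * ?a + 2 * ?x * ?v) \<le> exp (- c * s) * (c * (?v\<^sup>2 + ?x\<^sup>2))"
        by (rule mult_left_mono) simp
      then show ?thesis by (simp add: mult_ac)
    qed
    ultimately show "\<exists>y. (E has_real_derivative y) (at s) \<and> y \<le> 0" by blast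
  next
    show "continuous_on {0..t} E"
      unfolding E_def by (intro continuous_intros p.cont_Icc q.cont_Icc t)
  qed
  moreover have "E 0 = 0" by (simp add: E_def p.\<omega>_0 q.\<omega>_0 p.d\<omega>_0 q.d\<omega>_0)
  ultimately have "(p.d\<omega> t - q.d\<omega> t)\<^sup>2 + (\<omega> t - \<omega>' t)\<^sup>2 \<le> 0"
    by (simp add: E_def mult_le_0_iff)
  then show ?thesis by (simp add: sum_power2_le_zero_iff)
qed

lemma maximal_scale_factor_global:
  assumes "0 < G" "0 < K" "0 < \<alpha>" and \<omega>: "scale_factor G K \<alpha> \<omega> \<infinity>"
    and \<omega>': "maximal_scale_factor G K \<alpha> \<omega>' T"
  shows "T = \<infinity>" "\<And>t. 0 \<le> t \<Longrightarrow> \<omega>' t = \<omega> t"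
proof -
  have s': "scale_factor G K \<alpha> \<omega>' T"
    and max: "\<And>\<omega>'' b. scale_factor G K \<alpha> \<omega>'' b \<Longrightarrow>
      (\<forall>t\<in>from_zero_to T. \<omega>'' t = \<omega>' t) \<Longrightarrow> b \<le> T"
    using \<omega>' unfolding maximal_scale_factor_def by blast+
  note scales = scale_of_scale_factor[OF \<omega> assms(1-3)] scale_of_scale_factor[OF s' assms(1-3)]
  have eq: "\<omega> t = \<omega>' t" if "t \<in> from_zero_to T" for t
    by (rule scale_unique[OF scales]) (use that in \<open>auto simp: from_zero_to_iff\<close>)
  show T: "T = \<infinity>" using max[OF \<omega>] eq by simp
  show "\<omega>' t = \<omega> t" if "0 \<le> t" for t
    using eq[of t] that by (simp add: T)
qed

section \<open>Self-similar fields\<close>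

text \<open>A field \<open>a t * \<phi> (r / \<omega> t)\<close> inside the ball of radius \<open>Z * \<omega> t\<close>, and \<open>0\<close> outside. Density, both
  pressures and velocity of a homologous ball all have this form.\<close>

definition scaled_field ::
  "(real \<Rightarrow> real) \<Rightarrow> real \<Rightarrow> (real \<Rightarrow> real) \<Rightarrow> (real \<Rightarrow> real) \<Rightarrow> real \<Rightarrow> real \<Rightarrow> real" where
  "scaled_field \<omega> Z a \<phi> t r = (if r \<le> Z * \<omega> t then a t * \<phi> (r / \<omega> t) else 0)"

text \<open>The set \<open>S\<close> of times is kept general because the field equations refer to \<open>[0, \<infinity>)\<close> and the
  regularity conditions to the intervals \<open>[0, T]\<close>.\<close>

locale homologous_motion =
  fixes S :: "real set" and \<omega> d\<omega> :: "real \<Rightarrow> real" and Z Zm :: real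
  assumes S_limit: "\<And>t. t \<in> S \<Longrightarrow> at t within S \<noteq> bot"
    and \<omega>_deriv: "\<And>t. t \<in> S \<Longrightarrow> (\<omega> has_real_derivative d\<omega> t) (at t within S)"
    and \<omega>_pos: "\<And>t. t \<in> S \<Longrightarrow> 0 < \<omega> t"
    and d\<omega>_cont: "continuous_on S d\<omega>"
    and Z_pos: "0 < Z" and Z_less: "Z < Zm"
begin

abbreviation "R \<equiv> \<lambda>t. Z * \<omega> t"

lemma \<omega>_cont: "continuous_on S \<omega>"
  unfolding continuous_on_eq_continuous_within using \<omega>_deriv by (auto intro: DERIV_continuous)

lemma scaled_radius:
  assumes "t \<in> S" "0 \<le> r" "r \<le> R t"
  shows "r / \<omega> t \<in> {0..Z}" "r / \<omega> t \<in> {0..<Zm}"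
  using assms \<omega>_pos[of t] Z_less by (auto simp: pos_divide_le_eq pos_divide_less_eq intro: le_less_trans)

lemma scaled_radius_cont: "continuous_on (ball_closed S R) (\<lambda>x. snd x / \<omega> (fst x))"
proof -
  have "continuous_on (ball_closed S R) (\<lambda>x. \<omega> (fst x))"
    by (rule continuous_on_compose2[OF \<omega>_cont continuous_on_fst[OF continuous_on_id]])
      (auto simp: ball_closed_def)
  moreover have "\<forall>x\<in>ball_closed S R. \<omega> (fst x) \<noteq> 0"
    using \<omega>_pos by (force simp: ball_closed_def)
  ultimately show ?thesis by (intro continuous_intros) auto
qed

lemma time_function_cont:
  assumes "continuous_on S g"
  shows "continuous_on (ball_closed S R) (\<lambda>x. g (fst x))"
  by (rule continuous_on_compose2[OF assms continuous_on_fst[OF continuous_on_id]])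
    (auto simp: ball_closed_def)

lemma profile_function_cont:
  assumes "continuous_on {0..<Zm} g"
  shows "continuous_on (ball_closed S R) (\<lambda>x. g (snd x / \<omega> (fst x)))"
  by (rule continuous_on_compose2[OF assms scaled_radius_cont])
    (use scaled_radius in \<open>auto simp: ball_closed_def\<close>)

lemma ball_interior_subset: "ball_interior S R \<subseteq> ball_closed S R"
  by (auto simp: ball_interior_def ball_closed_def)

end

locale self_similar_field = homologous_motion S \<omega> d\<omega> Z Zm for S \<omega> d\<omega> Z Zm +
  fixes a da \<phi> d\<phi> :: "real \<Rightarrow> real"
  assumes a_deriv: "\<And>t. t \<in> S \<Longrightarrow> (a has_real_derivative da t) (at t within S)"
    and da_cont: "continuous_on S da"
    and \<phi>_deriv: "\<And>z. z \<in> {0..<Zm} \<Longrightarrow> (\<phi> has_real_derivative d\<phi> z) (at z within {0..})"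
    and d\<phi>_cont: "continuous_on {0..<Zm} d\<phi>"
begin

abbreviation "f \<equiv> scaled_field \<omega> Z a \<phi>"

lemma a_cont: "continuous_on S a"
  unfolding continuous_on_eq_continuous_within using a_deriv by (auto intro: DERIV_continuous)

lemma \<phi>_cont: "continuous_on {0..<Zm} \<phi>"
  unfolding continuous_on_eq_continuous_within
proof
  fix z assume "z \<in> {0..<Zm}"
  then have "(\<phi> has_real_derivative d\<phi> z) (at z within {0..<Zm})"
    by (rule DERIV_subset[OF \<phi>_deriv]) auto
  then show "continuous (at z within {0..<Zm}) \<phi>" by (rule DERIV_continuous)
qed

lemma scaled_field_deriv_r:
  assumes "t \<in> S" "0 \<le> r" "r < R t"
  shows "(f t has_real_derivative a t * d\<phi> (r / \<omega> t) / \<omega> t) (at r within {0..})"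
proof (rule has_field_derivative_transform_within[where d = "R t - r"])
  have "(\<phi> has_real_derivative d\<phi> (r / \<omega> t)) (at (r / \<omega> t) within (\<lambda>r. r / \<omega> t) ` {0..})"
    using scaled_radius(2)[of t r] assms \<omega>_pos[OF assms(1)]
    by (intro DERIV_subset[OF \<phi>_deriv]) auto
  moreover have "((\<lambda>r. r / \<omega> t) has_real_derivative 1 / \<omega> t) (at r within {0..})"
    using \<omega>_pos[OF assms(1)] by (auto intro!: derivative_eq_intros)
  ultimately have "(\<phi> \<circ> (\<lambda>r. r / \<omega> t) has_real_derivative d\<phi> (r / \<omega> t) * (1 / \<omega> t)) (at r within {0..})"
    by (rule DERIV_image_chain)
  from DERIV_cmult[OF this, of "a t"]
  show "((\<lambda>r. a t * \<phi> (r / \<omega> t)) has_real_derivative a t * d\<phi> (r / \<omega> t) / \<omega> t) (at r within {0..})"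
    by (simp add: o_def)
  show "a t * \<phi> (x / \<omega> t) = f t x" if "dist x r < R t - r" for x
    using that by (simp add: scaled_field_def dist_real_def abs_less_iff)
qed (use assms in auto)

text \<open>A point inside the ball at time \<open>t\<close> stays inside for nearby times, since \<open>\<omega>\<close> is continuous; hence the
  cutoff does not affect the time derivative.\<close>

lemma scaled_field_deriv_t:
  assumes "t \<in> S" "0 \<le> r" "r < R t"
  shows "((\<lambda>s. f s r) has_real_derivative
    da t * \<phi> (r / \<omega> t) - a t * d\<phi> (r / \<omega> t) * (r * d\<omega> t / (\<omega> t)\<^sup>2)) (at t within S)"
proof -
  have pos: "0 < \<omega> t" using assms \<omega>_pos by simp
  have "continuous (at t within S) \<omega>"
    using \<omega>_cont assms(1) by (simp add: continuous_on_eq_continuous_within)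
  moreover have "0 < \<omega> t - r / Z" using assms Z_pos by (simp add: field_simps)
  ultimately obtain d where d: "0 < d" "\<And>s. s \<in> S \<Longrightarrow> dist s t < d \<Longrightarrow> dist (\<omega> s) (\<omega> t) < \<omega> t - r / Z"
    unfolding continuous_within_eps_delta by blast
  have in_ball: "r \<le> Z * \<omega> s" if "s \<in> S" "dist s t < d" for s
  proof -
    have "r / Z < \<omega> s" using d(2)[OF that] by (simp add: dist_real_def abs_less_iff)
    then show ?thesis using Z_pos by (simp add: field_simps)
  qed
  show ?thesis
  proof (rule has_field_derivative_transform_within[OF _ d(1) assms(1)])
    have "(\<phi> has_real_derivative d\<phi> (r / \<omega> t)) (at (r / \<omega> t) within (\<lambda>s. r / \<omega> s) ` S)"
      using scaled_radius(2)[of t r] assms \<omega>_pos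
      by (intro DERIV_subset[OF \<phi>_deriv]) (auto simp: less_imp_le)
    moreover have "((\<lambda>s. r / \<omega> s) has_real_derivative - (r * d\<omega> t / (\<omega> t)\<^sup>2)) (at t within S)"
      using \<omega>_deriv[OF assms(1)] pos
      by (auto intro!: derivative_eq_intros simp: power2_eq_square)
    ultimately have "(\<phi> \<circ> (\<lambda>s. r / \<omega> s) has_real_derivative
        d\<phi> (r / \<omega> t) * - (r * d\<omega> t / (\<omega> t)\<^sup>2)) (at t within S)"
      by (rule DERIV_image_chain)
    from DERIV_mult[OF a_deriv[OF assms(1)] this]
    show "((\<lambda>s. a s * \<phi> (r / \<omega> s)) has_real_derivative
        da t * \<phi> (r / \<omega> t) - a t * d\<phi> (r / \<omega> t) * (r * d\<omega> t / (\<omega> t)\<^sup>2)) (at t within S)"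
      by (simp add: o_def mult_ac)
    show "a s * \<phi> (r / \<omega> s) = f s r" if "s \<in> S" "dist s t < d" for s
      using in_ball[OF that] by (simp add: scaled_field_def)
  qed
qed

lemma partial_r_scaled_field:
  assumes "t \<in> S" "0 \<le> r" "r < R t"
  shows "partial_r f t r = a t * d\<phi> (r / \<omega> t) / \<omega> t"
  unfolding partial_r_def
  using vector_derivative_real[OF scaled_field_deriv_r[OF assms]] at_within_atLeast_neq_bot assms(2)
  by simp

lemma partial_t_scaled_field:
  assumes "t \<in> S" "0 \<le> r" "r < R t"
  shows "partial_t S f t r = da t * \<phi> (r / \<omega> t) - a t * d\<phi> (r / \<omega> t) * (r * d\<omega> t / (\<omega> t)\<^sup>2)"
  unfolding partial_t_def
  using vector_derivative_real[OF scaled_field_deriv_t[OF assms] S_limit[OF assms(1)]] .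

lemma scaled_field_cont: "continuous_on (ball_closed S R) (\<lambda>(t, r). f t r)"
proof -
  have "continuous_on (ball_closed S R) (\<lambda>x. a (fst x) * \<phi> (snd x / \<omega> (fst x)))"
    by (intro continuous_intros time_function_cont profile_function_cont a_cont \<phi>_cont)
  then show ?thesis
    by (rule continuous_on_eq) (auto simp: ball_closed_def scaled_field_def)
qed

lemma scaled_field_C1: "C1_in_ball S R f"
  unfolding C1_in_ball_def
proof (intro conjI)
  show "\<forall>(t, r)\<in>ball_interior S R. (\<lambda>s. f s r) differentiable at t within S \<and>
      f t differentiable at r within {0..}"
    using scaled_field_deriv_r scaled_field_deriv_t
    by (auto simp: ball_interior_def has_real_derivative_iff_has_vector_derivative
        intro!: differentiableI_vector)
  have "continuous_on (ball_closed S R) (\<lambda>x. \<omega> (fst x))"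
    by (rule time_function_cont[OF \<omega>_cont])
  moreover have "\<forall>x\<in>ball_closed S R. \<omega> (fst x) \<noteq> 0"
    using \<omega>_pos by (force simp: ball_closed_def)
  ultimately have
    "continuous_on (ball_closed S R) (\<lambda>x. da (fst x) * \<phi> (snd x / \<omega> (fst x))
      - a (fst x) * d\<phi> (snd x / \<omega> (fst x)) * (snd x * d\<omega> (fst x) / (\<omega> (fst x))\<^sup>2))"
    "continuous_on (ball_closed S R) (\<lambda>x. a (fst x) * d\<phi> (snd x / \<omega> (fst x)) / \<omega> (fst x))"
    by (intro continuous_intros time_function_cont[OF da_cont] time_function_cont[OF a_cont]
        time_function_cont[OF d\<omega>_cont] profile_function_cont[OF \<phi>_cont]
        profile_function_cont[OF d\<phi>_cont]; simp)+
  note conts = this[THEN continuous_on_subset[OF _ ball_interior_subset]]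
  show "continuous_on (ball_interior S R) (\<lambda>(t, r). partial_t S f t r)"
    using conts(1)
    by (rule continuous_on_eq) (auto simp: ball_interior_def partial_t_scaled_field)
  show "continuous_on (ball_interior S R) (\<lambda>(t, r). partial_r f t r)"
    using conts(2)
    by (rule continuous_on_eq) (auto simp: ball_interior_def partial_r_scaled_field)
qed

lemma scaled_field_zero: "R t < r \<Longrightarrow> f t r = 0"
  by (simp add: scaled_field_def)

lemma partial_r_at_center:
  assumes "t \<in> S"
  shows "(partial_r f t \<longlongrightarrow> a t * d\<phi> 0 / \<omega> t) (at_right 0)"
proof -
  have pos: "0 < \<omega> t" using \<omega>_pos assms by simp
  have "(d\<phi> \<longlongrightarrow> d\<phi> 0) (at 0 within {0..<Zm})"
    using d\<phi>_cont Z_pos Z_less by (auto simp: continuous_on_def)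
  then have "(d\<phi> \<longlongrightarrow> d\<phi> 0) (at_right 0)"
    using at_within_from_zero_to[of 0 "ereal Zm"] Z_pos Z_less by (simp add: at_within_Ici_at_right)
  moreover have "filterlim (\<lambda>r. r / \<omega> t) (at_right 0) (at_right 0)"
  proof -
    have "((\<lambda>r. r / \<omega> t) \<longlongrightarrow> 0 / \<omega> t) (at_right 0)"
      using pos by (intro tendsto_intros) auto
    moreover have "eventually (\<lambda>r. 0 < r / \<omega> t) (at_right 0)"
      using pos by (auto simp: eventually_at_right_field intro!: exI[of _ 1])
    ultimately show ?thesis
      unfolding filterlim_at by (auto elim!: eventually_mono)
  qed
  ultimately have "((\<lambda>r. d\<phi> (r / \<omega> t)) \<longlongrightarrow> d\<phi> 0) (at_right 0)"
    by (rule filterlim_compose)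
  then have "((\<lambda>r. a t * d\<phi> (r / \<omega> t) / \<omega> t) \<longlongrightarrow> a t * d\<phi> 0 / \<omega> t) (at_right 0)"
    using pos by (intro tendsto_intros) auto
  moreover have "eventually (\<lambda>r. a t * d\<phi> (r / \<omega> t) / \<omega> t = partial_r f t r) (at_right 0)"
    using partial_r_scaled_field[OF assms] pos Z_pos
    by (auto simp: eventually_at_right_field intro!: exI[of _ "R t"])
  ultimately show ?thesis by (rule Lim_transform_eventually)
qed

end

section \<open>Pressures along the profile\<close>

text \<open>Both pressures have the form \<open>(A + B * y powr \<beta> + C * y) * \<eta> powr (4/3)\<close> with \<open>y = \<delta> / \<eta>\<close>, so their
  derivatives along a profile can be treated at once.\<close>

lemma F_rad_form:
  "F_rad \<kappa> \<nu> \<beta> d e =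
    (- (3 * \<kappa> * ((1 - \<nu>) / (1 + \<nu>)) * y_b \<nu> \<beta> powr \<beta> / \<beta>)
     + 3 * \<kappa> * ((1 - \<nu>) / (1 + \<nu>)) / \<beta> * (d / e) powr \<beta> + 0 * (d / e)) * e powr (4/3)"
proof -
  have "c * ((a - p) / \<beta>) * E = (- (c * p / \<beta>) + c / \<beta> * a + 0 * x) * E" for c a p E x :: real
    by (simp add: diff_divide_distrib algebra_simps)
  then show ?thesis unfolding F_rad_def .
qed

lemma F_tan_form:
  fixes \<nu> \<beta> :: real
  defines "p \<equiv> 3 * (\<beta> - 4/3) * (1 - \<nu>) / (2 * \<beta> * (\<beta> - 1) * (1 + \<nu>))"
    and "q \<equiv> (1 - \<nu>) / (2 * (\<beta> - 1) * (1 + \<nu>)) - 1/2"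
  shows "F_tan \<kappa> \<nu> \<beta> d e =
    (3 * \<kappa> * (p + q) - 3 * \<kappa> * ((1 - \<nu>) / (1 + \<nu>)) * y_b \<nu> \<beta> powr \<beta> / \<beta>
     + (3 * \<kappa> * ((1 - \<nu>) / (1 + \<nu>)) / \<beta> - 3 * \<kappa> * p) * (d / e) powr \<beta>
     + - (3 * \<kappa> * q) * (d / e)) * e powr (4/3)"
proof -
  have "F_tan \<kappa> \<nu> \<beta> d e = F_rad \<kappa> \<nu> \<beta> d e + 3 * \<kappa> * ((1 - d / e) * Q_fun \<nu> \<beta> (d / e)) * e powr (4/3)"
    by (simp add: F_tan_def)
  also have "(1 - d / e) * Q_fun \<nu> \<beta> (d / e) = p * (1 - (d / e) powr \<beta>) + q * (1 - d / e)"
    unfolding one_minus_times_Q p_def q_def ..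
  finally show ?thesis
    unfolding F_rad_form by (simp add: algebra_simps)
qed

text \<open>Homogeneity of degree \<open>4/3\<close> in the two compressions. Only for this polytropic exponent do the pressure
  forces scale like gravity, which is what makes homologous motion possible.\<close>

lemma F_rad_scale: "0 < w \<Longrightarrow> 0 < e \<Longrightarrow> F_rad \<kappa> \<nu> \<beta> (d / w ^ 3) (e / w ^ 3) = F_rad \<kappa> \<nu> \<beta> d e / w ^ 4"
  and F_tan_scale: "0 < w \<Longrightarrow> 0 < e \<Longrightarrow> F_tan \<kappa> \<nu> \<beta> (d / w ^ 3) (e / w ^ 3) = F_tan \<kappa> \<nu> \<beta> d e / w ^ 4"
proof -
  assume w: "0 < w" "0 < e"
  have "(w powr 3) powr (4/3) = w powr 4"
    by (subst powr_powr) simp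
  then have "(w ^ 3) powr (4/3) = w ^ 4"
    using w by (simp add: powr_numeral)
  then have p: "(e / w ^ 3) powr (4/3) = e powr (4/3) / w ^ 4"
    using w by (simp add: powr_divide)
  have "(d / w ^ 3) / (e / w ^ 3) = d / e" using w by simp
  then show "F_rad \<kappa> \<nu> \<beta> (d / w ^ 3) (e / w ^ 3) = F_rad \<kappa> \<nu> \<beta> d e / w ^ 4"
    "F_tan \<kappa> \<nu> \<beta> (d / w ^ 3) (e / w ^ 3) = F_tan \<kappa> \<nu> \<beta> d e / w ^ 4"
    unfolding F_rad_form F_tan_form p by simp_all
qed

text \<open>Elastic forces at fixed \<open>y\<close>, where \<open>Y\<close> stands for \<open>y powr \<beta>\<close> and \<open>Yb\<close> for its boundary value. The
  value of \<open>Yb\<close> cancels the terms with \<open>(1 + \<nu>) / (1 - \<nu>)\<close>; what remains is a multiple of \<open>B\<close>.\<close>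

lemma force_identity:
  fixes z y Y Yb \<kappa> \<nu> \<beta> :: real
  assumes "z \<noteq> 0" "\<beta> \<noteq> 0" "\<beta> \<noteq> 1" "1 + \<nu> \<noteq> 0" "1 - \<nu> \<noteq> 0"
    and "Yb = 1 - \<beta> / 4 * ((1 + \<nu>) / (1 - \<nu>))"
  shows "3 * \<kappa> * ((1 - \<nu>) / (1 + \<nu>)) *
      (3 * (\<beta> - 4/3) / z * ((y + (\<beta> - 1) * (y * Y) - \<beta> * Y) / (\<beta> * (\<beta> - 1)))
       + 3 / z * (Y * (1 - y)) - 4 / (\<beta> * z) * ((Y - Yb) * (1 - y)))
    = 2 / z * (3 * \<kappa> * (3 * (\<beta> - 4/3) * (1 - \<nu>) / (2 * \<beta> * (\<beta> - 1) * (1 + \<nu>)) * (1 - Y)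
       + ((1 - \<nu>) / (2 * (\<beta> - 1) * (1 + \<nu>)) - 1/2) * (1 - y)))"
proof -
  have "\<beta> - 1 \<noteq> 0" using assms by simp
  with assms(1-5) show ?thesis
    unfolding assms(6) by (simp add: divide_simps) algebra
qed

context profile
begin

definition pressure :: "real \<Rightarrow> real \<Rightarrow> real \<Rightarrow> real \<Rightarrow> real" where
  "pressure A B C z = (A + B * (\<delta> z / \<eta> z) powr \<beta> + C * (\<delta> z / \<eta> z)) * \<eta> z powr (4/3)"

definition dratio :: "real \<Rightarrow> real" where
  "dratio z = (d\<delta> z * \<eta> z - \<delta> z * d\<eta> z) / (\<eta> z * \<eta> z)"

definition dpressure :: "real \<Rightarrow> real \<Rightarrow> real \<Rightarrow> real \<Rightarrow> real" where
  "dpressure A B C z = (B * (\<beta> * (\<delta> z / \<eta> z) powr (\<beta> - 1) * dratio z) + C * dratio z) * \<eta> z powr (4/3)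
     + (A + B * (\<delta> z / \<eta> z) powr \<beta> + C * (\<delta> z / \<eta> z)) * (4/3 * \<eta> z powr (1/3) * d\<eta> z)"

lemma pressure_deriv:
  assumes "z \<in> I"
  shows "(pressure A B C has_real_derivative dpressure A B C z) (at z within {0..})"
proof -
  have pos: "0 < \<delta> z" "0 < \<eta> z" using \<delta>_pos \<eta>_pos assms by auto
  have ratio: "((\<lambda>z. \<delta> z / \<eta> z) has_real_derivative dratio z) (at z within {0..})"
    unfolding dratio_def using pos by (intro DERIV_divide \<delta>_deriv \<eta>_deriv_at assms) simp
  have 1: "((\<lambda>z. (\<delta> z / \<eta> z) powr \<beta>) has_real_derivative \<beta> * (\<delta> z / \<eta> z) powr (\<beta> - 1) * dratio z) (at z within {0..})"
    using has_real_derivative_powr[THEN DERIV_chain2, OF _ ratio, of \<beta>] pos by simp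
  have 2: "((\<lambda>z. \<eta> z powr (4/3)) has_real_derivative 4/3 * \<eta> z powr (1/3) * d\<eta> z) (at z within {0..})"
    using has_real_derivative_powr[THEN DERIV_chain2, OF _ \<eta>_deriv_at[OF assms], of "4/3"] pos by simp
  show ?thesis
    unfolding pressure_def[abs_def] dpressure_def
    using DERIV_mult[OF DERIV_add[OF DERIV_add[OF DERIV_const DERIV_cmult[OF 1, of B]]
        DERIV_cmult[OF ratio, of C]] 2, of A]
    by (simp add: mult_ac add_ac)
qed

lemma dpressure_cont: "continuous_on I (dpressure A B C)"
proof -
  have ne: "\<forall>z\<in>I. \<eta> z \<noteq> 0" "\<forall>z\<in>I. \<delta> z / \<eta> z \<noteq> 0" "\<forall>z\<in>I. \<eta> z * \<eta> z \<noteq> 0"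
    using \<delta>_pos \<eta>_pos by force+
  then show ?thesis
    unfolding dpressure_def[abs_def] dratio_def
    by (intro continuous_intros d\<delta>_cont d\<eta>_cont \<delta>_cont \<eta>_cont) auto
qed

lemma dpressure_center: "dpressure A B C 0 = 0"
  by (simp add: dpressure_def dratio_def d\<delta>_def d\<eta>_def)

text \<open>The profile equation, solved for the pressure gradient: the momentum balance in similarity variables.\<close>

lemma radial_force_balance:
  fixes \<kappa> \<nu> :: real
  assumes z: "z \<in> I" "0 < z" and \<nu>: "- 1 < \<nu>" "\<nu> < 1"
    and yb: "y_b \<nu> \<beta> powr \<beta> = 1 - \<beta> / 4 * ((1 + \<nu>) / (1 - \<nu>))"
  defines "c \<equiv> 3 * \<kappa> * ((1 - \<nu>) / (1 + \<nu>))"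
  shows "dpressure (- (c * y_b \<nu> \<beta> powr \<beta> / \<beta>)) (c / \<beta>) 0 z
    = 2 / z * (F_tan \<kappa> \<nu> \<beta> (\<delta> z) (\<eta> z) - F_rad \<kappa> \<nu> \<beta> (\<delta> z) (\<eta> z))
      - c * \<theta> * z * \<delta> z * (\<eta> z + \<alpha>)"
proof -
  define y where "y = \<delta> z / \<eta> z"
  define Y where "Y = y powr \<beta>"
  define E where "E = \<eta> z powr (4/3)"
  have pos: "0 < \<delta> z" "0 < \<eta> z" using \<delta>_pos \<eta>_pos z by auto
  then have y: "0 < y" by (simp add: y_def)
  have Y: "y powr (\<beta> - 1) * y = Y"
    using y powr_add[of y "\<beta> - 1" 1] by (simp add: Y_def)
  have E: "\<eta> z powr (1/3) * \<eta> z = E"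
    using pos powr_add[of "\<eta> z" "1/3" 1] by (simp add: E_def)
  have E': "E * (\<eta> z powr (- 1/3) / \<eta> z) = 1"
    using pos powr_add[of "\<eta> z" "4/3" "- 1/3"] by (simp add: E_def)
  have \<delta>: "\<delta> z = y * \<eta> z" using pos by (simp add: y_def)
  have d\<eta>: "d\<eta> z = - (3 / z) * (1 - y) * \<eta> z"
  proof -
    have "\<eta> z - \<delta> z = (1 - y) * \<eta> z" unfolding \<delta> by (simp add: left_diff_distrib)
    then show ?thesis using z by (simp add: d\<eta>_def)
  qed
  have dratio: "dratio z = d\<delta> z / \<eta> z + 3 / z * (y * (1 - y))"
    using z pos unfolding dratio_def d\<eta> \<delta> by (simp add: field_simps)
  define B where "B = (y + (\<beta> - 1) * (y * Y) - \<beta> * Y) / (\<beta> * (\<beta> - 1))"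
  have B: "B_fun \<beta> y = B"
    using y by (simp add: B_fun_def B_def Y_def powr_add)
  have "y powr (\<beta> - 1) * d\<delta> z = (y powr (\<beta> - 1) * y powr (1 - \<beta>)) *
      (3 * (\<beta> - 4/3) / z * B * \<eta> z - \<theta> * z * \<eta> z powr (- 1/3) * \<delta> z * (\<eta> z + \<alpha>))"
    using z by (simp add: d\<delta>_def slope_def B mult.assoc flip: y_def)
  also have "y powr (\<beta> - 1) * y powr (1 - \<beta>) = 1"
    using y by (simp flip: powr_add)
  finally have "E * (y powr (\<beta> - 1) * (d\<delta> z / \<eta> z)) =
      E * (3 * (\<beta> - 4/3) / z * B) - \<theta> * z * \<delta> z * (\<eta> z + \<alpha>) * (E * (\<eta> z powr (- 1/3) / \<eta> z))"
    using pos by (simp add: diff_divide_distrib right_diff_distrib mult_ac)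
  then have shear_part: "E * (y powr (\<beta> - 1) * (d\<delta> z / \<eta> z)) =
      E * (3 * (\<beta> - 4/3) / z * B) - \<theta> * z * \<delta> z * (\<eta> z + \<alpha>)"
    unfolding E' by simp
  have "dpressure (- (c * y_b \<nu> \<beta> powr \<beta> / \<beta>)) (c / \<beta>) 0 z
      = c * (E * (y powr (\<beta> - 1) * dratio z))
        + c / \<beta> * (Y - y_b \<nu> \<beta> powr \<beta>) * (4/3 * (\<eta> z powr (1/3) * d\<eta> z))"
    unfolding dpressure_def using \<beta>_gt
    by (simp add: field_simps flip: y_def Y_def E_def)
  also have "\<eta> z powr (1/3) * d\<eta> z = - (3 / z) * (1 - y) * E"
    unfolding d\<eta> by (simp add: mult_ac flip: E)
  also have "E * (y powr (\<beta> - 1) * dratio z)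
      = E * (y powr (\<beta> - 1) * (d\<delta> z / \<eta> z)) + E * (3 / z * ((y powr (\<beta> - 1) * y) * (1 - y)))"
    unfolding dratio by (simp add: distrib_left mult_ac)
  also have "c * (E * (y powr (\<beta> - 1) * (d\<delta> z / \<eta> z)) + E * (3 / z * ((y powr (\<beta> - 1) * y) * (1 - y))))
      + c / \<beta> * (Y - y_b \<nu> \<beta> powr \<beta>) * (4/3 * (- (3 / z) * (1 - y) * E))
    = E * (c * (3 * (\<beta> - 4/3) / z * B + 3 / z * (Y * (1 - y))
        - 4 / (\<beta> * z) * ((Y - y_b \<nu> \<beta> powr \<beta>) * (1 - y)))) - c * \<theta> * z * \<delta> z * (\<eta> z + \<alpha>)"
    unfolding shear_part Y by (simp add: algebra_simps add_divide_distrib diff_divide_distrib)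
  also have "c * (3 * (\<beta> - 4/3) / z * B + 3 / z * (Y * (1 - y))
        - 4 / (\<beta> * z) * ((Y - y_b \<nu> \<beta> powr \<beta>) * (1 - y)))
      = 2 / z * (3 * \<kappa> * ((1 - y) * Q_fun \<nu> \<beta> y))"
    unfolding c_def B_def one_minus_times_Q Y_def[symmetric]
    by (rule force_identity[OF _ _ _ _ _ yb]) (use z \<nu> \<beta>_gt in auto)
  also have "E * (2 / z * (3 * \<kappa> * ((1 - y) * Q_fun \<nu> \<beta> y)))
      = 2 / z * (F_tan \<kappa> \<nu> \<beta> (\<delta> z) (\<eta> z) - F_rad \<kappa> \<nu> \<beta> (\<delta> z) (\<eta> z))"
    by (simp add: F_tan_def mult_ac flip: y_def E_def)
  finally show ?thesis .
qed

end

lemma F_tan_ge_F_rad: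
  assumes "- 1 < \<nu>" "\<nu> \<le> 1/2" "1 < \<beta>" "\<beta> \<le> 4/3" "0 < \<kappa>" "0 < d" "d \<le> e"
  shows "F_rad \<kappa> \<nu> \<beta> d e \<le> F_tan \<kappa> \<nu> \<beta> d e"
proof -
  have "0 \<le> 3 * \<kappa> * ((1 - d / e) * Q_fun \<nu> \<beta> (d / e)) * e powr (4/3)"
    using assms by (intro mult_nonneg_nonneg one_minus_times_Q_nonneg) auto
  then show ?thesis by (simp add: F_tan_def mult.assoc)
qed

text \<open>The radial pressure changes sign at \<open>y = y\<^sub>b\<close> only. Hence positivity inside and vanishing at the
  surface together force the surface to sit at the first crossing.\<close>

lemma F_rad_sign:
  assumes "- 1 < \<nu>" "\<nu> < 1" "1 < \<beta>" "0 < \<kappa>" "0 < d" "0 < e" "0 < y_b \<nu> \<beta>"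
  shows "0 < F_rad \<kappa> \<nu> \<beta> d e \<longleftrightarrow> y_b \<nu> \<beta> < d / e"
    and "F_rad \<kappa> \<nu> \<beta> d e = 0 \<longleftrightarrow> d / e = y_b \<nu> \<beta>"
proof -
  define c where "c = 3 * \<kappa> * ((1 - \<nu>) / (1 + \<nu>)) / \<beta> * e powr (4/3)"
  have c: "0 < c" using assms by (simp add: c_def)
  have F: "F_rad \<kappa> \<nu> \<beta> d e = c * ((d / e) powr \<beta> - y_b \<nu> \<beta> powr \<beta>)"
    by (simp add: F_rad_def c_def)
  have iffs: "y_b \<nu> \<beta> powr \<beta> < (d / e) powr \<beta> \<longleftrightarrow> y_b \<nu> \<beta> < d / e"
      "(d / e) powr \<beta> < y_b \<nu> \<beta> powr \<beta> \<longleftrightarrow> d / e < y_b \<nu> \<beta>"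
  proof -
    have "x powr \<beta> < y powr \<beta> \<longleftrightarrow> x < y" if "0 < x" "0 < y" for x y :: real
      using powr_less_mono2[of \<beta> x y] powr_less_cancel2[of \<beta> x y] that assms(3) by auto
    then show "y_b \<nu> \<beta> powr \<beta> < (d / e) powr \<beta> \<longleftrightarrow> y_b \<nu> \<beta> < d / e"
      "(d / e) powr \<beta> < y_b \<nu> \<beta> powr \<beta> \<longleftrightarrow> d / e < y_b \<nu> \<beta>"
      using assms by simp_all
  qed
  show "0 < F_rad \<kappa> \<nu> \<beta> d e \<longleftrightarrow> y_b \<nu> \<beta> < d / e"
    unfolding F iffs(1)[symmetric] using c by (simp add: zero_less_mult_iff)
  have "(d / e) powr \<beta> = y_b \<nu> \<beta> powr \<beta> \<longleftrightarrow> d / e = y_b \<nu> \<beta>"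
    using iffs by (metis linorder_neq_iff)
  then show "F_rad \<kappa> \<nu> \<beta> d e = 0 \<longleftrightarrow> d / e = y_b \<nu> \<beta>"
    unfolding F using c by simp
qed

section \<open>The homologous ball\<close>

text \<open>A maximal profile together with the first radius \<open>Z\<close> at which \<open>\<delta> / \<eta>\<close> reaches \<open>y\<^sub>b\<close>.\<close>

locale polytropic_ball =
  fixes G K \<kappa> \<nu> \<beta> \<alpha> :: real and \<omega> \<delta> \<eta> :: "real \<Rightarrow> real" and Zm Z :: real
  assumes G_pos: "0 < G" and K_pos: "0 < K" and \<kappa>_pos: "0 < \<kappa>"
    and \<nu>_gt: "- 1 < \<nu>" and \<nu>_le: "\<nu> \<le> 1/2" and \<alpha>_pos: "0 < \<alpha>"
    and \<beta>_gt: "1 < \<beta>" and \<beta>_le: "\<beta> \<le> 4/3"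
    and nondegenerate: "\<not> (\<beta> = 4/3 \<and> \<nu> = 1/2)"
    and scale_factor: "scale_factor G K \<alpha> \<omega> \<infinity>"
    and max_profile: "maximal_strongly_regular_profile (\<theta>_const G K \<kappa> \<nu>) \<beta> \<alpha> \<delta> \<eta> (ereal Zm)"
    and Z_pos: "0 < Z" and Z_less: "Z < Zm"
    and ratio_Z: "\<delta> Z / \<eta> Z = y_b \<nu> \<beta>"
    and ratio_inside: "\<And>z. 0 \<le> z \<Longrightarrow> z < Z \<Longrightarrow> y_b \<nu> \<beta> < \<delta> z / \<eta> z"
begin

abbreviation "k \<equiv> 4 * pi * G / 3 * K * \<alpha>"
abbreviation "\<theta> \<equiv> \<theta>_const G K \<kappa> \<nu>"

lemma \<theta>_pos: "0 < \<theta>"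
  using G_pos K_pos \<kappa>_pos \<nu>_gt \<nu>_le by (simp add: \<theta>_const_def)

sublocale sc: scale k \<omega> \<infinity>
  by (rule scale_of_scale_factor[OF scale_factor G_pos K_pos \<alpha>_pos])

sublocale pr: profile \<theta> \<beta> \<alpha> \<delta> \<eta> "ereal Zm"
  using \<theta>_pos \<beta>_gt \<beta>_le \<alpha>_pos max_profile
  by unfold_locales (simp_all add: maximal_strongly_regular_profile_def)

lemmas yb = y_b_bounds[OF \<nu>_gt \<nu>_le \<beta>_gt \<beta>_le nondegenerate]

lemma \<omega>_pos: "0 \<le> t \<Longrightarrow> 0 < \<omega> t"
  using sc.\<omega>_ge_1[of t] by simp

abbreviation "Fr z \<equiv> F_rad \<kappa> \<nu> \<beta> (\<delta> z) (\<eta> z)"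
abbreviation "Ft z \<equiv> F_tan \<kappa> \<nu> \<beta> (\<delta> z) (\<eta> z)"

definition mass_density :: "real \<Rightarrow> real \<Rightarrow> real" where
  "mass_density = scaled_field \<omega> Z (\<lambda>t. K / \<omega> t ^ 3) \<delta>"

definition radial_pressure :: "real \<Rightarrow> real \<Rightarrow> real" where
  "radial_pressure = scaled_field \<omega> Z (\<lambda>t. 1 / \<omega> t ^ 4) Fr"

definition tangential_pressure :: "real \<Rightarrow> real \<Rightarrow> real" where
  "tangential_pressure = scaled_field \<omega> Z (\<lambda>t. 1 / \<omega> t ^ 4) Ft"

definition velocity :: "real \<Rightarrow> real \<Rightarrow> real" where
  "velocity = scaled_field \<omega> Z sc.d\<omega> (\<lambda>z. z)"

definition time_domain :: "real set \<Rightarrow> bool" where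
  "time_domain S \<longleftrightarrow> S = {0..} \<or> (\<exists>T>0. S = {0..T})"

lemma time_domain_cases [simp, intro]: "time_domain {0..}" "0 < T \<Longrightarrow> time_domain {0..T}"
  by (auto simp: time_domain_def)

lemma time_domain_nonneg: "time_domain S \<Longrightarrow> t \<in> S \<Longrightarrow> 0 \<le> t"
  by (auto simp: time_domain_def)

lemma time_domain_subset: "time_domain S \<Longrightarrow> S \<subseteq> {0..}"
  by (auto simp: time_domain_def)

lemma time_domain_limit:
  assumes "time_domain S" "t \<in> S" shows "at t within S \<noteq> bot"
proof (cases "S = {0..}")
  case True
  then show ?thesis using assms(2) at_within_atLeast_neq_bot[of t] by simp
next
  case False
  then obtain T where "0 < T" "S = {0..T}" using assms(1) by (auto simp: time_domain_def)
  then have "t islimpt S" using assms(2) by simp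
  then show ?thesis by (simp add: trivial_limit_within)
qed

lemma \<omega>_deriv_within:
  assumes "time_domain S" "t \<in> S"
  shows "(\<omega> has_real_derivative sc.d\<omega> t) (at t within S)"
    "(sc.d\<omega> has_real_derivative k / (\<omega> t)\<^sup>2) (at t within S)"
  using DERIV_subset[OF sc.\<omega>_deriv time_domain_subset[OF assms(1)], of t]
    DERIV_subset[OF sc.d\<omega>_deriv time_domain_subset[OF assms(1)], of t] time_domain_nonneg[OF assms]
  by simp_all

lemma \<omega>_cont_on: "time_domain S \<Longrightarrow> continuous_on S \<omega>"
  and d\<omega>_cont_on: "time_domain S \<Longrightarrow> continuous_on S sc.d\<omega>"
  using continuous_on_subset[OF sc.\<omega>_cont] continuous_on_subset[OF sc.d\<omega>_cont] time_domain_subset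
  by simp_all

lemma motion:
  assumes "time_domain S"
  shows "homologous_motion S \<omega> sc.d\<omega> Z Zm"
proof
  show "at t within S \<noteq> bot" if "t \<in> S" for t
    by (rule time_domain_limit[OF assms that])
  show "(\<omega> has_real_derivative sc.d\<omega> t) (at t within S)" if "t \<in> S" for t
    by (rule \<omega>_deriv_within(1)[OF assms that])
  show "0 < \<omega> t" if "t \<in> S" for t
    by (rule \<omega>_pos[OF time_domain_nonneg[OF assms that]])
qed (rule d\<omega>_cont_on[OF assms] Z_pos Z_less)+

lemma amplitude_deriv:
  assumes "time_domain S" "t \<in> S"
  shows "((\<lambda>t. c / \<omega> t ^ n) has_real_derivative - (n * c * sc.d\<omega> t / \<omega> t ^ (n + 1))) (at t within S)"
proof -
  have "0 < \<omega> t" using assms \<omega>_pos time_domain_nonneg by blast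
  then have "((\<lambda>t. c / \<omega> t ^ n) has_real_derivative
      (0 * \<omega> t ^ n - c * (real n * (sc.d\<omega> t * \<omega> t ^ (n - Suc 0)))) / (\<omega> t ^ n * \<omega> t ^ n)) (at t within S)"
    by (intro DERIV_divide DERIV_const DERIV_power \<omega>_deriv_within(1)[OF assms]) simp
  also have "(0 * \<omega> t ^ n - c * (real n * (sc.d\<omega> t * \<omega> t ^ (n - Suc 0)))) / (\<omega> t ^ n * \<omega> t ^ n)
      = - (n * c * sc.d\<omega> t / \<omega> t ^ (n + 1))"
    using \<open>0 < \<omega> t\<close> by (cases n) (simp_all add: field_simps)
  finally show ?thesis .
qed

lemma amplitude_deriv_cont:
  assumes "time_domain S"
  shows "continuous_on S (\<lambda>t. - (real n * c * sc.d\<omega> t / \<omega> t ^ (n + 1)))"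
proof -
  have "\<forall>t\<in>S. \<omega> t ^ (n + 1) \<noteq> 0" using \<omega>_pos time_domain_nonneg[OF assms] by fastforce
  then show ?thesis
    by (intro continuous_intros \<omega>_cont_on d\<omega>_cont_on assms)
qed

lemma acceleration_cont:
  assumes "time_domain S"
  shows "continuous_on S (\<lambda>t. k / (\<omega> t)\<^sup>2)"
proof -
  have "\<forall>t\<in>S. (\<omega> t)\<^sup>2 \<noteq> 0" using \<omega>_pos time_domain_nonneg[OF assms] by fastforce
  then show ?thesis by (intro continuous_intros \<omega>_cont_on assms)
qed

abbreviation "c \<equiv> 3 * \<kappa> * ((1 - \<nu>) / (1 + \<nu>))"
abbreviation "dF_rad \<equiv> pr.dpressure (- (c * y_b \<nu> \<beta> powr \<beta> / \<beta>)) (c / \<beta>) 0"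

lemma F_rad_deriv:
  assumes "z \<in> {0..<Zm}"
  shows "(Fr has_real_derivative dF_rad z) (at z within {0..})"
proof -
  have "Fr = pr.pressure (- (c * y_b \<nu> \<beta> powr \<beta> / \<beta>)) (c / \<beta>) 0"
    unfolding pr.pressure_def[abs_def] F_rad_form ..
  then show ?thesis using pr.pressure_deriv[of z] assms by (simp only:) simp
qed

lemma F_tan_deriv:
  obtains dF_tan where
    "\<And>z. z \<in> {0..<Zm} \<Longrightarrow>
      (Ft has_real_derivative dF_tan z) (at z within {0..})"
    "continuous_on {0..<Zm} dF_tan" "dF_tan 0 = 0"
proof -
  define p q where "p = 3 * (\<beta> - 4/3) * (1 - \<nu>) / (2 * \<beta> * (\<beta> - 1) * (1 + \<nu>))"
    and "q = (1 - \<nu>) / (2 * (\<beta> - 1) * (1 + \<nu>)) - 1/2"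
  define A B C where "A = 3 * \<kappa> * (p + q) - c * y_b \<nu> \<beta> powr \<beta> / \<beta>"
    and "B = c / \<beta> - 3 * \<kappa> * p" and "C = - (3 * \<kappa> * q)"
  have eq: "Ft = pr.pressure A B C"
    by (simp only: pr.pressure_def[abs_def] F_tan_form A_def B_def C_def p_def q_def)
  show thesis
  proof (rule that[of "pr.dpressure A B C"])
    show "(Ft has_real_derivative pr.dpressure A B C z)
        (at z within {0..})" if "z \<in> {0..<Zm}" for z
      unfolding eq by (rule pr.pressure_deriv) (use that in simp)
    show "continuous_on {0..<Zm} (pr.dpressure A B C)"
      using pr.dpressure_cont by simp
    show "pr.dpressure A B C 0 = 0" by (rule pr.dpressure_center)
  qed
qed

lemmas dF_rad_cont = pr.dpressure_cont[unfolded from_zero_to_ereal]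
  and d\<delta>_cont = pr.d\<delta>_cont[unfolded from_zero_to_ereal]
  and \<delta>_deriv = pr.\<delta>_deriv[unfolded from_zero_to_ereal]

lemma id_deriv: "z \<in> {0..<Zm} \<Longrightarrow> ((\<lambda>z. z) has_real_derivative 1) (at z within {0..})"
  by (auto intro!: derivative_eq_intros)

lemma density_field:
  assumes "time_domain S"
  shows "self_similar_field S \<omega> sc.d\<omega> Z Zm
    (\<lambda>t. K / \<omega> t ^ 3) (\<lambda>t. - (real 3 * K * sc.d\<omega> t / \<omega> t ^ (3 + 1))) \<delta> pr.d\<delta>"
  using motion[OF assms] amplitude_deriv[OF assms, of _ K 3] amplitude_deriv_cont[OF assms, of 3 K]
    \<delta>_deriv d\<delta>_cont
  unfolding self_similar_field_def self_similar_field_axioms_def by blast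

lemma velocity_field:
  assumes "time_domain S"
  shows "self_similar_field S \<omega> sc.d\<omega> Z Zm sc.d\<omega> (\<lambda>t. k / (\<omega> t)\<^sup>2) (\<lambda>z. z) (\<lambda>_. 1)"
  using motion[OF assms] \<omega>_deriv_within(2)[OF assms] acceleration_cont[OF assms] id_deriv
    continuous_on_const[of "{0..<Zm}" "1 :: real"]
  unfolding self_similar_field_def self_similar_field_axioms_def by blast

lemma pressure_field:
  assumes "time_domain S"
    and "\<And>z. z \<in> {0..<Zm} \<Longrightarrow> (\<phi> has_real_derivative d\<phi> z) (at z within {0..})"
    and "continuous_on {0..<Zm} d\<phi>"
  shows "self_similar_field S \<omega> sc.d\<omega> Z Zm
    (\<lambda>t. 1 / \<omega> t ^ 4) (\<lambda>t. - (real 4 * 1 * sc.d\<omega> t / \<omega> t ^ (4 + 1))) \<phi> d\<phi>"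
  using motion[OF assms(1)] amplitude_deriv[OF assms(1), of _ 1 4]
    amplitude_deriv_cont[OF assms(1), of 4 1] assms(2,3)
  unfolding self_similar_field_def self_similar_field_axioms_def by blast

lemmas density_deriv_r = self_similar_field.scaled_field_deriv_r
    [OF density_field[OF time_domain_cases(1)], folded mass_density_def]
  and density_partial_t = self_similar_field.partial_t_scaled_field
    [OF density_field[OF time_domain_cases(1)], folded mass_density_def]
  and velocity_deriv_r = self_similar_field.scaled_field_deriv_r
    [OF velocity_field[OF time_domain_cases(1)], folded velocity_def]
  and velocity_partial_r = self_similar_field.partial_r_scaled_field
    [OF velocity_field[OF time_domain_cases(1)], folded velocity_def]
  and velocity_partial_t = self_similar_field.partial_t_scaled_field
    [OF velocity_field[OF time_domain_cases(1)], folded velocity_def]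
  and radial_pressure_partial_r = self_similar_field.partial_r_scaled_field
    [OF pressure_field[OF time_domain_cases(1) F_rad_deriv dF_rad_cont], folded radial_pressure_def]

lemma scaled_radius_mem:
  assumes "0 \<le> t" "0 \<le> r" "r \<le> Z * \<omega> t"
  shows "0 \<le> r / \<omega> t" "r / \<omega> t \<le> Z" "r / \<omega> t \<in> pr.I"
  using homologous_motion.scaled_radius[OF motion[OF time_domain_cases(1)], of t r] assms by auto

lemma mass_eq:
  assumes "0 \<le> t" "0 < r" "r \<le> Z * \<omega> t"
  shows "mass mass_density t r = 4 * pi / 3 * K * (r / \<omega> t) ^ 3 * \<eta> (r / \<omega> t)"
proof -
  let ?w = "\<omega> t"
  have w: "0 < ?w" by (rule \<omega>_pos[OF assms(1)])
  define z where "z = r / ?w"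
  have z: "0 < z" "z \<in> pr.I" "r = z * ?w"
    using assms w scaled_radius_mem[of t r] by (auto simp: z_def)
  have "((\<lambda>x. \<delta> x * x\<^sup>2) has_integral \<eta> z * z ^ 3 / 3) {0..z}"
  proof -
    have "(\<lambda>x. \<delta> x * x\<^sup>2) integrable_on {0..z}"
      by (intro integrable_times_square pr.\<delta>_cont_Icc z)
    moreover have "integral {0..z} (\<lambda>x. \<delta> x * x\<^sup>2) = \<eta> z * z ^ 3 / 3"
      using pr.\<eta>_eq[OF z(2,1)] z(1) by (simp add: ball_mean_def)
    ultimately show ?thesis by (simp add: has_integral_iff)
  qed
  from has_integral_stretch_real[OF this, of "1 / ?w"]
  have "((\<lambda>s. \<delta> (s / ?w) * (s / ?w)\<^sup>2) has_integral ?w * (\<eta> z * z ^ 3 / 3)) ((\<lambda>x. x * ?w) ` {0..z})"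
    using w by simp
  also have "(\<lambda>x. x * ?w) ` {0..z} = {0..r}"
    using w z image_mult_atLeastAtMost[of ?w 0 z] by (simp add: mult.commute)
  finally have "((\<lambda>s. K / ?w * (\<delta> (s / ?w) * (s / ?w)\<^sup>2)) has_integral K / ?w * (?w * (\<eta> z * z ^ 3 / 3))) {0..r}"
    by (rule has_integral_mult_right)
  then have "((\<lambda>s. mass_density t s * s\<^sup>2) has_integral K * (\<eta> z * z ^ 3 / 3)) {0..r}"
  proof (rule has_integral_eq_rhs[OF has_integral_eq[rotated]])
    show "K / ?w * (\<delta> (s / ?w) * (s / ?w)\<^sup>2) = mass_density t s * s\<^sup>2" if "s \<in> {0..r}" for s
      using that assms(3) w
      by (simp add: mass_density_def scaled_field_def power2_eq_square power3_eq_cube)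
  qed (use w in simp)
  then show ?thesis
    by (simp add: mass_def integral_unique flip: z_def)
qed

lemma mean_compression_eq:
  assumes "0 \<le> t" "0 \<le> r" "r \<le> Z * \<omega> t"
  shows "mean_compression K mass_density t r = \<eta> (r / \<omega> t) / \<omega> t ^ 3"
proof (cases "r = 0")
  case True
  then show ?thesis
    using K_pos \<omega>_pos[OF assms(1)] Z_pos pr.\<eta>_0
    by (simp add: mean_compression_def mass_density_def scaled_field_def)
next
  case False
  then show ?thesis
    using mass_eq[of t r] assms K_pos \<omega>_pos[OF assms(1)]
    by (simp add: mean_compression_def power_divide)
qed

lemma mass_conservation:
  assumes "0 \<le> t" "0 < r" "r < Z * \<omega> t"
  shows "partial_t {0..} mass_density t r
    + 1 / r\<^sup>2 * partial_r (\<lambda>t r. r\<^sup>2 * mass_density t r * velocity t r) t r = 0"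
proof -
  define w z where "w = \<omega> t" and "z = r / w"
  have w: "0 < w" unfolding w_def by (rule \<omega>_pos[OF assms(1)])
  have r: "r = z * w" "0 < z" using w assms by (simp_all add: z_def)
  have vals: "mass_density t r = K / w ^ 3 * \<delta> z" "velocity t r = sc.d\<omega> t * z"
    using assms by (simp_all add: mass_density_def velocity_def scaled_field_def w_def z_def)
  have d: "(mass_density t has_real_derivative K / w ^ 3 * pr.d\<delta> z / w) (at r within {0..})"
    "(velocity t has_real_derivative sc.d\<omega> t / w) (at r within {0..})"
    using density_deriv_r[of t r] velocity_deriv_r[of t r] assms by (simp_all add: w_def z_def)
  have "((\<lambda>r. r\<^sup>2 * mass_density t r * velocity t r) has_real_derivative
      (2 * r * mass_density t r + K / w ^ 3 * pr.d\<delta> z / w * r\<^sup>2) * velocity t r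
      + sc.d\<omega> t / w * (r\<^sup>2 * mass_density t r)) (at r within {0..})"
    by (auto intro!: derivative_eq_intros d)
  from vector_derivative_real[OF this at_within_atLeast_neq_bot]
  have flux: "partial_r (\<lambda>t r. r\<^sup>2 * mass_density t r * velocity t r) t r =
      (2 * r * (K / w ^ 3 * \<delta> z) + K / w ^ 3 * pr.d\<delta> z / w * r\<^sup>2) * (sc.d\<omega> t * z)
      + sc.d\<omega> t / w * (r\<^sup>2 * (K / w ^ 3 * \<delta> z))"
    using assms unfolding vals by (simp add: partial_r_def)
  have rate: "partial_t {0..} mass_density t r = - (3 * K * sc.d\<omega> t / w ^ 4) * \<delta> z
      - K / w ^ 3 * pr.d\<delta> z * (r * sc.d\<omega> t / w\<^sup>2)"
    using density_partial_t[of t r] assms by (simp add: w_def z_def)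
  show ?thesis
    unfolding flux rate unfolding r(1) using w r(2)
    by (simp add: field_simps power2_eq_square eval_nat_numeral)
qed

text \<open>By the homogeneity of the pressures every term is a multiple of the same power of \<open>\<omega>\<close>. The profile
  equation leaves the term with \<open>\<alpha>\<close> unbalanced, and the equation of \<open>\<omega>\<close> supplies the matching
  acceleration.\<close>

lemma momentum_balance:
  assumes "0 \<le> t" "0 < r" "r < Z * \<omega> t"
  shows "mass_density t r * (partial_t {0..} velocity t r + velocity t r * partial_r velocity t r) =
    - partial_r radial_pressure t r + 2 / r * (tangential_pressure t r - radial_pressure t r)
    - G * mass_density t r * (mass mass_density t r / r\<^sup>2)"
proof -
  define w z where "w = \<omega> t" and "z = r / w"
  have w: "0 < w" unfolding w_def by (rule \<omega>_pos[OF assms(1)])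
  have r: "r = z * w" "0 < z" using w assms by (simp_all add: z_def)
  have zI: "z \<in> pr.I" using scaled_radius_mem[of t r] assms by (simp add: z_def w_def)
  have vals: "mass_density t r = K / w ^ 3 * \<delta> z" "velocity t r = sc.d\<omega> t * z"
    "radial_pressure t r = Fr z / w ^ 4" "tangential_pressure t r = Ft z / w ^ 4"
    using assms by (simp_all add: mass_density_def velocity_def radial_pressure_def
        tangential_pressure_def scaled_field_def w_def z_def)
  have p: "partial_r radial_pressure t r = dF_rad z / w ^ 5" "partial_r velocity t r = sc.d\<omega> t / w"
    using radial_pressure_partial_r[of t r] velocity_partial_r[of t r] assms
    by (simp_all add: w_def z_def eval_nat_numeral)
  have "partial_t {0..} velocity t r = k / w\<^sup>2 * z - sc.d\<omega> t * (z * w * sc.d\<omega> t / w\<^sup>2)"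
    using velocity_partial_t[of t r] assms w by (simp add: w_def z_def)
  then have acc: "partial_t {0..} velocity t r + velocity t r * partial_r velocity t r = k / w\<^sup>2 * z"
    unfolding p vals using w by (simp add: power2_eq_square)
  then have lhs: "mass_density t r * (partial_t {0..} velocity t r + velocity t r * partial_r velocity t r)
      = K * \<delta> z * z * k / w ^ 5"
    unfolding acc vals(1) using w by (simp add: field_simps eval_nat_numeral)
  have gravity: "c * \<theta> = 4 * pi / 3 * G * K\<^sup>2"
  proof -
    have "1 + \<nu> \<noteq> 0" "1 - \<nu> \<noteq> 0" "\<kappa> \<noteq> 0" using \<nu>_gt \<nu>_le \<kappa>_pos by auto
    then show ?thesis by (simp add: \<theta>_const_def divide_simps)
  qed
  have "dF_rad z = 2 / z * (Ft z - Fr z) - c * \<theta> * z * \<delta> z * (\<eta> z + \<alpha>)"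
    using zI r(2) \<nu>_gt \<nu>_le yb(3) by (intro pr.radial_force_balance) auto
  then have dF: "dF_rad z = 2 / z * (Ft z - Fr z) - 4 * pi / 3 * G * K\<^sup>2 * z * \<delta> z * (\<eta> z + \<alpha>)"
    unfolding gravity .
  have M: "mass mass_density t r = 4 * pi / 3 * K * z ^ 3 * \<eta> z"
    using mass_eq[of t r] assms by (simp add: w_def z_def)
  show ?thesis
    unfolding lhs unfolding p(1) M dF vals unfolding r(1) using w r(2)
    by (simp add: field_simps eval_nat_numeral)
qed

lemma fields_positive:
  assumes "0 \<le> t" "0 \<le> r" "r < Z * \<omega> t"
  shows "0 < mass_density t r" "0 < radial_pressure t r" "radial_pressure t r \<le> tangential_pressure t r"
proof -
  have w: "0 < \<omega> t" by (rule \<omega>_pos[OF assms(1)])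
  have z: "0 \<le> r / \<omega> t" "r / \<omega> t < Z" "r / \<omega> t \<in> pr.I"
    using scaled_radius_mem[of t r] assms w by (auto simp: pos_divide_less_eq)
  have "0 < Fr (r / \<omega> t)"
    using F_rad_sign(1) \<nu>_gt \<nu>_le \<beta>_gt \<kappa>_pos pr.\<delta>_pos pr.\<eta>_pos yb(1) z ratio_inside by simp
  moreover have "Fr (r / \<omega> t) \<le> Ft (r / \<omega> t)"
    by (intro F_tan_ge_F_rad \<nu>_gt \<nu>_le \<beta>_gt \<beta>_le \<kappa>_pos pr.\<delta>_pos pr.\<delta>_le_\<eta> z)
  ultimately show "0 < mass_density t r" "0 < radial_pressure t r"
    "radial_pressure t r \<le> tangential_pressure t r"
    using assms w K_pos pr.\<delta>_pos[OF z(3)]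
    by (simp_all add: mass_density_def radial_pressure_def tangential_pressure_def scaled_field_def
        divide_right_mono)
qed

end

section \<open>Existence and uniqueness of the ball\<close>

context polytropic_ball
begin

lemma radius_C1: "0 < T \<Longrightarrow> C1_on {0..T} (\<lambda>t. Z * \<omega> t)"
  and radius_velocity: "0 \<le> t \<Longrightarrow> vector_derivative (\<lambda>t. Z * \<omega> t) (at t within {0..}) = Z * sc.d\<omega> t"
proof -
  have der: "((\<lambda>t. Z * \<omega> t) has_real_derivative Z * sc.d\<omega> t) (at t within S)"
    if "time_domain S" "t \<in> S" for S t
    by (rule DERIV_cmult[OF \<omega>_deriv_within(1)[OF that]])
  have vd: "vector_derivative (\<lambda>t. Z * \<omega> t) (at t within S) = Z * sc.d\<omega> t"
    if "time_domain S" "t \<in> S" for S t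
    by (rule vector_derivative_real[OF der[OF that] time_domain_limit[OF that]])
  show "vector_derivative (\<lambda>t. Z * \<omega> t) (at t within {0..}) = Z * sc.d\<omega> t" if "0 \<le> t"
    using vd[of "{0..}" t] that by simp
  show "C1_on {0..T} (\<lambda>t. Z * \<omega> t)" if "0 < T"
    unfolding C1_on_def
  proof
    show "(\<lambda>t. Z * \<omega> t) differentiable_on {0..T}"
      unfolding differentiable_on_def
      using der[OF time_domain_cases(2)[OF that]] has_field_derivative_imp_has_derivative
      by (blast intro: differentiableI)
    have "continuous_on {0..T} (\<lambda>t. Z * sc.d\<omega> t)"
      using that by (intro continuous_intros d\<omega>_cont_on) simp
    then show "continuous_on {0..T} (\<lambda>t. vector_derivative (\<lambda>t. Z * \<omega> t) (at t within {0..T}))"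
      by (rule continuous_on_eq) (simp add: vd[OF time_domain_cases(2)[OF that]])
  qed
qed

lemma radius_pos: "0 \<le> t \<Longrightarrow> 0 < Z * \<omega> t"
  using \<omega>_pos Z_pos by simp

lemma F_rad_eq_F_tan_center: "Ft 0 = Fr 0"
  using pr.ratio_center by (simp add: F_tan_def)

lemma ball_of_matter:
  assumes T: "0 < T"
  shows "ball_of_matter T (\<lambda>t. Z * \<omega> t) mass_density radial_pressure tangential_pressure velocity"
proof -
  note S = time_domain_cases(2)[OF T]
  obtain dF_tan where tan: "\<And>z. z \<in> {0..<Zm} \<Longrightarrow>
      (Ft has_real_derivative dF_tan z) (at z within {0..})"
    "continuous_on {0..<Zm} dF_tan" and tan0: "dF_tan 0 = 0"
    by (rule F_tan_deriv) (rule that)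
  note fields = density_field[OF S] pressure_field[OF S F_rad_deriv dF_rad_cont]
    pressure_field[OF S tan] velocity_field[OF S]
  note folds = mass_density_def[symmetric] radial_pressure_def[symmetric]
    tangential_pressure_def[symmetric] velocity_def[symmetric]
  have C1: "continuous_on (ball_closed {0..T} (\<lambda>t. Z * \<omega> t)) (\<lambda>(t, r). f t r) \<and>
      C1_in_ball {0..T} (\<lambda>t. Z * \<omega> t) f \<and> (\<forall>t\<in>{0..T}. \<forall>r>Z * \<omega> t. f t r = 0)"
    if "f \<in> {mass_density, radial_pressure, tangential_pressure, velocity}" for f
    using that fields[THEN self_similar_field.scaled_field_cont, unfolded folds]
      fields[THEN self_similar_field.scaled_field_C1, unfolded folds]
      fields[THEN self_similar_field.scaled_field_zero, unfolded folds]
    by blast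
  have lim: "(partial_r f t \<longlongrightarrow> 0) (at_right 0)"
    if "f \<in> {mass_density, radial_pressure, tangential_pressure}" "t \<in> {0..T}" for f t
    using that fields(1-3)[THEN self_similar_field.partial_r_at_center, of t, unfolded folds]
      pr.dpressure_center tan0 by (auto simp: pr.d\<delta>_def)
  have "(partial_r velocity t \<longlongrightarrow> sc.d\<omega> t / \<omega> t) (at_right 0)" if "t \<in> {0..T}" for t
    using self_similar_field.partial_r_at_center[OF fields(4) that, unfolded folds] by simp
  moreover have "((\<lambda>r. velocity t r / r) \<longlongrightarrow> sc.d\<omega> t / \<omega> t) (at_right 0)" if "t \<in> {0..T}" for t
  proof -
    have "eventually (\<lambda>r. sc.d\<omega> t / \<omega> t = velocity t r / r) (at_right 0)"
      unfolding eventually_at_right_field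
      using that radius_pos[of t]
      by (intro exI[of _ "Z * \<omega> t"]) (auto simp: velocity_def scaled_field_def)
    then show ?thesis by (rule Lim_transform_eventually[OF tendsto_const])
  qed
  moreover have "continuous_on {0..T} (\<lambda>t. sc.d\<omega> t / \<omega> t)"
  proof -
    have "\<forall>t\<in>{0..T}. \<omega> t \<noteq> 0" using \<omega>_pos by fastforce
    then show ?thesis by (intro continuous_intros d\<omega>_cont_on \<omega>_cont_on S)
  qed
  ultimately have expansion: "\<exists>L. continuous_on {0..T} L \<and> (\<forall>t\<in>{0..T}.
      (partial_r velocity t \<longlongrightarrow> L t) (at_right 0) \<and> ((\<lambda>r. velocity t r / r) \<longlongrightarrow> L t) (at_right 0))"
    by (intro exI[of _ "\<lambda>t. sc.d\<omega> t / \<omega> t"]) blast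
  have center: "radial_pressure t 0 = tangential_pressure t 0 \<and>
      partial_t {0..T} radial_pressure t 0 = partial_t {0..T} tangential_pressure t 0 \<and>
      velocity t 0 = 0 \<and> partial_t {0..T} velocity t 0 = 0" if t: "t \<in> {0..T}" for t
  proof -
    have "0 < Z * \<omega> t" using t radius_pos[of t] by simp
    then have "partial_t {0..T} radial_pressure t 0 = partial_t {0..T} tangential_pressure t 0"
      "partial_t {0..T} velocity t 0 = 0"
      using fields(2-4)[THEN self_similar_field.partial_t_scaled_field, of t 0, unfolded folds] t
        F_rad_eq_F_tan_center by simp_all
    then show ?thesis
      using F_rad_eq_F_tan_center
      by (simp add: radial_pressure_def tangential_pressure_def velocity_def scaled_field_def)
  qed
  have "0 < mass_density t r \<and> 0 < radial_pressure t r \<and> 0 < tangential_pressure t r"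
    if "(t, r) \<in> ball_interior {0..T} (\<lambda>t. Z * \<omega> t)" for t r
    using fields_positive[of t r] that by (auto simp: ball_interior_def)
  then show ?thesis
    unfolding ball_of_matter_def
    using radius_C1[OF T] radius_pos C1 center lim expansion by auto
qed

lemma homologous_elastic_ball:
  "homologous_elastic_ball G K \<kappa> \<nu> \<beta> \<alpha> \<omega> \<infinity> \<delta> \<eta> (ereal Zm) Z (\<lambda>t. Z * \<omega> t)
     mass_density radial_pressure tangential_pressure velocity"
proof -
  have scale: "maximal_scale_factor G K \<alpha> \<omega> \<infinity>"
    using scale_factor by (simp add: maximal_scale_factor_def)
  have boundary: "velocity t (Z * \<omega> t) = vector_derivative (\<lambda>t. Z * \<omega> t) (at t within {0..}) \<and>
      radial_pressure t (Z * \<omega> t) = 0" if t: "0 \<le> t" for t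
  proof -
    have w: "0 < \<omega> t" by (rule \<omega>_pos[OF t])
    have "Z \<in> pr.I" using Z_pos Z_less by simp
    then have "Fr Z = 0"
      using F_rad_sign(2) \<nu>_gt \<nu>_le \<beta>_gt \<kappa>_pos pr.\<delta>_pos pr.\<eta>_pos yb(1) ratio_Z by simp
    then show ?thesis
      using w radius_velocity[OF t]
      by (simp add: velocity_def radial_pressure_def scaled_field_def)
  qed
  have state: "radial_pressure t r = F_rad \<kappa> \<nu> \<beta> (mass_density t r / K) (mean_compression K mass_density t r) \<and>
      tangential_pressure t r = F_tan \<kappa> \<nu> \<beta> (mass_density t r / K) (mean_compression K mass_density t r) \<and>
      velocity t r = vector_derivative \<omega> (at t within {0..}) / \<omega> t * r \<and>
      mass_density t r / K = \<delta> (r / \<omega> t) / \<omega> t ^ 3 \<and>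
      mean_compression K mass_density t r = \<eta> (r / \<omega> t) / \<omega> t ^ 3"
    if "0 \<le> t" "0 \<le> r" "r \<le> Z * \<omega> t" for t r
  proof -
    have w: "0 < \<omega> t" by (rule \<omega>_pos[OF that(1)])
    have d: "mass_density t r / K = \<delta> (r / \<omega> t) / \<omega> t ^ 3"
      using that K_pos by (simp add: mass_density_def scaled_field_def)
    have e: "mean_compression K mass_density t r = \<eta> (r / \<omega> t) / \<omega> t ^ 3"
      by (rule mean_compression_eq[OF that])
    have "0 < \<eta> (r / \<omega> t)" by (rule pr.\<eta>_pos[OF scaled_radius_mem(3)[OF that]])
    then show ?thesis
      unfolding d e using that w
      by (simp add: F_rad_scale F_tan_scale radial_pressure_def tangential_pressure_def
          velocity_def scaled_field_def sc.d\<omega>_def)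
  qed
  show ?thesis
    unfolding homologous_elastic_ball_def Let_def from_zero_to_infinity
    using \<alpha>_pos scale max_profile Z_pos Z_less ball_of_matter boundary state
      mass_conservation momentum_balance
    by (auto simp: ball_closed_def)
qed

lemma expanding_ball:
  "expanding_ball_type_A G K \<kappa> \<nu> \<beta> \<alpha> (\<lambda>t. Z * \<omega> t)
     mass_density radial_pressure tangential_pressure velocity"
proof -
  have "ereal Z < ereal Zm" "ereal Zm < \<infinity>" using Z_less by simp_all
  then show ?thesis
    unfolding expanding_ball_type_A_def using homologous_elastic_ball \<alpha>_pos Z_pos by blast
qed

text \<open>Scale factor and profile of the competing ball agree with the given ones by uniqueness for the two
  ordinary differential equations; the central density fixes the central value. Positivity of the
  radial pressure inside and its vanishing at the surface, both at time \<open>0\<close>, then force the same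
  surface radius, and all fields are determined by these data.\<close>

lemma expanding_ball_unique:
  assumes ball: "expanding_ball_type_A G K \<kappa> \<nu> \<beta> \<alpha> R' \<rho> p q u"
    and center: "\<And>t. 0 \<le> t \<Longrightarrow> \<rho> t 0 = K * \<delta> 0 / \<omega> t ^ 3"
    and tr: "0 \<le> t" "0 \<le> r"
  shows "\<rho> t r = mass_density t r \<and> p t r = radial_pressure t r \<and>
    q t r = tangential_pressure t r \<and> u t r = velocity t r"
proof -
  obtain \<omega>' T' \<delta>' \<eta>' Zm' Z' where hom:
    "homologous_elastic_ball G K \<kappa> \<nu> \<beta> \<alpha> \<omega>' T' \<delta>' \<eta>' Zm' Z' R' \<rho> p q u"
    using ball unfolding expanding_ball_type_A_def by blast
  have "maximal_scale_factor G K \<alpha> \<omega>' T'"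
    using hom unfolding homologous_elastic_ball_def Let_def by blast
  note scale' = maximal_scale_factor_global[OF G_pos K_pos \<alpha>_pos scale_factor this]
  note hom = hom[unfolded homologous_elastic_ball_def Let_def scale'(1) from_zero_to_infinity]
  have Z': "0 < Z'" "ereal Z' < Zm'" using hom by blast+
  have on_domain: "\<forall>t\<in>{0..}. R' t = Z' * \<omega>' t"
    "\<forall>T>0. T \<in> {0..} \<longrightarrow> ball_of_matter T R' \<rho> p q u"
    "\<forall>t\<in>{0..}. u t (R' t) = vector_derivative R' (at t within {0..}) \<and> p t (R' t) = 0"
    using hom by blast+
  have R': "R' t = Z' * \<omega> t" if "0 \<le> t" for t using on_domain(1) that scale'(2) by simp
  have bom: "ball_of_matter T R' \<rho> p q u" if "0 < T" for T using on_domain(2) that by simp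
  have p_boundary: "p 0 Z' = 0" using on_domain(3) R'[of 0] sc.\<omega>_0 by force
  have hom_forms: "\<forall>(t, r)\<in>ball_closed {0..} R'.
      p t r = F_rad \<kappa> \<nu> \<beta> (\<rho> t r / K) (mean_compression K \<rho> t r) \<and>
      q t r = F_tan \<kappa> \<nu> \<beta> (\<rho> t r / K) (mean_compression K \<rho> t r)"
    "\<forall>(t, r)\<in>ball_closed {0..} R'.
      u t r = vector_derivative \<omega>' (at t within {0..}) / \<omega>' t * r \<and>
      \<rho> t r / K = \<delta>' (r / \<omega>' t) / \<omega>' t ^ 3 \<and>
      mean_compression K \<rho> t r = \<eta>' (r / \<omega>' t) / \<omega>' t ^ 3"
    using hom by blast+
  have velocity': "vector_derivative \<omega>' (at t within {0..}) = sc.d\<omega> t" if "0 \<le> t" for t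
    unfolding sc.d\<omega>_def from_zero_to_infinity
    by (rule vector_derivative_cong_eq) (use scale'(2) that in auto)
  have forms: "u t r = sc.d\<omega> t / \<omega> t * r" "\<rho> t r = K * (\<delta>' (r / \<omega> t) / \<omega> t ^ 3)"
    "p t r = F_rad \<kappa> \<nu> \<beta> (\<delta>' (r / \<omega> t) / \<omega> t ^ 3) (\<eta>' (r / \<omega> t) / \<omega> t ^ 3)"
    "q t r = F_tan \<kappa> \<nu> \<beta> (\<delta>' (r / \<omega> t) / \<omega> t ^ 3) (\<eta>' (r / \<omega> t) / \<omega> t ^ 3)"
    if "0 \<le> t" "0 \<le> r" "r \<le> Z' * \<omega> t" for t r
  proof -
    have mem: "(t, r) \<in> ball_closed {0..} R'" using that R' by (simp add: ball_closed_def)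
    have d: "\<rho> t r / K = \<delta>' (r / \<omega> t) / \<omega> t ^ 3"
      and e: "mean_compression K \<rho> t r = \<eta>' (r / \<omega> t) / \<omega> t ^ 3"
      and v: "u t r = sc.d\<omega> t / \<omega> t * r"
      using bspec[OF hom_forms(2) mem] scale'(2)[OF that(1)] velocity'[OF that(1)] by simp_all
    show "u t r = sc.d\<omega> t / \<omega> t * r" by (rule v)
    show "\<rho> t r = K * (\<delta>' (r / \<omega> t) / \<omega> t ^ 3)" using d K_pos by (simp add: field_simps)
    show "p t r = F_rad \<kappa> \<nu> \<beta> (\<delta>' (r / \<omega> t) / \<omega> t ^ 3) (\<eta>' (r / \<omega> t) / \<omega> t ^ 3)"
      "q t r = F_tan \<kappa> \<nu> \<beta> (\<delta>' (r / \<omega> t) / \<omega> t ^ 3) (\<eta>' (r / \<omega> t) / \<omega> t ^ 3)"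
      using bspec[OF hom_forms(1) mem] d e by simp_all
  qed
  have "strongly_regular_profile \<theta> \<beta> \<alpha> \<delta>' \<eta>' Zm'"
    using hom unfolding maximal_strongly_regular_profile_def by blast
  then interpret pr': profile \<theta> \<beta> \<alpha> \<delta>' \<eta>' Zm'
    by unfold_locales (use \<theta>_pos \<beta>_gt \<beta>_le \<alpha>_pos in auto)
  have "K * \<delta>' 0 = K * \<delta> 0"
    using forms(2)[of 0 0] center[of 0] Z' sc.\<omega>_0 by auto
  then have "\<delta> 0 = \<delta>' 0" using K_pos by simp
  then have same: "\<delta> z = \<delta>' z \<and> \<eta> z = \<eta>' z" if "z \<in> pr.I" "z \<in> from_zero_to Zm'" for z
    by (rule profile_unique[OF pr.profile_axioms pr'.profile_axioms _ that])
  have Z'_mem: "z \<in> from_zero_to Zm'" if "0 \<le> z" "z \<le> Z'" for z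
    by (rule from_zero_to_mono[of Z']) (use Z' that in \<open>auto simp: from_zero_to_iff\<close>)
  have sign: "y_b \<nu> \<beta> < \<delta>' z / \<eta>' z" if "0 \<le> z" "z < Z'" for z
  proof -
    have "(0, z) \<in> ball_interior {0..1} R'"
      using that R'[of 0] sc.\<omega>_0 by (simp add: ball_interior_def)
    then have "0 < p 0 z" using bom[of 1] unfolding ball_of_matter_def by auto
    then show ?thesis
      using forms(3)[of 0 z] that sc.\<omega>_0 F_rad_sign(1) \<nu>_gt \<nu>_le \<beta>_gt \<kappa>_pos yb(1)
        pr'.\<delta>_pos[OF Z'_mem[of z]] pr'.\<eta>_pos[OF Z'_mem[of z]] by simp
  qed
  have ratio_Z': "\<delta>' Z' / \<eta>' Z' = y_b \<nu> \<beta>"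
    using forms(3)[of 0 Z'] p_boundary Z' sc.\<omega>_0 F_rad_sign(2) \<nu>_gt \<nu>_le \<beta>_gt \<kappa>_pos yb(1)
      pr'.\<delta>_pos[OF Z'_mem[of Z']] pr'.\<eta>_pos[OF Z'_mem[of Z']] by simp
  have "\<not> Z < Z'"
  proof
    assume "Z < Z'"
    then show False
      using sign[of Z] same[of Z] Z'_mem[of Z] ratio_Z Z_pos Z_less by simp
  qed
  moreover have "\<not> Z' < Z"
  proof
    assume "Z' < Z"
    then show False
      using ratio_inside[of Z'] same[of Z'] Z'_mem[of Z'] ratio_Z' Z' Z_less by simp
  qed
  ultimately have ZZ: "Z' = Z" by simp
  show ?thesis
  proof (cases "r \<le> Z * \<omega> t")
    case True
    let ?z = "r / \<omega> t"
    have w: "0 < \<omega> t" by (rule \<omega>_pos[OF tr(1)])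
    have z: "0 \<le> ?z" "?z \<le> Z" "?z \<in> pr.I" using scaled_radius_mem[OF tr True] by auto
    have "\<delta>' ?z = \<delta> ?z" "\<eta>' ?z = \<eta> ?z"
      using same[OF z(3) Z'_mem] z ZZ by simp_all
    then show ?thesis
      using forms[OF tr] True ZZ w pr.\<eta>_pos[OF z(3)]
      by (simp add: F_rad_scale F_tan_scale mass_density_def radial_pressure_def
          tangential_pressure_def velocity_def scaled_field_def)
  next
    case False
    then have "R' t < r" using R'[OF tr(1)] ZZ by simp
    moreover have "ball_of_matter (t + 1) R' \<rho> p q u" using bom tr by simp
    ultimately have "\<rho> t r = 0 \<and> p t r = 0 \<and> q t r = 0 \<and> u t r = 0"
      using tr unfolding ball_of_matter_def by auto
    then show ?thesis
      using False by (simp add: mass_density_def radial_pressure_def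
          tangential_pressure_def velocity_def scaled_field_def)
  qed
qed

end

theorem theorem2:
  fixes G K \<kappa> \<nu> \<alpha> \<beta> \<delta>\<^sub>c :: real
    and \<omega> \<delta>\<^sub>0 \<eta>\<^sub>0 :: "real \<Rightarrow> real"
    and Zmax :: ereal
  assumes "0 < G" "0 < K" "0 < \<kappa>"
    and "- 1 < \<nu>" "\<nu> \<le> 1/2"
    and "0 < \<alpha>"
    and "1 < \<beta>" "\<beta> \<le> 4/3"
    and "scale_factor G K \<alpha> \<omega> \<infinity>"
    and "0 < \<delta>\<^sub>c"
    and "maximal_strongly_regular_profile (\<theta>_const G K \<kappa> \<nu>) \<beta> \<alpha> \<delta>\<^sub>0 \<eta>\<^sub>0 Zmax"
    and "\<delta>\<^sub>0 0 = \<delta>\<^sub>c"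
  shows "(\<exists>Zm. Zmax = ereal Zm \<and>
            (\<forall>z\<in>{0<..<Zm}. 0 < \<delta>\<^sub>0 z / \<eta>\<^sub>0 z \<and> \<delta>\<^sub>0 z / \<eta>\<^sub>0 z < 1) \<and>
            filterlim (\<lambda>z. \<delta>\<^sub>0 z / \<eta>\<^sub>0 z) (at_right 0) (at_left Zm)) \<and>
         (\<not> (\<beta> = 4/3 \<and> \<nu> = 1/2) \<longrightarrow>
          (\<exists>Z. 0 < Z \<and> ereal Z < Zmax \<and> \<delta>\<^sub>0 Z / \<eta>\<^sub>0 Z = y_b \<nu> \<beta> \<and>
             (\<forall>z\<in>{0<..<Z}. \<delta>\<^sub>0 z / \<eta>\<^sub>0 z \<noteq> y_b \<nu> \<beta>) \<and>
             (\<exists>\<rho> p_rad p_tan u.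
                expanding_ball_type_A G K \<kappa> \<nu> \<beta> \<alpha> (\<lambda>t. Z * \<omega> t) \<rho> p_rad p_tan u \<and>
                (\<forall>t\<ge>0. \<rho> t 0 = K * \<delta>\<^sub>c / \<omega> t ^ 3) \<and>
                (\<forall>R' \<rho>' p_rad' p_tan' u'.
                   expanding_ball_type_A G K \<kappa> \<nu> \<beta> \<alpha> R' \<rho>' p_rad' p_tan' u' \<and>
                   (\<forall>t\<ge>0. \<rho>' t 0 = K * \<delta>\<^sub>c / \<omega> t ^ 3) \<longrightarrow>
                   (\<forall>t\<ge>0. \<forall>r\<ge>0. \<rho>' t r = \<rho> t r \<and> p_rad' t r = p_rad t r \<and>
                      p_tan' t r = p_tan t r \<and> u' t r = u t r)) \<and>
                (\<forall>t\<ge>0. \<forall>r. 0 \<le> r \<and> r < Z * \<omega> t \<longrightarrow> p_tan t r \<ge> p_rad t r))))"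
proof -
  have "0 < \<theta>_const G K \<kappa> \<nu>"
    using assms(1-5) by (simp add: \<theta>_const_def)
  then have profile: "profile (\<theta>_const G K \<kappa> \<nu>) \<beta> \<alpha> \<delta>\<^sub>0 \<eta>\<^sub>0 Zmax"
    using assms(6-8,11) by (simp add: profile_def maximal_strongly_regular_profile_def)
  then interpret prof: profile "\<theta>_const G K \<kappa> \<nu>" \<beta> \<alpha> \<delta>\<^sub>0 \<eta>\<^sub>0 Zmax .
  obtain Zm where Zm: "Zmax = ereal Zm"
    and vacuum: "filterlim (\<lambda>z. \<delta>\<^sub>0 z / \<eta>\<^sub>0 z) (at_right 0) (at_left Zm)"
    by (rule maximal_profile_ends_at_vacuum[OF profile assms(11)])
  have bounds: "0 < \<delta>\<^sub>0 z / \<eta>\<^sub>0 z \<and> \<delta>\<^sub>0 z / \<eta>\<^sub>0 z < 1" if "z \<in> {0<..<Zm}" for z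
    using prof.ratio_bounds[of z] that Zm by simp
  show ?thesis
  proof (rule conjI, goal_cases)
    case 1
    show ?case by (rule exI[of _ Zm]) (use Zm bounds vacuum in blast)
  next
    case 2
    show ?case (is "_ \<longrightarrow> ?ball")
    proof
      assume nondeg: "\<not> (\<beta> = 4/3 \<and> \<nu> = 1/2)"
      obtain Z where Z: "0 < Z" "Z < Zm" "\<delta>\<^sub>0 Z / \<eta>\<^sub>0 Z = y_b \<nu> \<beta>"
        "\<And>z. 0 \<le> z \<Longrightarrow> z < Z \<Longrightarrow> y_b \<nu> \<beta> < \<delta>\<^sub>0 z / \<eta>\<^sub>0 z"
        by (rule prof.first_ratio_crossing[OF Zm vacuum y_b_bounds(1)[OF assms(4,5,7,8) nondeg]
              y_b_bounds(2)[OF assms(4,5,7,8) nondeg]]) (rule that)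
      interpret polytropic_ball G K \<kappa> \<nu> \<beta> \<alpha> \<omega> \<delta>\<^sub>0 \<eta>\<^sub>0 Zm Z
        using assms nondeg Z Zm by unfold_locales auto
      have center: "mass_density t 0 = K * \<delta>\<^sub>c / \<omega> t ^ 3" if "0 \<le> t" for t
        using radius_pos[OF that] assms(12) by (simp add: mass_density_def scaled_field_def)
      have order: "radial_pressure t r \<le> tangential_pressure t r"
        if "0 \<le> t" "0 \<le> r" "r < Z * \<omega> t" for t r
        by (rule fields_positive(3)[OF that])
      have first: "\<delta>\<^sub>0 z / \<eta>\<^sub>0 z \<noteq> y_b \<nu> \<beta>" if "z \<in> {0<..<Z}" for z
        using Z(4)[of z] that by simp
      have inside: "ereal Z < Zmax" using Z(2) Zm by simp
      show ?ball
      proof (rule exI[of _ Z], intro conjI, goal_cases)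
        case 5
        show ?case
        proof (rule exI[of _ mass_density], rule exI[of _ radial_pressure],
            rule exI[of _ tangential_pressure], rule exI[of _ velocity], intro conjI)
        show "expanding_ball_type_A G K \<kappa> \<nu> \<beta> \<alpha> (\<lambda>t. Z * \<omega> t)
            mass_density radial_pressure tangential_pressure velocity" by (rule expanding_ball)
        show "\<forall>t\<ge>0. mass_density t 0 = K * \<delta>\<^sub>c / \<omega> t ^ 3" using center by blast
        show "\<forall>R' \<rho>' p_rad' p_tan' u'.
            expanding_ball_type_A G K \<kappa> \<nu> \<beta> \<alpha> R' \<rho>' p_rad' p_tan' u' \<and>
            (\<forall>t\<ge>0. \<rho>' t 0 = K * \<delta>\<^sub>c / \<omega> t ^ 3) \<longrightarrow>
            (\<forall>t\<ge>0. \<forall>r\<ge>0. \<rho>' t r = mass_density t r \<and> p_rad' t r = radial_pressure t r \<and>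
               p_tan' t r = tangential_pressure t r \<and> u' t r = velocity t r)"
          by (intro allI impI, elim conjE, rule expanding_ball_unique, assumption)
            (simp_all add: assms(12))
        show "\<forall>t\<ge>0. \<forall>r. 0 \<le> r \<and> r < Z * \<omega> t \<longrightarrow> radial_pressure t r \<le> tangential_pressure t r"
          using order by blast
        qed
      qed (use Z(1,3) inside first in blast)+
    qed
  qed
qed

end
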